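(* Let $G$ be a quantum graph. The Bloch spectrum and the $\pi_1$-spectrum of $G$ are equal. There is a one-to-one correspondence $[\alpha]\mapsto\chi_\alpha$ between $H^1_{dR}(G,\mathbb{R})/H^1_{dR}(G,\mathbb{Z})$ and the set of characters $\pi_1(G)\to\mathbb{C}^*$ of $\pi_1(G)$. It is given by $$\chi_\alpha(\gamma)=e^{-2\pi i\int_\gamma\alpha},\qquad \gamma\in\pi_1(G),$$ and it induces the equality $\mathrm{Spec}(G,\chi_\alpha)=\mathrm{Spec}_\alpha(G)$.
   Context: Quantum graphs. A quantum graph $G$ is a finite connected graph (loops and multiple edges allowed, no vertices of degree $2$) with vertex set $V$ and edge set $E$, in which every edge $e$ has a length $L_e>0$ and is identified with the interval $[0,L_e]$. For a vertex $v$, $e\sim v$ ranges over the edges adjacent to $v$ (a loop at $v$ is counted once for each of its two ends), and $\nu_{v,e}$ is the outward unit normal of $e$ at $v$. A $0$-form is a continuous function $f$ on $G$ that is $C^\infty$ on each closed edge and satisfies $\sum_{e\sim v}\nu_{v,e}(f|_e)=0$ at every vertex $v$ (Kirchhoff condition). A $1$-form $\alpha$ consists of a smooth $1$-form $\alpha_e$ on each closed edge such that $\sum_{e\sim v}\alpha_e(\nu_{v,e})=0$ at every $v$. $H^1_{dR}(G,\mathbb{R})$ is the space of real $1$-forms modulo $d$ of real $0$-forms, and $H^1_{dR}(G,\mathbb{Z})$ is the subgroup of classes whose integrals over all closed walks are integers. Bloch spectrum. For a real $1$-form $\alpha$ put $d_\alpha f=df+2\pi i f\alpha$ and $\Delta_\alpha=d_\alpha^*d_\alpha$;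 explicitly, if $\alpha=a\,dx$ in the arc length coordinate on an edge, then $\Delta_\alpha f=-\left(\frac{d}{dx}+2\pi i a\right)^2 f$ on that edge. Its domain consists of the continuous $f$ that lie in the $L^2$-Sobolev space of order $2$ on each edge and satisfy the Kirchhoff condition at each vertex. $\mathrm{Spec}_\alpha(G)$ is the spectrum of $\Delta_\alpha$, with multiplicities; it depends only on the coset of $[\alpha]$ in $H^1_{dR}(G,\mathbb{R})/H^1_{dR}(G,\mathbb{Z})$. The Bloch spectrum is the map $[\alpha]\mapsto\mathrm{Spec}_\alpha(G)$ on this torus. $\pi_1$-spectrum. Let $\tilde G$ be the universal cover of $G$, on which the fundamental group $\pi_1(G)$ acts by deck transformations. A character of $\pi_1(G)$ is a homomorphism $\chi:\pi_1(G)\to\mathbb{C}^*$. For a character $\chi$, let $\Lambda^0_\chi(\tilde G)$ be the space of functions $\tilde f:\tilde G\to\mathbb{C}$ that are continuous, smooth on closed edges, satisfy the Kirchhoff conditions at all vertices, and satisfy $\tilde f(\gamma x)=\chi(\gamma)\tilde f(x)$ for all $x\in\tilde G$, $\gamma\in\pi_1(G)$. $\mathrm{Spec}(G,\chi)$ is the spectrum (with multiplicities) of the standard Laplacian $d^*d$ ($-d^2/dx^2$ on each edge) on $\tilde G$ restricted to functions in $\Lambda^0_\chi(\tilde G)$. The $\pi_1$-spectrum is the map $\chi\mapsto\mathrm{Spec}(G,\chi)$.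
   Formalization: The correspondence is proved onto the unitary characters (values of modulus 1) rather than all characters to C^*; for real α, |χ_α|=1 always, so the claim for all characters fails whenever π_1(G) is non-trivial. *)

theory Defs
  imports
    "HOL-Analysis.Analysis"
    "HOL-Algebra.Coset"
    "HOL-Library.Function_Algebras"
begin

section \<open>Metric graphs and quantum graphs\<close>

text \<open>
  Loops and multiple edges are allowed.  The edge \<open>e\<close> is the interval from \<open>0\<close>
  (at the vertex \<open>tail G e\<close>) to \<open>len G e\<close> (at \<open>head G e\<close>); the orientation only fixes the arc
  length coordinate.  The vertex and edge sets need not be finite, since the universal cover is
  also a metric graph.
\<close>

record ('v, 'e) metric_graph =
  verts :: "'v set"
  edges :: "'e set"
  tail :: "'e \<Rightarrow> 'v"
  head :: "'e \<Rightarrow> 'v"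
  len :: "'e \<Rightarrow> real"

text \<open>
  A dart \<open>(e, True)\<close> is \<open>e\<close> traversed from tail to head, \<open>(e, False)\<close> is \<open>e\<close> traversed backwards.
  The darts starting at \<open>v\<close> are the edge ends at \<open>v\<close>, so that a loop at \<open>v\<close> contributes two.
\<close>

fun dart_start :: "('v, 'e) metric_graph \<Rightarrow> 'e \<times> bool \<Rightarrow> 'v" where
  "dart_start G (e, b) = (if b then tail G e else head G e)"

fun rev_dart :: "'e \<times> bool \<Rightarrow> 'e \<times> bool" where
  "rev_dart (e, b) = (e, \<not> b)"

definition dart_end :: "('v, 'e) metric_graph \<Rightarrow> 'e \<times> bool \<Rightarrow> 'v" where
  "dart_end G d = dart_start G (rev_dart d)"

definition darts_at :: "('v, 'e) metric_graph \<Rightarrow> 'v \<Rightarrow> ('e \<times> bool) set" where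
  "darts_at G v = {d. fst d \<in> edges G \<and> dart_start G d = v}"

fun walk :: "('v, 'e) metric_graph \<Rightarrow> 'v \<Rightarrow> ('e \<times> bool) list \<Rightarrow> 'v \<Rightarrow> bool" where
  "walk G u [] v \<longleftrightarrow> u \<in> verts G \<and> u = v"
| "walk G u (d # p) v \<longleftrightarrow> d \<in> darts_at G u \<and> walk G (dart_end G d) p v"

definition quantum_graph :: "('v, 'e) metric_graph \<Rightarrow> bool" where
  "quantum_graph G \<longleftrightarrow>
     finite (verts G) \<and> verts G \<noteq> {} \<and> finite (edges G) \<and>
     (\<forall>e\<in>edges G. tail G e \<in> verts G \<and> head G e \<in> verts G \<and> len G e > 0) \<and>
     (\<forall>u\<in>verts G. \<forall>v\<in>verts G. \<exists>p. walk G u p v) \<and>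
     (\<forall>v\<in>verts G. card (darts_at G v) \<noteq> 2)"


section \<open>Functions and forms\<close>

text \<open>
  A function on a metric graph is a family \<open>f e x\<close> with \<open>x\<close> in \<open>[0, len G e]\<close>, normalised to be
  \<open>0\<close> for all other arguments so that equality is equality of functions on the graph.
  A 1-form \<open>\<alpha>\<close> is likewise given by its coefficients: \<open>\<alpha> e x dx\<close> on the edge \<open>e\<close>.
\<close>

definition supported :: "('v, 'e) metric_graph \<Rightarrow> ('e \<Rightarrow> real \<Rightarrow> 'a::zero) \<Rightarrow> bool" where
  "supported G f \<longleftrightarrow> (\<forall>e x. \<not> (e \<in> edges G \<and> x \<in> {0..len G e}) \<longrightarrow> f e x = 0)"

definition smooth_on_edge :: "real \<Rightarrow> (real \<Rightarrow> 'a::real_normed_vector) \<Rightarrow> bool" where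
  "smooth_on_edge L f \<longleftrightarrow>
     (\<exists>D :: nat \<Rightarrow> real \<Rightarrow> 'a. (\<forall>x\<in>{0..L}. D 0 x = f x) \<and>
        (\<forall>n. \<forall>x\<in>{0..L}. (D n has_vector_derivative D (Suc n) x) (at x within {0..L})))"

definition edge_deriv :: "real \<Rightarrow> (real \<Rightarrow> 'a::real_normed_vector) \<Rightarrow> real \<Rightarrow> 'a" where
  "edge_deriv L f x = vector_derivative f (at x within {0..L})"

definition end_point :: "('v, 'e) metric_graph \<Rightarrow> 'e \<times> bool \<Rightarrow> real" where
  "end_point G d = (if snd d then 0 else len G (fst d))"

text \<open>The outward unit normal at an edge end is \<open>-d/dx\<close> at \<open>x = 0\<close> and \<open>d/dx\<close> at \<open>x = len G e\<close>.\<close>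

definition normal_sign :: "'e \<times> bool \<Rightarrow> real" where
  "normal_sign d = (if snd d then - 1 else 1)"

definition continuous_at_vertices ::
    "('v, 'e) metric_graph \<Rightarrow> ('e \<Rightarrow> real \<Rightarrow> 'a) \<Rightarrow> bool" where
  "continuous_at_vertices G f \<longleftrightarrow>
     (\<forall>v\<in>verts G. \<exists>c. \<forall>d\<in>darts_at G v. f (fst d) (end_point G d) = c)"

definition kirchhoff ::
    "('v, 'e) metric_graph \<Rightarrow> ('e \<Rightarrow> real \<Rightarrow> 'a::real_normed_vector) \<Rightarrow> bool" where
  "kirchhoff G f \<longleftrightarrow>
     (\<forall>v\<in>verts G. (\<Sum>d\<in>darts_at G v.
        normal_sign d *\<^sub>R edge_deriv (len G (fst d)) (f (fst d)) (end_point G d)) = 0)"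

definition zero_forms ::
    "('v, 'e) metric_graph \<Rightarrow> ('e \<Rightarrow> real \<Rightarrow> 'a::real_normed_vector) set" where
  "zero_forms G = {f. supported G f \<and> (\<forall>e\<in>edges G. smooth_on_edge (len G e) (f e)) \<and>
     continuous_at_vertices G f \<and> kirchhoff G f}"

definition one_forms :: "('v, 'e) metric_graph \<Rightarrow> ('e \<Rightarrow> real \<Rightarrow> real) set" where
  "one_forms G = {\<alpha>. supported G \<alpha> \<and> (\<forall>e\<in>edges G. smooth_on_edge (len G e) (\<alpha> e)) \<and>
     (\<forall>v\<in>verts G. (\<Sum>d\<in>darts_at G v. normal_sign d * \<alpha> (fst d) (end_point G d)) = 0)}"

definition ext_d ::
    "('v, 'e) metric_graph \<Rightarrow> ('e \<Rightarrow> real \<Rightarrow> 'a::real_normed_vector) \<Rightarrow> 'e \<Rightarrow> real \<Rightarrow> 'a" where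
  "ext_d G f = (\<lambda>e x. if e \<in> edges G \<and> x \<in> {0..len G e}
                       then edge_deriv (len G e) (f e) x else 0)"

definition dart_integral ::
    "('v, 'e) metric_graph \<Rightarrow> ('e \<Rightarrow> real \<Rightarrow> real) \<Rightarrow> 'e \<times> bool \<Rightarrow> real" where
  "dart_integral G \<alpha> d =
     (if snd d then 1 else - 1) * integral {0..len G (fst d)} (\<alpha> (fst d))"

definition walk_integral ::
    "('v, 'e) metric_graph \<Rightarrow> ('e \<Rightarrow> real \<Rightarrow> real) \<Rightarrow> ('e \<times> bool) list \<Rightarrow> real" where
  "walk_integral G \<alpha> p = (\<Sum>d\<leftarrow>p. dart_integral G \<alpha> d)"


section \<open>De Rham cohomology\<close>

definition one_form_group :: "('v, 'e) metric_graph \<Rightarrow> ('e \<Rightarrow> real \<Rightarrow> real) monoid" where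
  "one_form_group G = \<lparr>carrier = one_forms G, mult = (+), one = 0\<rparr>"

definition exact_forms :: "('v, 'e) metric_graph \<Rightarrow> ('e \<Rightarrow> real \<Rightarrow> real) set" where
  "exact_forms G = ext_d G ` zero_forms G"

definition H1_dR :: "('v, 'e) metric_graph \<Rightarrow> ('e \<Rightarrow> real \<Rightarrow> real) set monoid" where
  "H1_dR G = one_form_group G Mod exact_forms G"

definition H1_dR_int :: "('v, 'e) metric_graph \<Rightarrow> ('e \<Rightarrow> real \<Rightarrow> real) set set" where
  "H1_dR_int G =
     {c \<in> carrier (H1_dR G). \<forall>\<alpha>\<in>c. \<forall>v p. walk G v p v \<longrightarrow> walk_integral G \<alpha> p \<in> \<int>}"

definition H1_torus :: "('v, 'e) metric_graph \<Rightarrow> ('e \<Rightarrow> real \<Rightarrow> real) set set monoid" where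
  "H1_torus G = H1_dR G Mod H1_dR_int G"

definition H1_class ::
    "('v, 'e) metric_graph \<Rightarrow> ('e \<Rightarrow> real \<Rightarrow> real) \<Rightarrow> ('e \<Rightarrow> real \<Rightarrow> real) set" where
  "H1_class G \<alpha> = exact_forms G #>\<^bsub>one_form_group G\<^esub> \<alpha>"

definition torus_class ::
    "('v, 'e) metric_graph \<Rightarrow> ('e \<Rightarrow> real \<Rightarrow> real) \<Rightarrow> ('e \<Rightarrow> real \<Rightarrow> real) set set" where
  "torus_class G \<alpha> = H1_dR_int G #>\<^bsub>H1_dR G\<^esub> H1_class G \<alpha>"


section \<open>Spectrum with multiplicities of an unbounded operator\<close>

text \<open>
  An operator in a (pre-Hilbert) space \<open>X\<close> of functions with \<open>L\<^sup>2\<close> norm \<open>N\<close> is given by its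
  graph \<open>T\<close>, a set of pairs \<open>(f, T f)\<close> with \<open>f\<close> in the domain, where \<open>T f\<close> is only relevant up to
  functions of norm \<open>0\<close>.  A number \<open>z\<close> is in the resolvent set if \<open>T - z\<close> has a bounded inverse
  with dense domain of definition.  For a closed operator in a Hilbert space this is the same as
  \<open>T - z\<close> being a bijection onto \<open>X\<close> with bounded inverse; the form used here is the usual one
  for operators that need not be closed, such as the Laplacian on smooth functions.
\<close>

definition cscale :: "complex \<Rightarrow> ('e \<Rightarrow> real \<Rightarrow> complex) \<Rightarrow> 'e \<Rightarrow> real \<Rightarrow> complex" where
  "cscale c f = (\<lambda>e x. c * f e x)"

definition resolvent_set ::
    "(('e \<Rightarrow> real \<Rightarrow> complex) \<Rightarrow> real) \<Rightarrow> ('e \<Rightarrow> real \<Rightarrow> complex) set \<Rightarrow>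
     (('e \<Rightarrow> real \<Rightarrow> complex) \<times> ('e \<Rightarrow> real \<Rightarrow> complex)) set \<Rightarrow> complex set" where
  "resolvent_set N X T =
     {z. (\<exists>C. \<forall>(f, g)\<in>T. N f \<le> C * N (g - cscale z f)) \<and>
         (\<forall>h\<in>X. \<forall>\<epsilon>>0. \<exists>(f, g)\<in>T. N (g - cscale z f - h) < \<epsilon>)}"

definition eigenspace ::
    "(('e \<Rightarrow> real \<Rightarrow> complex) \<Rightarrow> real) \<Rightarrow>
     (('e \<Rightarrow> real \<Rightarrow> complex) \<times> ('e \<Rightarrow> real \<Rightarrow> complex)) set \<Rightarrow> complex \<Rightarrow>
     ('e \<Rightarrow> real \<Rightarrow> complex) set" where
  "eigenspace N T z = {f. \<exists>g. (f, g) \<in> T \<and> N (g - cscale z f) = 0}"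

text \<open>The set of pairs (element of the spectrum, its multiplicity).\<close>

definition spectrum_mult ::
    "(('e \<Rightarrow> real \<Rightarrow> complex) \<Rightarrow> real) \<Rightarrow> ('e \<Rightarrow> real \<Rightarrow> complex) set \<Rightarrow>
     (('e \<Rightarrow> real \<Rightarrow> complex) \<times> ('e \<Rightarrow> real \<Rightarrow> complex)) set \<Rightarrow> (complex \<times> nat) set" where
  "spectrum_mult N X T =
     {(z, m). z \<notin> resolvent_set N X T \<and> m = vector_space.dim cscale (eigenspace N T z)}"

text \<open>The \<open>L\<^sup>2\<close> norm over the edges in \<open>S\<close>.\<close>

definition L2_norm_on ::
    "('v, 'e) metric_graph \<Rightarrow> 'e set \<Rightarrow> ('e \<Rightarrow> real \<Rightarrow> complex) \<Rightarrow> real" where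
  "L2_norm_on G S f =
     sqrt (\<Sum>e\<in>S. integral\<^sup>L (lebesgue_on {0..len G e}) (\<lambda>x. (cmod (f e x))\<^sup>2))"


section \<open>The Bloch spectrum\<close>

definition square_integrable :: "real \<Rightarrow> (real \<Rightarrow> complex) \<Rightarrow> bool" where
  "square_integrable L u \<longleftrightarrow> u \<in> borel_measurable (lebesgue_on {0..L}) \<and>
     integrable (lebesgue_on {0..L}) (\<lambda>x. (cmod (u x))\<^sup>2)"

text \<open>
  \<open>u\<close> is the continuous representative of an element of the Sobolev space of order 1, and \<open>w\<close> is
  its weak derivative, which is determined almost everywhere.
\<close>

definition has_weak_deriv :: "real \<Rightarrow> (real \<Rightarrow> complex) \<Rightarrow> (real \<Rightarrow> complex) \<Rightarrow> bool" where
  "has_weak_deriv L u w \<longleftrightarrow> square_integrable L w \<and>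
     (\<forall>x\<in>{0..L}. (w has_integral (u x - u 0)) {0..x})"

definition sobolev2 :: "real \<Rightarrow> (real \<Rightarrow> complex) \<Rightarrow> bool" where
  "sobolev2 L u \<longleftrightarrow> (\<exists>u' u''. has_weak_deriv L u u' \<and> has_weak_deriv L u' u'')"

definition L2_space :: "('v, 'e) metric_graph \<Rightarrow> ('e \<Rightarrow> real \<Rightarrow> complex) set" where
  "L2_space G = {f. supported G f \<and> (\<forall>e\<in>edges G. square_integrable (len G e) (f e))}"

definition bloch_domain :: "('v, 'e) metric_graph \<Rightarrow> ('e \<Rightarrow> real \<Rightarrow> complex) set" where
  "bloch_domain G = {f. supported G f \<and> (\<forall>e\<in>edges G. sobolev2 (len G e) (f e)) \<and>
     continuous_at_vertices G f \<and> kirchhoff G f}"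

text \<open>
  The graph of \<open>\<Delta>\<^sub>\<alpha>\<close>.  On each edge, \<open>h\<close> is \<open>(d/dx + 2 \<pi> i a) f\<close> and \<open>g\<close> is
  \<open>-(d/dx + 2 \<pi> i a) h\<close>, the outer derivative being a weak one.
\<close>

definition bloch_laplacian ::
    "('v, 'e) metric_graph \<Rightarrow> ('e \<Rightarrow> real \<Rightarrow> real) \<Rightarrow>
     (('e \<Rightarrow> real \<Rightarrow> complex) \<times> ('e \<Rightarrow> real \<Rightarrow> complex)) set" where
  "bloch_laplacian G \<alpha> =
     {(f, g). f \<in> bloch_domain G \<and> g \<in> L2_space G \<and>
        (\<forall>e\<in>edges G. \<exists>h h'. has_weak_deriv (len G e) h h' \<and>
           (\<forall>x\<in>{0..len G e}.
              h x = edge_deriv (len G e) (f e) x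
                      + 2 * complex_of_real pi * \<i> * complex_of_real (\<alpha> e x) * f e x \<and>
              g e x = - (h' x
                      + 2 * complex_of_real pi * \<i> * complex_of_real (\<alpha> e x) * h x)))}"

definition Spec_form ::
    "('v, 'e) metric_graph \<Rightarrow> ('e \<Rightarrow> real \<Rightarrow> real) \<Rightarrow> (complex \<times> nat) set" where
  "Spec_form G \<alpha> = spectrum_mult (L2_norm_on G (edges G)) (L2_space G) (bloch_laplacian G \<alpha>)"

text \<open>
  The value at a coset is the common value of \<open>Spec_form\<close> on its representatives.
\<close>

definition bloch_spectrum ::
    "('v, 'e) metric_graph \<Rightarrow> ('e \<Rightarrow> real \<Rightarrow> real) set set \<Rightarrow> (complex \<times> nat) set" where
  "bloch_spectrum G c = the_elem (Spec_form G ` {\<alpha> \<in> one_forms G. torus_class G \<alpha> = c})"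


section \<open>Fundamental group, characters, universal cover\<close>

text \<open>
  Homotopy with fixed end points of walks starting at \<open>u\<close>: the equivalence relation generated by
  inserting and deleting backtracks.
\<close>

inductive homotopic :: "('v, 'e) metric_graph \<Rightarrow> 'v \<Rightarrow>
    ('e \<times> bool) list \<Rightarrow> ('e \<times> bool) list \<Rightarrow> bool" for G u where
  refl: "walk G u p v \<Longrightarrow> homotopic G u p p"
| sym: "homotopic G u p q \<Longrightarrow> homotopic G u q p"
| trans: "homotopic G u p q \<Longrightarrow> homotopic G u q r \<Longrightarrow> homotopic G u p r"
| backtrack: "walk G u (p @ [d, rev_dart d] @ q) v \<Longrightarrow>
    homotopic G u (p @ [d, rev_dart d] @ q) (p @ q)"

definition hclass ::
    "('v, 'e) metric_graph \<Rightarrow> 'v \<Rightarrow> ('e \<times> bool) list \<Rightarrow> ('e \<times> bool) list set" where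
  "hclass G u p = {q. homotopic G u p q}"

definition hconcat :: "('v, 'e) metric_graph \<Rightarrow> 'v \<Rightarrow>
    ('e \<times> bool) list set \<Rightarrow> ('e \<times> bool) list set \<Rightarrow> ('e \<times> bool) list set" where
  "hconcat G u X Y = {r. \<exists>p\<in>X. \<exists>q\<in>Y. homotopic G u (p @ q) r}"

definition pi1 :: "('v, 'e) metric_graph \<Rightarrow> 'v \<Rightarrow> ('e \<times> bool) list set monoid" where
  "pi1 G v0 = \<lparr>carrier = {hclass G v0 p | p. walk G v0 p v0},
               mult = hconcat G v0, one = hclass G v0 []\<rparr>"

definition Cstar :: "complex monoid" where
  "Cstar = \<lparr>carrier = - {0}, mult = (*), one = 1\<rparr>"

definition characters ::
    "('v, 'e) metric_graph \<Rightarrow> 'v \<Rightarrow> (('e \<times> bool) list set \<Rightarrow> complex) set" where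
  "characters G v0 = hom (pi1 G v0) Cstar \<inter> extensional (carrier (pi1 G v0))"

text \<open>The integral of a 1-form is the same along all walks in a homotopy class.\<close>

definition class_integral ::
    "('v, 'e) metric_graph \<Rightarrow> ('e \<Rightarrow> real \<Rightarrow> real) \<Rightarrow> ('e \<times> bool) list set \<Rightarrow> real" where
  "class_integral G \<alpha> \<gamma> = the_elem (walk_integral G \<alpha> ` \<gamma>)"

definition form_character ::
    "('v, 'e) metric_graph \<Rightarrow> 'v \<Rightarrow> ('e \<Rightarrow> real \<Rightarrow> real) \<Rightarrow> ('e \<times> bool) list set \<Rightarrow> complex" where
  "form_character G v0 \<alpha> =
     (\<lambda>\<gamma>\<in>carrier (pi1 G v0).
        exp (- 2 * complex_of_real pi * \<i> * complex_of_real (class_integral G \<alpha> \<gamma>)))"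

text \<open>
  The universal cover, constructed from homotopy classes of walks starting at \<open>v0\<close>: the edge
  \<open>(X, e)\<close> is the lift of \<open>e\<close> that starts at the vertex \<open>X\<close>.
\<close>

definition universal_cover :: "('v, 'e) metric_graph \<Rightarrow> 'v \<Rightarrow>
    (('e \<times> bool) list set, ('e \<times> bool) list set \<times> 'e) metric_graph" where
  "universal_cover G v0 =
     \<lparr>verts = {hclass G v0 p | p v. walk G v0 p v},
      edges = {(hclass G v0 p, e) | p e. e \<in> edges G \<and> walk G v0 p (tail G e)},
      tail = fst,
      head = (\<lambda>(X, e). hconcat G v0 X {[(e, True)]}),
      len = (\<lambda>(X, e). len G e)\<rparr>"

definition deck :: "('v, 'e) metric_graph \<Rightarrow> 'v \<Rightarrow> ('e \<times> bool) list set \<Rightarrow>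
    ('e \<times> bool) list set \<times> 'e \<Rightarrow> ('e \<times> bool) list set \<times> 'e" where
  "deck G v0 \<gamma> = (\<lambda>(X, e). (hconcat G v0 \<gamma> X, e))"


section \<open>The spectrum associated with a character\<close>

definition equivariant :: "('v, 'e) metric_graph \<Rightarrow> 'v \<Rightarrow> (('e \<times> bool) list set \<Rightarrow> complex) \<Rightarrow>
    (('e \<times> bool) list set \<times> 'e \<Rightarrow> real \<Rightarrow> complex) \<Rightarrow> bool" where
  "equivariant G v0 \<psi> f \<longleftrightarrow>
     (\<forall>\<gamma>\<in>carrier (pi1 G v0). \<forall>\<epsilon>\<in>edges (universal_cover G v0).
        \<forall>x\<in>{0..len (universal_cover G v0) \<epsilon>}. f (deck G v0 \<gamma> \<epsilon>) x = \<psi> \<gamma> * f \<epsilon> x)"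

definition Lambda0 :: "('v, 'e) metric_graph \<Rightarrow> 'v \<Rightarrow> (('e \<times> bool) list set \<Rightarrow> complex) \<Rightarrow>
    (('e \<times> bool) list set \<times> 'e \<Rightarrow> real \<Rightarrow> complex) set" where
  "Lambda0 G v0 \<psi> = {f \<in> zero_forms (universal_cover G v0). equivariant G v0 \<psi> f}"

definition std_laplacian ::
    "('v, 'e) metric_graph \<Rightarrow> ('e \<Rightarrow> real \<Rightarrow> complex) \<Rightarrow> 'e \<Rightarrow> real \<Rightarrow> complex" where
  "std_laplacian G f = (\<lambda>e x. - ext_d G (ext_d G f) e x)"

text \<open>
  The Laplacian on \<open>Lambda0\<close> takes values in the equivariant functions that are smooth on closed
  edges but need not satisfy any vertex conditions.  The norm on this space is the \<open>L\<^sup>2\<close> norm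
  over a fundamental domain, consisting of one lift of each edge of \<open>G\<close>.  For a unitary character
  it does not depend on the choice of the lifts, and in general different choices give equivalent
  norms.
\<close>

definition equivariant_smooth :: "('v, 'e) metric_graph \<Rightarrow> 'v \<Rightarrow>
    (('e \<times> bool) list set \<Rightarrow> complex) \<Rightarrow>
    (('e \<times> bool) list set \<times> 'e \<Rightarrow> real \<Rightarrow> complex) set" where
  "equivariant_smooth G v0 \<psi> =
     {f. supported (universal_cover G v0) f \<and>
         (\<forall>\<epsilon>\<in>edges (universal_cover G v0).
            smooth_on_edge (len (universal_cover G v0) \<epsilon>) (f \<epsilon>)) \<and>
         equivariant G v0 \<psi> f}"

definition edge_lift ::
    "('v, 'e) metric_graph \<Rightarrow> 'v \<Rightarrow> 'e \<Rightarrow> ('e \<times> bool) list set \<times> 'e" where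
  "edge_lift G v0 e = (SOME \<epsilon>. \<epsilon> \<in> edges (universal_cover G v0) \<and> snd \<epsilon> = e)"

definition pi1_spectrum :: "('v, 'e) metric_graph \<Rightarrow> 'v \<Rightarrow>
    (('e \<times> bool) list set \<Rightarrow> complex) \<Rightarrow> (complex \<times> nat) set" where
  "pi1_spectrum G v0 \<psi> =
     spectrum_mult
       (L2_norm_on (universal_cover G v0) (edge_lift G v0 ` edges G))
       (equivariant_smooth G v0 \<psi>)
       ((\<lambda>f. (f, std_laplacian (universal_cover G v0) f)) ` Lambda0 G v0 \<psi>)"

end

theory Submission
  imports Defs
begin

text \<open>
  The torus \<open>H\<^sup>1(G, \<real>) / H\<^sup>1(G, \<int>)\<close> and the set of unitary characters are matched by elementary means.
  Two 1-forms have the same torus class exactly if their difference has integral periods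
  (\<open>torus_class_eq_iff\<close>), and they have the same character exactly if their difference has integral
  periods on the closed walks at the base point (\<open>form_character_eq_iff\<close>); connectedness makes the
  two conditions equivalent.  Every unitary character comes from a form
  (\<open>unitary_character_from_form\<close>): closing up each edge by chosen walks to its end points turns the
  character into one phase per edge, and a form with prescribed edge integrals that vanishes at all
  vertices satisfies the vertex condition for trivial reasons.

  For the spectra, both operators are transformed into \<open>-u''\<close> on the edges of \<open>G\<close>, with vertex
  conditions in which the values and derivatives at the edge ends carry phases, here called weights.
  For \<open>\<Delta>\<^sub>\<alpha>\<close> the transformation is \<open>u(x) = exp (2 \<pi> \<i> \<integral>\<^sub>0\<^sup>x \<alpha>) f(x)\<close> on every edge, which puts
  \<open>exp (-2 \<pi> \<i> \<integral>\<^sub>e \<alpha>)\<close> at the head of \<open>e\<close> (\<open>Spec_form_eq_twisted\<close>).  An equivariant function on the universal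
  cover has the form \<open>exp (-2 \<pi> \<i> \<integral>\<^sub>X \<alpha>) u\<close> on the lift of an edge that starts at \<open>X\<close>, which puts
  \<open>exp (2 \<pi> \<i> \<integral>\<^sub>e \<alpha>)\<close> at the head (\<open>pi1_spectrum_eq_twisted\<close>).  So the sign of the character
  makes the two problems complex conjugate rather than equal.  Conjugating \<open>u\<close> exchanges them and
  replaces \<open>z\<close> by its conjugate; Green's formula shows that eigenvalues are real
  (\<open>twisted_eigenvalue_real\<close>), so nothing is changed
  (\<open>twisted_eigenspace_cnj_weights\<close>).

  The two operators also differ in their domains: Sobolev functions on one side, smooth functions
  on the other, where the operator is not closed.  The reason that this does not matter is that
  a resolvent equation on a finite graph is a finite system of linear equations.  Variation
  of constants expresses \<open>-u'' = z u + k\<close> on an edge by the initial data at its tail, so that the vertex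
  conditions become a square system in the initial data on all edges.  If its homogeneous version has
  only the zero solution, it is solvable with bounds for every \<open>k\<close> (\<open>twisted_fredholm\<close>), and the
  solution is as regular as \<open>k\<close> allows.  So in both settings \<open>z\<close> is in the spectrum exactly if there is
  a nonzero homogeneous solution (\<open>spectrum_mult_gauge\<close>), and homogeneous solutions are smooth.
\<close>

section \<open>Products with indefinite integrals\<close>

lemma absolutely_integrable_continuous_mult:
  fixes c w :: "real \<Rightarrow> complex"
  assumes "continuous_on {a..b} c" "w absolutely_integrable_on {a..b}"
  shows "(\<lambda>t. c t * w t) absolutely_integrable_on {a..b}"
proof (rule absolutely_integrable_bounded_measurable_product[OF bilinear_times])
  show "c \<in> borel_measurable (lebesgue_on {a..b})"
    by (intro continuous_imp_measurable_on_sets_lebesgue assms) auto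
  show "bounded (c ` {a..b})"
    by (intro compact_imp_bounded compact_continuous_image assms) auto
qed (use assms in auto)

lemma primitive_increment:
  fixes w W :: "real \<Rightarrow> complex"
  assumes W: "\<And>x. x \<in> {0..L} \<Longrightarrow> (w has_integral (W x - W 0)) {0..x}"
    and xy: "0 \<le> x" "x \<le> y" "y \<le> L"
  shows "(w has_integral (W y - W x)) {x..y}"
proof -
  have i: "w integrable_on {0..y}"
    using W[of y] xy by (auto intro: has_integral_integrable)
  have "integral {0..x} w + integral {x..y} w = integral {0..y} w"
    using Henstock_Kurzweil_Integration.integral_combine[OF xy(1,2) i] .
  moreover have "integral {0..x} w = W x - W 0" "integral {0..y} w = W y - W 0"
    using W[of x] W[of y] xy by (auto intro: integral_unique)
  ultimately have "integral {x..y} w = W y - W x" by (simp add: algebra_simps)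
  moreover have "w integrable_on {x..y}"
    using i by (rule integrable_on_subinterval) (use xy in auto)
  ultimately show ?thesis by (metis integrable_integral)
qed

lemma primitive_continuous:
  fixes w W :: "real \<Rightarrow> complex"
  assumes W: "\<And>x. x \<in> {0..L} \<Longrightarrow> (w has_integral (W x - W 0)) {0..x}"
  shows "continuous_on {0..L} W"
proof (cases "0 \<le> L")
  case True
  have "w integrable_on {0..L}" using W[of L] True by (auto intro: has_integral_integrable)
  then have "continuous_on {0..L} (\<lambda>x. integral {0..x} w)"
    by (rule indefinite_integral_continuous_1)
  then have "continuous_on {0..L} (\<lambda>x. W 0 + integral {0..x} w)"
    by (intro continuous_intros)
  then show ?thesis
    by (rule continuous_on_eq) (simp add: integral_unique[OF W])
qed auto

lemma primitive_deriv:
  fixes w W :: "real \<Rightarrow> complex"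
  assumes w: "continuous_on {0..L} w" and W: "\<And>x. x \<in> {0..L} \<Longrightarrow> (w has_integral (W x - W 0)) {0..x}"
    and x: "x \<in> {0..L}"
  shows "(W has_vector_derivative w x) (at x within {0..L})"
proof -
  have "((\<lambda>t. W 0 + integral {0..t} w) has_vector_derivative (0 + w x)) (at x within {0..L})"
    by (intro has_vector_derivative_add has_vector_derivative_const integral_has_vector_derivative w x)
  then show ?thesis
    by (intro has_vector_derivative_transform[of x "{0..L}" W "\<lambda>t. W 0 + integral {0..t} w"])
      (use x in \<open>simp_all add: integral_unique[OF W]\<close>)
qed

text \<open>
  Since \<open>w\<close> is only integrable, its primitive \<open>W\<close> need not be differentiable at any given point, and the
  fundamental theorem of calculus does not apply to \<open>c W\<close>.  But the difference of the two sides is, up to a constant, a function \<open>D\<close> that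
  satisfies \<open>\<bar>D y - D x\<bar> \<le> 2 M \<bar>y - x\<bar> \<bar>A y - A x\<bar>\<close>, where \<open>M\<close> bounds \<open>c'\<close> and \<open>A\<close> is the continuous
  primitive of \<open>\<bar>w\<bar>\<close>.  So \<open>D\<close> has derivative \<open>0\<close> everywhere.
\<close>

lemma primitive_product_rule:
  fixes w W c c' :: "real \<Rightarrow> complex"
  assumes w: "w absolutely_integrable_on {0..L}"
    and W: "\<And>x. x \<in> {0..L} \<Longrightarrow> (w has_integral (W x - W 0)) {0..x}"
    and c: "\<And>x. x \<in> {0..L} \<Longrightarrow> (c has_vector_derivative c' x) (at x within {0..L})"
    and c': "continuous_on {0..L} c'"
    and x: "x \<in> {0..L}"
  shows "((\<lambda>t. c t * w t + c' t * W t) has_integral (c x * W x - c 0 * W 0)) {0..x}"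
proof -
  define F where "F = (\<lambda>t. c t * w t + c' t * W t)"
  define D where "D = (\<lambda>x. c x * W x - integral {0..x} F)"
  define A where "A = (\<lambda>x. integral {0..x} (\<lambda>t. norm (w t)))"
  have cc: "continuous_on {0..L} c"
    using c by (meson continuous_on_vector_derivative)
  have cW: "continuous_on {0..L} W" by (rule primitive_continuous[OF W])
  obtain M0 where M0: "\<And>x. x \<in> {0..L} \<Longrightarrow> norm (c' x) \<le> M0"
    using compact_imp_bounded[OF compact_continuous_image[OF c']]
    unfolding bounded_iff by (metis compact_Icc imageI)
  define M where "M = max M0 0"
  have M: "\<And>x. x \<in> {0..L} \<Longrightarrow> norm (c' x) \<le> M" "0 \<le> M"
    using M0 by (auto simp: M_def intro: max.coboundedI1)
  have nw: "(\<lambda>t. norm (w t)) integrable_on {0..L}"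
    using w by (simp add: absolutely_integrable_on_def)
  have Fi: "F integrable_on {0..L}"
    unfolding F_def
    by (intro integrable_add set_lebesgue_integral_eq_integral(1)
        absolutely_integrable_continuous_mult[OF cc w]
        absolutely_integrable_continuous_real continuous_intros c' cW)
  have cA: "continuous_on {0..L} A"
    unfolding A_def by (rule indefinite_integral_continuous_1[OF nw])
  have inc: "norm (D y - D x) \<le> 2 * M * \<bar>y - x\<bar> * \<bar>A y - A x\<bar>"
    if xy: "x \<in> {0..L}" "y \<in> {0..L}" "x \<le> y" for x y
  proof -
    have sub: "{x..y} \<subseteq> {0..L}" using xy by auto
    have wi: "w absolutely_integrable_on {x..y}"
      by (rule absolutely_integrable_on_subinterval[OF w sub])
    have Ws: "\<And>s. s \<in> {x..y} \<Longrightarrow> (w has_integral (W s - W x)) {x..s}"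
      by (rule primitive_increment[of L, OF W]) (use xy in auto)
    have Ayx: "A y - A x = integral {x..y} (\<lambda>t. norm (w t))"
      unfolding A_def using Henstock_Kurzweil_Integration.integral_combine[of 0 x y "\<lambda>t. norm (w t)"]
        integrable_on_subinterval[OF nw, of 0 y] xy by (auto simp: algebra_simps)
    have A0: "0 \<le> A y - A x" unfolding Ayx by (rule integral_nonneg) (use wi in \<open>auto simp: absolutely_integrable_on_def\<close>)
    have cs: "(c' has_integral (c s - c r)) {r..s}" if "x \<le> r" "r \<le> s" "s \<le> y" for r s
    proof (rule fundamental_theorem_of_calculus)
      have "{r..s} \<subseteq> {0..L}" using that xy by auto
      then show "(c has_vector_derivative c' t) (at t within {r..s})" if "t \<in> {r..s}" for t
        using c that by (meson has_vector_derivative_within_subset subsetD)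
    qed (use that in auto)
    have lip: "norm (c y - c s) \<le> M * (y - x)" if "s \<in> {x..y}" for s
    proof -
      have "norm (c y - c s) \<le> M * measure lborel {s..y}"
        by (rule has_integral_bound_real[OF M(2) _ cs]) (use that M(1) sub in auto)
      also have "\<dots> \<le> M * (y - x)" using that M(2) by (auto intro: mult_left_mono)
      finally show ?thesis .
    qed
    have Wb: "norm (W s - W x) \<le> A y - A x" if "s \<in> {x..y}" for s
    proof -
      have "W s - W x = integral {x..s} w" using Ws[OF that] by (simp add: integral_unique)
      also have "norm \<dots> \<le> integral {x..s} (\<lambda>t. norm (w t))"
        using absolutely_integrable_on_subinterval[OF wi, of x s] that
        by (intro integral_norm_bound_integral) (auto simp: absolutely_integrable_on_def)
      also have "\<dots> \<le> A y - A x" unfolding Ayx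
        using wi that absolutely_integrable_on_subinterval[OF wi, of x s]
        by (intro integral_subset_le) (auto simp: absolutely_integrable_on_def)
      finally show ?thesis .
    qed
    have i1: "((\<lambda>s. c y * w s - c s * w s) has_integral
        (c y * (W y - W x) - integral {x..y} (\<lambda>s. c s * w s))) {x..y}"
      using xy by (intro has_integral_diff has_integral_mult_right Ws integrable_integral
          set_lebesgue_integral_eq_integral(1) absolutely_integrable_continuous_mult wi
          continuous_on_subset[OF cc sub]) auto
    have i2: "((\<lambda>s. c' s * W x - c' s * W s) has_integral
        ((c y - c x) * W x - integral {x..y} (\<lambda>s. c' s * W s))) {x..y}"
      using xy by (intro has_integral_diff has_integral_mult_left cs integrable_integral
          integrable_continuous_real continuous_intros continuous_on_subset[OF c' sub]
          continuous_on_subset[OF cW sub]) auto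
    have iF: "integral {x..y} F = integral {x..y} (\<lambda>s. c s * w s) + integral {x..y} (\<lambda>s. c' s * W s)"
      unfolding F_def
      by (intro Henstock_Kurzweil_Integration.integral_add set_lebesgue_integral_eq_integral(1)
          absolutely_integrable_continuous_mult wi continuous_on_subset[OF cc sub]
          absolutely_integrable_continuous_real continuous_intros continuous_on_subset[OF c' sub]
          continuous_on_subset[OF cW sub])
    have "integral {0..x} F + integral {x..y} F = integral {0..y} F"
      using xy by (intro Henstock_Kurzweil_Integration.integral_combine integrable_on_subinterval[OF Fi]) auto
    \<comment> \<open>on \<open>[x, y]\<close> both integrands contain a factor that vanishes at one end\<close>
    then have D_eq: "D y - D x = integral {x..y} (\<lambda>s. c y * w s - c s * w s)
        + integral {x..y} (\<lambda>s. c' s * W x - c' s * W s)"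
      unfolding integral_unique[OF i1] integral_unique[OF i2] D_def using iF
      by (simp add: algebra_simps)
    have b1: "norm (integral {x..y} (\<lambda>s. c y * w s - c s * w s)) \<le> integral {x..y} (\<lambda>s. M * (y - x) * norm (w s))"
    proof (rule integral_norm_bound_integral)
      show "(\<lambda>s. c y * w s - c s * w s) integrable_on {x..y}" using i1 by blast
      show "(\<lambda>s. M * (y - x) * norm (w s)) integrable_on {x..y}"
        using wi by (intro integrable_on_mult_right) (auto simp: absolutely_integrable_on_def)
      fix s assume "s \<in> {x..y}"
      have "norm (c y * w s - c s * w s) = norm (c y - c s) * norm (w s)"
        by (metis left_diff_distrib norm_mult)
      also have "\<dots> \<le> M * (y - x) * norm (w s)"
        using lip[OF \<open>s \<in> {x..y}\<close>] by (intro mult_right_mono) auto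
      finally show "norm (c y * w s - c s * w s) \<le> M * (y - x) * norm (w s)" .
    qed
    have b2: "norm (integral {x..y} (\<lambda>s. c' s * W x - c' s * W s)) \<le> M * (A y - A x) * measure lborel {x..y}"
    proof (rule has_integral_bound_real[where S = "{}"])
      show "((\<lambda>s. c' s * W x - c' s * W s) has_integral integral {x..y} (\<lambda>s. c' s * W x - c' s * W s)) {x..y}"
        using i2 by blast
      fix s assume "s \<in> {x..y} - {}"
      then have s: "s \<in> {x..y}" by simp
      have "norm (c' s * W x - c' s * W s) = norm (c' s) * norm (W s - W x)"
        by (metis norm_minus_commute norm_mult right_diff_distrib)
      also have "\<dots> \<le> M * (A y - A x)"
        using M s sub Wb[OF s] by (intro mult_mono) auto
      finally show "norm (c' s * W x - c' s * W s) \<le> M * (A y - A x)" .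
    qed (use M A0 in auto)
    have "norm (D y - D x) \<le> M * (y - x) * (A y - A x) + M * (A y - A x) * (y - x)"
      unfolding D_eq using b1 b2 xy
      by (intro order_trans[OF norm_triangle_ineq] add_mono) (auto simp: Ayx)
    then show ?thesis using A0 xy by (simp add: algebra_simps)
  qed
  have inc': "norm (D y - D x) \<le> 2 * M * \<bar>y - x\<bar> * \<bar>A y - A x\<bar>"
    if "x \<in> {0..L}" "y \<in> {0..L}" for x y
    using inc[OF that] inc[OF that(2,1)]
    by (metis abs_minus_commute linear norm_minus_commute)
  have "(D has_vector_derivative 0) (at x within {0..L})" if x: "x \<in> {0..L}" for x
    unfolding has_vector_derivative_def has_derivative_within_alt
  proof (intro conjI allI impI)
    show "bounded_linear (\<lambda>x. x *\<^sub>R (0 :: complex))" by (simp add: bounded_linear_zero)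
    fix e :: real assume e: "0 < e"
    have "0 < e / (2 * M + 1)" using M(2) e by simp
    then obtain d where d: "0 < d" "\<And>y. y \<in> {0..L} \<Longrightarrow> dist y x < d \<Longrightarrow> dist (A y) (A x) < e / (2 * M + 1)"
      using cA x unfolding continuous_on_iff by metis
    have "norm (D y - D x - (y - x) *\<^sub>R 0) \<le> e * norm (y - x)"
      if y: "y \<in> {0..L}" "norm (y - x) < d" for y
    proof -
      have "\<bar>A y - A x\<bar> \<le> e / (2 * M + 1)" using d(2)[OF y(1)] y(2) by (simp add: dist_norm)
      then have "2 * M * \<bar>A y - A x\<bar> \<le> 2 * M * (e / (2 * M + 1))"
        using M(2) by (intro mult_left_mono) auto
      also have "\<dots> \<le> e" using M(2) e by (simp add: field_simps)
      finally have "2 * M * \<bar>A y - A x\<bar> * \<bar>y - x\<bar> \<le> e * \<bar>y - x\<bar>"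
        by (intro mult_right_mono) auto
      with inc'[OF x y(1)] show ?thesis by (simp add: mult_ac)
    qed
    then show "\<exists>d>0. \<forall>y\<in>{0..L}. norm (y - x) < d \<longrightarrow> norm (D y - D x - (y - x) *\<^sub>R 0) \<le> e * norm (y - x)"
      using d(1) by blast
  qed
  then obtain k where k: "\<And>x. x \<in> {0..L} \<Longrightarrow> D x = k"
    using has_vector_derivative_zero_constant[of "{0..L}" D] by auto
  have "D x = D 0" using k x by auto
  then have "integral {0..x} F = c x * W x - c 0 * W 0"
    unfolding D_def by (simp add: algebra_simps)
  moreover have "F integrable_on {0..x}"
    by (rule integrable_on_subinterval[OF Fi]) (use x in auto)
  ultimately show ?thesis unfolding F_def[symmetric] by (metis integrable_integral)
qed

section \<open>Square integrable functions on an interval\<close>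

lemma continuous_on_interval_bounded:
  fixes f :: "real \<Rightarrow> 'a::real_normed_vector"
  assumes "continuous_on {a..b} f"
  obtains M where "0 \<le> M" "\<And>x. x \<in> {a..b} \<Longrightarrow> norm (f x) \<le> M"
proof -
  obtain M where M: "\<forall>y\<in>f ` {a..b}. norm y \<le> M"
    using compact_imp_bounded[OF compact_continuous_image[OF assms compact_Icc]]
    unfolding bounded_iff by blast
  show thesis by (rule that[of "max M 0"]) (use M in \<open>auto intro: max.coboundedI1\<close>)
qed

lemma square_integrable_imp_absolutely_integrable:
  assumes "square_integrable L k"
  shows "k absolutely_integrable_on {0..L}"
proof (rule measurable_bounded_by_integrable_imp_absolutely_integrable)
  have "integrable (lebesgue_on {0..L}) (\<lambda>x. 1 + (cmod (k x))\<^sup>2)"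
    using assms by (intro Bochner_Integration.integrable_add) (auto simp: square_integrable_def)
  then show "(\<lambda>x. 1 + (cmod (k x))\<^sup>2) integrable_on {0..L}"
    by (rule integrable_on_lebesgue_on) auto
  fix x
  have "0 \<le> (cmod (k x) - 1)\<^sup>2" by simp
  then have "2 * cmod (k x) \<le> 1 + (cmod (k x))\<^sup>2"
    by (simp add: power2_eq_square algebra_simps)
  then show "norm (k x) \<le> 1 + (cmod (k x))\<^sup>2"
    using norm_ge_zero[of "k x"] by linarith
qed (use assms in \<open>auto simp: square_integrable_def\<close>)

lemma square_integrable_bounded:
  assumes "square_integrable L k" "w \<in> borel_measurable (lebesgue_on {0..L})"
    "\<And>x. x \<in> {0..L} \<Longrightarrow> cmod (w x) \<le> M * cmod (k x)"
  shows "square_integrable L w"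
  unfolding square_integrable_def
proof
  show "integrable (lebesgue_on {0..L}) (\<lambda>x. (cmod (w x))\<^sup>2)"
  proof (rule Bochner_Integration.integrable_bound)
    show "integrable (lebesgue_on {0..L}) (\<lambda>x. M\<^sup>2 * (cmod (k x))\<^sup>2)"
      using assms(1) by (auto simp: square_integrable_def)
    show "(\<lambda>x. (cmod (w x))\<^sup>2) \<in> borel_measurable (lebesgue_on {0..L})"
      using assms(2) by measurable
    show "AE x in lebesgue_on {0..L}. norm ((cmod (w x))\<^sup>2) \<le> norm (M\<^sup>2 * (cmod (k x))\<^sup>2)"
      using power_mono[OF assms(3), of _ 2] by (intro AE_I2) (simp add: power_mult_distrib)
  qed
qed fact

lemma square_integrable_continuous_mult:
  assumes "continuous_on {0..L} c" "square_integrable L k"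
  shows "square_integrable L (\<lambda>x. c x * k x)"
proof -
  obtain M where "\<And>x. x \<in> {0..L} \<Longrightarrow> cmod (c x) \<le> M"
    using continuous_on_interval_bounded[OF assms(1)] by blast
  moreover have "c \<in> borel_measurable (lebesgue_on {0..L})"
    by (intro continuous_imp_measurable_on_sets_lebesgue assms) auto
  ultimately show ?thesis using assms(2)
    by (intro square_integrable_bounded[OF assms(2), of _ M])
      (auto simp: norm_mult square_integrable_def intro: mult_right_mono)
qed

lemma square_integrable_continuous:
  assumes "continuous_on {0..L} c"
  shows "square_integrable L c"
proof -
  have "square_integrable L (\<lambda>x. 1)" by (simp add: square_integrable_def)
  from square_integrable_continuous_mult[OF assms this] show ?thesis by simp
qed

lemma square_integrable_add:
  assumes "square_integrable L f" "square_integrable L g"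
  shows "square_integrable L (\<lambda>x. f x + g x)"
  unfolding square_integrable_def
proof
  show m: "(\<lambda>x. f x + g x) \<in> borel_measurable (lebesgue_on {0..L})"
    using assms by (auto simp: square_integrable_def)
  show "integrable (lebesgue_on {0..L}) (\<lambda>x. (cmod (f x + g x))\<^sup>2)"
  proof (rule Bochner_Integration.integrable_bound)
    show "integrable (lebesgue_on {0..L}) (\<lambda>x. 2 * (cmod (f x))\<^sup>2 + 2 * (cmod (g x))\<^sup>2)"
      using assms by (auto simp: square_integrable_def)
    show "(\<lambda>x. (cmod (f x + g x))\<^sup>2) \<in> borel_measurable (lebesgue_on {0..L})"
      using m by measurable
    have "(cmod (f x + g x))\<^sup>2 \<le> 2 * (cmod (f x))\<^sup>2 + 2 * (cmod (g x))\<^sup>2" for x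
    proof -
      have "(cmod (f x + g x))\<^sup>2 \<le> (cmod (f x) + cmod (g x))\<^sup>2"
        by (intro power_mono norm_triangle_ineq) auto
      moreover have "0 \<le> (cmod (f x) - cmod (g x))\<^sup>2" by simp
      ultimately show ?thesis by (simp add: power2_eq_square algebra_simps)
    qed
    then show "AE x in lebesgue_on {0..L}. norm ((cmod (f x + g x))\<^sup>2)
        \<le> norm (2 * (cmod (f x))\<^sup>2 + 2 * (cmod (g x))\<^sup>2)"
      by (intro AE_I2) auto
  qed
qed

lemma square_integrable_cong:
  assumes "square_integrable L f" "\<And>x. x \<in> {0..L} \<Longrightarrow> f x = g x"
  shows "square_integrable L g"
  using assms(1) measurable_cong[of "lebesgue_on {0..L}" f g]
    Bochner_Integration.integrable_cong[of "lebesgue_on {0..L}" _ "\<lambda>x. (cmod (f x))\<^sup>2" "\<lambda>x. (cmod (g x))\<^sup>2"]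
  by (auto simp: square_integrable_def assms(2))

abbreviation edge_L2 :: "real \<Rightarrow> (real \<Rightarrow> complex) \<Rightarrow> real" where
  "edge_L2 L k \<equiv> sqrt (integral\<^sup>L (lebesgue_on {0..L}) (\<lambda>x. (cmod (k x))\<^sup>2))"

text \<open>
  The Cauchy-Schwarz inequality, from \<open>0 \<le> \<integral> (\<bar>k\<bar> - t)\<^sup>2\<close> for \<open>t\<close> the mean value of \<open>\<bar>k\<bar>\<close>.
\<close>

lemma integral_norm_le_L2:
  assumes k: "square_integrable L k" and L: "0 < L"
  shows "integral {0..L} (\<lambda>x. norm (k x)) \<le> sqrt L * edge_L2 L k"
proof -
  define J where "J = integral {0..L} (\<lambda>x. norm (k x))"
  define Q where "Q = integral\<^sup>L (lebesgue_on {0..L}) (\<lambda>x. (cmod (k x))\<^sup>2)"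
  have Q: "((\<lambda>x. (cmod (k x))\<^sup>2) has_integral Q) {0..L}"
    unfolding Q_def using k by (intro has_integral_integral_lebesgue_on) (auto simp: square_integrable_def)
  have J: "((\<lambda>x. norm (k x)) has_integral J) {0..L}"
    unfolding J_def using square_integrable_imp_absolutely_integrable[OF k]
    by (intro integrable_integral) (auto simp: absolutely_integrable_on_def)
  define t where "t = J / L"
  have "((\<lambda>x. (cmod (k x))\<^sup>2 - 2 * t * norm (k x) + t\<^sup>2) has_integral (Q - 2 * t * J + t\<^sup>2 * L)) {0..L}"
    using has_integral_const_real[of "t\<^sup>2" 0 L] L
    by (intro has_integral_add has_integral_diff has_integral_mult_right Q J) (simp add: mult_ac)
  moreover have "(cmod (k x))\<^sup>2 - 2 * t * norm (k x) + t\<^sup>2 = (norm (k x) - t)\<^sup>2" for x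
    by (simp add: power2_eq_square algebra_simps)
  ultimately have "((\<lambda>x. (norm (k x) - t)\<^sup>2) has_integral (Q - 2 * t * J + t\<^sup>2 * L)) {0..L}"
    by simp
  then have "0 \<le> Q - 2 * t * J + t\<^sup>2 * L"
    by (rule has_integral_nonneg) simp
  then have "J\<^sup>2 \<le> L * Q" using L by (simp add: t_def field_simps power2_eq_square)
  then have "J \<le> sqrt (L * Q)" by (rule real_le_rsqrt)
  then show ?thesis unfolding J_def Q_def by (simp add: real_sqrt_mult)
qed

section \<open>The equation on one edge\<close>

text \<open>
  \<open>fund_cos z\<close> and \<open>fund_sin z\<close> are the solutions of \<open>u'' = -z u\<close> with initial data \<open>(1, 0)\<close> and \<open>(0, 1)\<close>.
  Both are even in the square root of \<open>z\<close>, so that its branch is irrelevant.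
\<close>

definition fund_cos :: "complex \<Rightarrow> real \<Rightarrow> complex" where
  "fund_cos z x = cos (csqrt z * of_real x)"

definition fund_sin :: "complex \<Rightarrow> real \<Rightarrow> complex" where
  "fund_sin z x = (if z = 0 then of_real x else sin (csqrt z * of_real x) / csqrt z)"

lemma fund_at_0 [simp]: "fund_cos z 0 = 1" "fund_sin z 0 = 0"
  by (auto simp: fund_cos_def fund_sin_def)

lemma fund_cos_deriv: "(fund_cos z has_vector_derivative - z * fund_sin z x) (at x within S)"
proof -
  have "((\<lambda>y. cos (csqrt z * y)) has_field_derivative - z * fund_sin z x) (at (of_real x))"
  proof (cases "z = 0")
    case False
    then have "csqrt z \<noteq> 0" by simp
    moreover have "z = csqrt z * csqrt z" by (metis power2_csqrt power2_eq_square)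
    ultimately show ?thesis using False
      by (auto intro!: derivative_eq_intros simp: fund_sin_def field_simps)
  qed auto
  then show ?thesis unfolding fund_cos_def[abs_def] by (rule has_vector_derivative_real_field)
qed

lemma fund_sin_deriv: "(fund_sin z has_vector_derivative fund_cos z x) (at x within S)"
proof -
  have "((\<lambda>y. if z = 0 then y else sin (csqrt z * y) / csqrt z) has_field_derivative fund_cos z x) (at (of_real x))"
    by (cases "z = 0") (auto intro!: derivative_eq_intros simp: fund_cos_def)
  then show ?thesis unfolding fund_sin_def[abs_def] by (rule has_vector_derivative_real_field)
qed

lemma fund_pythagoras: "fund_cos z x * fund_cos z x + z * (fund_sin z x * fund_sin z x) = 1"
proof (cases "z = 0")
  case False
  then have "csqrt z \<noteq> 0" by simp
  moreover have "z = csqrt z * csqrt z" by (metis power2_csqrt power2_eq_square)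
  ultimately have "z * (fund_sin z x * fund_sin z x) = (sin (csqrt z * of_real x))\<^sup>2"
    using False by (simp add: fund_sin_def power2_eq_square)
  then show ?thesis using sin_cos_squared_add2[of "csqrt z * of_real x"]
    by (simp add: fund_cos_def power2_eq_square)
qed (simp add: fund_cos_def)

lemma fund_continuous [continuous_intros]:
  "continuous_on S (fund_cos z)" "continuous_on S (fund_sin z)"
  using fund_cos_deriv fund_sin_deriv by (meson continuous_on_vector_derivative)+

text \<open>
  The equation \<open>-u'' = z u + k\<close> on \<open>[0, L]\<close> with derivative \<open>u'\<close>, in integrated form, so that it makes
  sense for integrable \<open>k\<close>.
\<close>

definition edge_solution ::
    "real \<Rightarrow> complex \<Rightarrow> (real \<Rightarrow> complex) \<Rightarrow> (real \<Rightarrow> complex) \<Rightarrow> (real \<Rightarrow> complex) \<Rightarrow> bool" where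
  "edge_solution L z u u' k \<longleftrightarrow>
     (\<forall>x\<in>{0..L}. (u' has_integral (u x - u 0)) {0..x} \<and>
        ((\<lambda>t. - z * u t - k t) has_integral (u' x - u' 0)) {0..x})"

lemma edge_solution_continuous:
  assumes "edge_solution L z u u' k"
  shows "continuous_on {0..L} u" "continuous_on {0..L} u'"
  using assms primitive_continuous[of L u' u] primitive_continuous[of L "\<lambda>t. - z * u t - k t" u']
  by (auto simp: edge_solution_def)

text \<open>
  The solution of \<open>-u'' = z u + k\<close> with \<open>u 0 = 0\<close> and \<open>u' 0 = 0\<close>; \<open>duhamel'\<close> is its derivative.
\<close>

definition duhamel ::
    "complex \<Rightarrow> (real \<Rightarrow> complex) \<Rightarrow> real \<Rightarrow> complex" where
  "duhamel z k x = fund_cos z x * integral {0..x} (\<lambda>t. fund_sin z t * k t)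
     - fund_sin z x * integral {0..x} (\<lambda>t. fund_cos z t * k t)"

definition duhamel' ::
    "complex \<Rightarrow> (real \<Rightarrow> complex) \<Rightarrow> real \<Rightarrow> complex" where
  "duhamel' z k x = - (fund_cos z x * integral {0..x} (\<lambda>t. fund_cos z t * k t))
     - z * (fund_sin z x * integral {0..x} (\<lambda>t. fund_sin z t * k t))"

lemma duhamel_at_0 [simp]: "duhamel z k 0 = 0" "duhamel' z k 0 = 0"
  by (auto simp: duhamel_def duhamel'_def)

lemma fund_cos_scaled_deriv: "((\<lambda>x. z * fund_sin z x) has_vector_derivative z * fund_cos z x) (at x within S)"
  by (intro has_vector_derivative_mult_right fund_sin_deriv)

text \<open>
  With \<open>C = fund_cos z\<close> and \<open>S = fund_sin z\<close>, the function \<open>C u' + z S u\<close> is a primitive of \<open>-C k\<close>,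
  and \<open>C u - S u'\<close> is a primitive of \<open>S k\<close>.  By \<open>C\<^sup>2 + z S\<^sup>2 = 1\<close> these two functions determine \<open>u\<close> and \<open>u'\<close>.
\<close>

lemma edge_solution_variation_of_constants:
  assumes k: "k absolutely_integrable_on {0..L}" and sol: "edge_solution L z u u' k" and x: "x \<in> {0..L}"
  shows "u x = fund_cos z x * u 0 + fund_sin z x * u' 0 + duhamel z k x"
    and "u' x = - z * fund_sin z x * u 0 + fund_cos z x * u' 0 + duhamel' z k x"
proof -
  let ?C = "fund_cos z" and ?S = "fund_sin z"
  let ?w = "\<lambda>t. - z * u t - k t"
  let ?IC = "integral {0..x} (\<lambda>t. ?C t * k t)" and ?IS = "integral {0..x} (\<lambda>t. ?S t * k t)"
  note cu = edge_solution_continuous[OF sol]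
  have u1: "\<And>y. y \<in> {0..L} \<Longrightarrow> (u' has_integral (u y - u 0)) {0..y}"
    and u2: "\<And>y. y \<in> {0..L} \<Longrightarrow> (?w has_integral (u' y - u' 0)) {0..y}"
    using sol by (auto simp: edge_solution_def)
  have w: "?w absolutely_integrable_on {0..L}"
    by (intro set_integral_diff(1) k absolutely_integrable_continuous_real continuous_intros cu)
  have aiu': "u' absolutely_integrable_on {0..L}"
    by (intro absolutely_integrable_continuous_real cu)
  note cont = continuous_intros
  have Cu': "((\<lambda>t. ?C t * ?w t + (- z * ?S t) * u' t) has_integral (?C x * u' x - ?C 0 * u' 0)) {0..x}"
    by (rule primitive_product_rule[OF w u2 fund_cos_deriv _ x]) (auto intro!: cont)
  have zSu: "((\<lambda>t. (z * ?S t) * u' t + (z * ?C t) * u t) has_integral ((z * ?S x) * u x - (z * ?S 0) * u 0)) {0..x}"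
    by (rule primitive_product_rule[OF aiu' u1 fund_cos_scaled_deriv _ x]) (auto intro!: cont)
  have Cu: "((\<lambda>t. ?C t * u' t + (- z * ?S t) * u t) has_integral (?C x * u x - ?C 0 * u 0)) {0..x}"
    by (rule primitive_product_rule[OF aiu' u1 fund_cos_deriv _ x]) (auto intro!: cont)
  have Su': "((\<lambda>t. ?S t * ?w t + ?C t * u' t) has_integral (?S x * u' x - ?S 0 * u' 0)) {0..x}"
    by (rule primitive_product_rule[OF w u2 fund_sin_deriv _ x]) (auto intro!: cont)
  have "((\<lambda>t. - (?C t * k t)) has_integral (?C x * u' x - u' 0 + z * ?S x * u x)) {0..x}"
    using has_integral_add[OF Cu' zSu] by (simp add: algebra_simps)
  then have A: "?C x * u' x + z * ?S x * u x = u' 0 - ?IC"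
    by (auto dest!: has_integral_neg integral_unique simp: algebra_simps)
  have "((\<lambda>t. ?S t * k t) has_integral (?C x * u x - u 0 - ?S x * u' x)) {0..x}"
    using has_integral_diff[OF Cu Su'] by (simp add: algebra_simps)
  then have B: "?C x * u x - ?S x * u' x = u 0 + ?IS"
    by (auto dest!: integral_unique simp: algebra_simps)
  have "u x = (?C x * ?C x + z * (?S x * ?S x)) * u x" by (simp add: fund_pythagoras)
  also have "\<dots> = ?C x * (?C x * u x - ?S x * u' x) + ?S x * (?C x * u' x + z * ?S x * u x)"
    by (simp add: algebra_simps)
  finally show "u x = ?C x * u 0 + ?S x * u' 0 + duhamel z k x"
    unfolding A B duhamel_def by (simp add: algebra_simps)
  have "u' x = (?C x * ?C x + z * (?S x * ?S x)) * u' x" by (simp add: fund_pythagoras)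
  also have "\<dots> = ?C x * (?C x * u' x + z * ?S x * u x) - z * ?S x * (?C x * u x - ?S x * u' x)"
    by (simp add: algebra_simps)
  finally show "u' x = - z * ?S x * u 0 + ?C x * u' 0 + duhamel' z k x"
    unfolding A B duhamel'_def by (simp add: algebra_simps)
qed

lemma edge_solution_duhamel:
  assumes k: "k absolutely_integrable_on {0..L}"
  shows "edge_solution L z (duhamel z k) (duhamel' z k) k"
  unfolding edge_solution_def
proof (intro ballI)
  fix x assume x: "x \<in> {0..L}"
  let ?C = "fund_cos z" and ?S = "fund_sin z"
  let ?IC = "\<lambda>x. integral {0..x} (\<lambda>t. ?C t * k t)" and ?IS = "\<lambda>x. integral {0..x} (\<lambda>t. ?S t * k t)"
  note cont = continuous_intros
  have aC: "(\<lambda>t. ?C t * k t) absolutely_integrable_on {0..L}"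
    and aS: "(\<lambda>t. ?S t * k t) absolutely_integrable_on {0..L}"
    by (intro absolutely_integrable_continuous_mult k cont)+
  have I: "((\<lambda>t. c t * k t) has_integral (integral {0..y} (\<lambda>t. c t * k t) - integral {0..0} (\<lambda>t. c t * k t))) {0..y}"
    if "(\<lambda>t. c t * k t) absolutely_integrable_on {0..L}" "y \<in> {0..L}" for c y
    using set_lebesgue_integral_eq_integral(1)[OF absolutely_integrable_on_subinterval[OF that(1), of 0 y]] that(2)
    by (simp add: integrable_integral)
  note r = primitive_product_rule[OF _ _ _ _ x]
  have CS: "((\<lambda>t. ?C t * (?S t * k t) + (- z * ?S t) * ?IS t) has_integral (?C x * ?IS x - ?C 0 * ?IS 0)) {0..x}"
    by (rule r[OF aS I[OF aS] fund_cos_deriv]) (auto intro!: cont)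
  have SC: "((\<lambda>t. ?S t * (?C t * k t) + ?C t * ?IC t) has_integral (?S x * ?IC x - ?S 0 * ?IC 0)) {0..x}"
    by (rule r[OF aC I[OF aC] fund_sin_deriv]) (auto intro!: cont)
  have CC: "((\<lambda>t. ?C t * (?C t * k t) + (- z * ?S t) * ?IC t) has_integral (?C x * ?IC x - ?C 0 * ?IC 0)) {0..x}"
    by (rule r[OF aC I[OF aC] fund_cos_deriv]) (auto intro!: cont)
  have SS: "((\<lambda>t. (z * ?S t) * (?S t * k t) + (z * ?C t) * ?IS t) has_integral ((z * ?S x) * ?IS x - (z * ?S 0) * ?IS 0)) {0..x}"
    by (rule r[OF aS I[OF aS] fund_cos_scaled_deriv]) (auto intro!: cont)
  have "((\<lambda>t. duhamel' z k t) has_integral (duhamel z k x - duhamel z k 0)) {0..x}"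
    using has_integral_diff[OF CS SC] by (simp add: duhamel_def duhamel'_def algebra_simps)
  moreover have "((\<lambda>t. - z * duhamel z k t - k t) has_integral (duhamel' z k x - duhamel' z k 0)) {0..x}"
  proof -
    have eq: "- z * duhamel z k t - k t = - (?C t * (?C t * k t) + (- z * ?S t) * ?IC t)
        - ((z * ?S t) * (?S t * k t) + (z * ?C t) * ?IS t)" for t
    proof -
      have "k t = (?C t * ?C t + z * (?S t * ?S t)) * k t" by (simp add: fund_pythagoras)
      then show ?thesis unfolding duhamel_def by (simp add: algebra_simps)
    qed
    have "- (?C x * ?IC x - ?C 0 * ?IC 0) - ((z * ?S x) * ?IS x - (z * ?S 0) * ?IS 0)
        = duhamel' z k x - duhamel' z k 0"
      by (simp add: duhamel'_def)
    then show ?thesis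
      using has_integral_diff[OF has_integral_neg[OF CC] SS] by (simp only: eq)
  qed
  ultimately show "(duhamel' z k has_integral (duhamel z k x - duhamel z k 0)) {0..x} \<and>
    ((\<lambda>t. - z * duhamel z k t - k t) has_integral (duhamel' z k x - duhamel' z k 0)) {0..x}" by blast
qed

lemma edge_solution_homogeneous:
  "edge_solution L z (\<lambda>x. fund_cos z x * a + fund_sin z x * b)
     (\<lambda>x. - z * fund_sin z x * a + fund_cos z x * b) (\<lambda>_. 0)"
  unfolding edge_solution_def
proof (intro ballI conjI)
  fix x assume x: "x \<in> {0..L}"
  note d = has_vector_derivative_mult_left[OF fund_cos_deriv] has_vector_derivative_mult_left[OF fund_sin_deriv]
    has_vector_derivative_mult_left[OF has_vector_derivative_mult_right[OF fund_sin_deriv]]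
  have "((\<lambda>x. fund_cos z x * a + fund_sin z x * b) has_vector_derivative
      - z * fund_sin z t * a + fund_cos z t * b) (at t within S)" for t S
    by (rule has_vector_derivative_add d)+
  then show "((\<lambda>x. - z * fund_sin z x * a + fund_cos z x * b) has_integral
      (fund_cos z x * a + fund_sin z x * b) - (fund_cos z 0 * a + fund_sin z 0 * b)) {0..x}"
    by (intro fundamental_theorem_of_calculus) (use x in auto)
  have "((\<lambda>x. - z * fund_sin z x * a + fund_cos z x * b) has_vector_derivative
      - z * fund_cos z x * a + - z * fund_sin z x * b) (at x within S)" for x S
    by (rule has_vector_derivative_add d)+
  then show "((\<lambda>t. - z * (fund_cos z t * a + fund_sin z t * b) - 0) has_integral
      (- z * fund_sin z x * a + fund_cos z x * b) - (- z * fund_sin z 0 * a + fund_cos z 0 * b)) {0..x}"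
    by (intro fundamental_theorem_of_calculus) (use x in \<open>auto simp: algebra_simps\<close>)
qed

lemma edge_solution_add:
  assumes "edge_solution L z u u' k" "edge_solution L z v v' l"
  shows "edge_solution L z (\<lambda>x. u x + v x) (\<lambda>x. u' x + v' x) (\<lambda>x. k x + l x)"
  unfolding edge_solution_def
proof (intro ballI conjI)
  fix x assume x: "x \<in> {0..L}"
  show "((\<lambda>x. u' x + v' x) has_integral u x + v x - (u 0 + v 0)) {0..x}"
    using has_integral_add[of u' "u x - u 0" "{0..x}" v' "v x - v 0"] assms x
    by (simp add: edge_solution_def algebra_simps)
  show "((\<lambda>t. - z * (u t + v t) - (k t + l t)) has_integral u' x + v' x - (u' 0 + v' 0)) {0..x}"
    using has_integral_add[of "\<lambda>t. - z * u t - k t" "u' x - u' 0" "{0..x}" "\<lambda>t. - z * v t - l t" "v' x - v' 0"] assms x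
    by (simp add: edge_solution_def algebra_simps)
qed

text \<open>
  One constant \<open>M\<close> for all right hand sides \<open>k\<close>: this is what makes the resolvent bounded.
\<close>

lemma duhamel_bound:
  assumes L: "0 < L"
  obtains M where "0 \<le> M"
    "\<And>x. x \<in> {0..L} \<Longrightarrow> cmod (fund_cos z x) \<le> M \<and> cmod (fund_sin z x) \<le> M"
    "\<And>k x. square_integrable L k \<Longrightarrow> x \<in> {0..L} \<Longrightarrow>
      cmod (duhamel z k x) \<le> M * edge_L2 L k \<and> cmod (duhamel' z k x) \<le> M * edge_L2 L k"
proof -
  let ?C = "fund_cos z" and ?S = "fund_sin z"
  obtain c where c: "\<And>x. x \<in> {0..L} \<Longrightarrow> cmod (?C x) \<le> c"
    using continuous_on_interval_bounded[OF fund_continuous(1)[of "{0..L}" z]] by metis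
  obtain s where s: "\<And>x. x \<in> {0..L} \<Longrightarrow> cmod (?S x) \<le> s"
    using continuous_on_interval_bounded[OF fund_continuous(2)[of "{0..L}" z]] by metis
  define B where "B = max c s"
  have B: "\<And>x. x \<in> {0..L} \<Longrightarrow> cmod (?C x) \<le> B" "\<And>x. x \<in> {0..L} \<Longrightarrow> cmod (?S x) \<le> B"
    using c s by (auto simp: B_def intro: max.coboundedI1 max.coboundedI2)
  have B0: "0 \<le> B" using order_trans[OF norm_ge_zero B(1)[of 0]] L by auto
  define n where "n k = edge_L2 L k" for k
  have I: "cmod (integral {0..x} (\<lambda>t. f t * k t)) \<le> B * (sqrt L * n k)"
    if k: "square_integrable L k" and x: "x \<in> {0..L}" and f: "continuous_on {0..L} f"
      "\<And>x. x \<in> {0..L} \<Longrightarrow> cmod (f x) \<le> B" for f k x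
  proof -
    have ai: "k absolutely_integrable_on {0..L}" by (rule square_integrable_imp_absolutely_integrable[OF k])
    have aix: "k absolutely_integrable_on {0..x}" by (rule absolutely_integrable_on_subinterval[OF ai]) (use x in auto)
    have "cmod (integral {0..x} (\<lambda>t. f t * k t)) \<le> integral {0..x} (\<lambda>t. B * norm (k t))"
    proof (rule integral_norm_bound_integral)
      show "(\<lambda>t. f t * k t) integrable_on {0..x}"
        by (intro set_lebesgue_integral_eq_integral(1) absolutely_integrable_continuous_mult aix
            continuous_on_subset[OF f(1)]) (use x in auto)
      show "(\<lambda>t. B * norm (k t)) integrable_on {0..x}"
        using aix by (intro integrable_on_mult_right) (auto simp: absolutely_integrable_on_def)
    qed (use x f(2) in \<open>auto simp: norm_mult intro!: mult_right_mono\<close>)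
    also have "\<dots> = B * integral {0..x} (\<lambda>t. norm (k t))" by simp
    also have "\<dots> \<le> B * integral {0..L} (\<lambda>t. norm (k t))"
      using aix ai x B0 by (intro mult_left_mono integral_subset_le) (auto simp: absolutely_integrable_on_def)
    also have "\<dots> \<le> B * (sqrt L * n k)"
      unfolding n_def using B0 integral_norm_le_L2[OF k L] by (intro mult_left_mono)
    finally show ?thesis .
  qed
  define M where "M = (1 + cmod z) * 2 * B * B * sqrt L"
  have n0: "0 \<le> n k" for k by (simp add: n_def)
  have M0: "0 \<le> 2 * B * B * sqrt L" using B0 L by simp
  have M: "2 * B * B * sqrt L \<le> M"
    using mult_right_mono[OF _ M0, of 1 "1 + cmod z"] by (simp add: M_def mult_ac)
  have "cmod (duhamel z k x) \<le> M * n k \<and> cmod (duhamel' z k x) \<le> M * n k"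
    if kx: "square_integrable L k" "x \<in> {0..L}" for k x
  proof
    note IC = I[OF kx fund_continuous(1) B(1)] and IS = I[OF kx fund_continuous(2) B(2)]
    have p: "cmod (p x * integral {0..x} (\<lambda>t. q t * k t)) \<le> B * (B * (sqrt L * n k))"
      if "p \<in> {?C, ?S}" "q \<in> {?C, ?S}" for p q
      using that IC IS B[OF kx(2)] B0 n0 unfolding norm_mult by (intro mult_mono) auto
    have "cmod (duhamel z k x) \<le> B * (B * (sqrt L * n k)) + B * (B * (sqrt L * n k))"
      unfolding duhamel_def by (rule order_trans[OF norm_triangle_ineq4 add_mono[OF p p]]) auto
    also have "\<dots> = (2 * B * B * sqrt L) * n k" by simp
    also have "\<dots> \<le> M * n k" by (rule mult_right_mono[OF M n0])
    finally show "cmod (duhamel z k x) \<le> M * n k" .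
    have "cmod (duhamel' z k x) \<le> B * (B * (sqrt L * n k)) + cmod z * (B * (B * (sqrt L * n k)))"
      unfolding duhamel'_def
    proof (rule order_trans[OF norm_triangle_ineq4 add_mono])
      show "cmod (- (?C x * integral {0..x} (\<lambda>t. ?C t * k t))) \<le> B * (B * (sqrt L * n k))"
        unfolding norm_minus_cancel by (rule p) auto
      show "cmod (z * (?S x * integral {0..x} (\<lambda>t. ?S t * k t))) \<le> cmod z * (B * (B * (sqrt L * n k)))"
        unfolding norm_mult[of z] by (intro mult_left_mono p) auto
    qed
    also have "\<dots> = (1 + cmod z) * (B * (B * (sqrt L * n k)))" by (simp add: algebra_simps)
    also have "\<dots> \<le> 2 * ((1 + cmod z) * (B * (B * (sqrt L * n k))))"
    proof -
      have "0 \<le> (1 + cmod z) * (B * (B * (sqrt L * n k)))"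
        using n0[of k] B0 L by simp
      then show ?thesis by linarith
    qed
    also have "\<dots> = M * n k" by (simp add: M_def)
    finally show "cmod (duhamel' z k x) \<le> M * n k" .
  qed
  moreover have "M * n k \<le> (M + B) * n k" for k using B0 n0 by (intro mult_right_mono) auto
  ultimately have "cmod (duhamel z k x) \<le> (M + B) * n k \<and> cmod (duhamel' z k x) \<le> (M + B) * n k"
    if "square_integrable L k" "x \<in> {0..L}" for k x
    using that by (meson order_trans)
  moreover have "cmod (?C x) \<le> M + B \<and> cmod (?S x) \<le> M + B" if "x \<in> {0..L}" for x
    using B(1)[OF that] B(2)[OF that] M M0 by linarith
  moreover have "0 \<le> M + B" using B0 M M0 by linarith
  ultimately show thesis unfolding n_def by (intro that) auto
qed

section \<open>Finite linear systems and dimensions\<close>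

text \<open>
  Injectivity makes the images of the \<open>n\<close> unit vectors independent; as they lie in a space spanned by
  \<open>n\<close> vectors, they span it.  Expressing the unit vectors by them gives the inverse matrix \<open>b\<close>, and
  hence \<open>K\<close>.  Only the coordinates in \<open>D\<close> are equations and unknowns.
\<close>

lemma square_system_solvable:
  fixes A :: "('d \<Rightarrow> complex) \<Rightarrow> 'd \<Rightarrow> complex"
  assumes fin: "finite D"
    and add: "\<And>x y. A (\<lambda>d. x d + y d) = (\<lambda>d. A x d + A y d)"
    and scale: "\<And>c x. A (\<lambda>d. c * x d) = (\<lambda>d. c * A x d)"
    and inj: "\<And>x. \<forall>d. d \<notin> D \<longrightarrow> x d = 0 \<Longrightarrow> \<forall>d\<in>D. A x d = 0 \<Longrightarrow> \<forall>d\<in>D. x d = 0"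
  obtains K where "0 \<le> K"
    "\<And>y. \<exists>x. (\<forall>d\<in>D. A x d = y d) \<and> (\<forall>d. cmod (x d) \<le> K * (\<Sum>k\<in>D. cmod (y k)))"
proof -
  interpret vs: vector_space "\<lambda>(c::complex) (x :: 'd \<Rightarrow> complex) d. c * x d"
    by standard (auto simp: fun_eq_iff algebra_simps)
  define e where "e k = (\<lambda>d. if d = k then 1 else 0 :: complex)" for k :: 'd
  \<comment> \<open>cut off outside \<open>D\<close>, so that all images lie in the span of the unit vectors in \<open>D\<close>\<close>
  define A' where "A' x = (\<lambda>d. if d \<in> D then A x d else 0)" for x
  have A0: "A (\<lambda>d. 0) = (\<lambda>d. 0)" using scale[of 0 "\<lambda>d. 0"] by simp
  have A_sum: "A (\<lambda>d. \<Sum>k\<in>S. c k * f k d) = (\<lambda>d. \<Sum>k\<in>S. c k * A (f k) d)" if "finite S" for S c f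
    using that
  proof (induction S)
    case (insert k S)
    then show ?case using add[of "\<lambda>d. c k * f k d" "\<lambda>d. \<Sum>k\<in>S. c k * f k d"] scale[of "c k" "f k"]
      by simp
  qed (simp add: A0)
  have e_expand: "(\<Sum>k\<in>D. c k * e k d) = (if d \<in> D then c d else 0)" for c d
    using fin by (simp add: e_def if_distrib[of "\<lambda>x. _ * x"] sum.delta cong: if_cong)
  have coeffs0: "\<forall>k\<in>D. c k = 0" if "\<And>d. d \<in> D \<Longrightarrow> (\<Sum>k\<in>D. c k * A (e k) d) = 0" for c
  proof -
    have "\<forall>d\<in>D. (\<lambda>d. \<Sum>k\<in>D. c k * e k d) d = 0"
    proof (rule inj)
      show "\<forall>d\<in>D. A (\<lambda>d. \<Sum>k\<in>D. c k * e k d) d = 0" using that by (simp add: A_sum[OF fin])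
    qed (simp add: e_expand)
    then show ?thesis by (simp add: e_expand)
  qed
  have inj_Ae: "inj_on (\<lambda>k. A' (e k)) D"
  proof (rule inj_onI, rule ccontr)
    fix j k assume jk: "j \<in> D" "k \<in> D" "A' (e j) = A' (e k)" "j \<noteq> k"
    have "A (e j) d = A (e k) d" if "d \<in> D" for d
      using fun_cong[OF jk(3), of d] that by (simp add: A'_def)
    moreover have "(\<Sum>i\<in>D. (if i = j then 1 else if i = k then -1 else 0) * A (e i) d) = A (e j) d - A (e k) d" for d
    proof -
      have "(\<Sum>i\<in>D. (if i = j then 1 else if i = k then -1 else 0) * A (e i) d)
        = (\<Sum>i\<in>D. (if i = j then A (e i) d else 0) - (if i = k then A (e i) d else 0))"
        using jk(4) by (intro sum.cong) auto
      also have "\<dots> = A (e j) d - A (e k) d" using fin jk by (simp add: sum_subtractf sum.delta)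
      finally show ?thesis .
    qed
    ultimately have "\<forall>i\<in>D. (if i = j then 1 else if i = k then -1 else 0) = (0::complex)"
      by (intro coeffs0) simp
    then show False using jk(1) by auto
  qed
  define V where "V = (\<lambda>k. A' (e k)) ` D"
  have finV: "finite V" and cardV: "card V = card D"
    using fin inj_Ae by (auto simp: V_def card_image)
  have indep: "vs.independent V"
  proof (rule vs.independent_if_scalars_zero[OF finV])
    fix f v assume s: "(\<Sum>x\<in>V. (\<lambda>d. f x * x d)) = 0" and v: "v \<in> V"
    have "(\<Sum>k\<in>D. f (A' (e k)) * A (e k) d) = 0" if "d \<in> D" for d
    proof -
      have "(\<Sum>x\<in>V. (\<lambda>d. f x * x d)) d = (\<Sum>k\<in>D. f (A' (e k)) * A' (e k) d)"
        unfolding V_def by (subst sum.reindex[OF inj_Ae]) (induction D rule: infinite_finite_induct; simp)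
      then show ?thesis using s that by (simp add: A'_def)
    qed
    from coeffs0[OF this] show "f v = 0" using v by (auto simp: V_def)
  qed
  have span_e: "x \<in> vs.span (e ` D)" if "\<And>d. d \<notin> D \<Longrightarrow> x d = 0" for x
  proof -
    have "(\<Sum>k\<in>D. (\<lambda>d. x k * e k d)) \<in> vs.span (e ` D)"
      by (intro vs.span_sum vs.span_scale vs.span_base) auto
    moreover have "(\<Sum>k\<in>D. (\<lambda>d. x k * e k d)) d = x d" for d
    proof -
      have "(\<Sum>k\<in>D. (\<lambda>d. x k * e k d)) d = (\<Sum>k\<in>D. x k * e k d)"
        by (induction D rule: infinite_finite_induct) auto
      then show ?thesis using that[of d] by (simp add: e_expand)
    qed
    ultimately show ?thesis by (metis ext)
  qed
  have "e j \<in> vs.span V" if j: "j \<in> D" for j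
  proof (rule ccontr)
    assume n: "e j \<notin> vs.span V"
    then have i: "vs.independent (insert (e j) V)" by (rule vs.independent_insertI[OF _ indep])
    have "insert (e j) V \<subseteq> vs.span (e ` D)"
      using j unfolding V_def by (intro subsetI span_e) (auto simp: A'_def e_def)
    from vs.independent_span_bound[OF _ i this] fin
    have "card (insert (e j) V) \<le> card (e ` D)" by auto
    moreover have "e j \<notin> V" using n vs.span_base by blast
    ultimately have "card D + 1 \<le> card (e ` D)" using finV cardV by simp
    then show False using card_image_le[OF fin, of e] by simp
  qed
  then have ex: "\<exists>b. \<forall>d\<in>D. (\<Sum>k\<in>D. b k * A (e k) d) = e j d" if j: "j \<in> D" for j
  proof -
    obtain r where r: "e j = (\<Sum>v\<in>V. (\<lambda>d. r v * v d))"
      using \<open>\<And>j. j \<in> D \<Longrightarrow> e j \<in> vs.span V\<close>[OF j] unfolding vs.span_finite[OF finV] by auto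
    have "(\<Sum>k\<in>D. r (A' (e k)) * A (e k) d) = e j d" if "d \<in> D" for d
    proof -
      have "(\<Sum>v\<in>V. (\<lambda>d. r v * v d)) d = (\<Sum>k\<in>D. r (A' (e k)) * A' (e k) d)"
        unfolding V_def by (subst sum.reindex[OF inj_Ae]) (induction D rule: infinite_finite_induct; simp)
      then show ?thesis using r that by (simp add: A'_def)
    qed
    then show ?thesis by (intro exI[of _ "\<lambda>k. r (A' (e k))"] ballI)
  qed
  obtain b where b: "\<And>j d. j \<in> D \<Longrightarrow> d \<in> D \<Longrightarrow> (\<Sum>k\<in>D. b j k * A (e k) d) = e j d"
  proof -
    have "\<forall>j\<in>D. \<exists>b. \<forall>d\<in>D. (\<Sum>k\<in>D. b k * A (e k) d) = e j d" using ex by simp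
    from bchoice[OF this] that show thesis by blast
  qed
  define K where "K = (\<Sum>j\<in>D. \<Sum>k\<in>D. cmod (b j k))"
  show thesis
  proof
    show "0 \<le> K" by (auto simp: K_def intro!: sum_nonneg)
    fix y :: "'d \<Rightarrow> complex"
    define c where "c k = (\<Sum>j\<in>D. y j * b j k)" for k
    define x where "x d = (\<Sum>k\<in>D. c k * e k d)" for d
    have "A x d = y d" if d: "d \<in> D" for d
    proof -
      have "A x d = (\<Sum>k\<in>D. \<Sum>j\<in>D. y j * b j k * A (e k) d)"
        unfolding x_def[abs_def] A_sum[OF fin] c_def by (simp add: sum_distrib_right)
      also have "\<dots> = (\<Sum>j\<in>D. y j * (\<Sum>k\<in>D. b j k * A (e k) d))"
        by (subst sum.swap) (simp add: sum_distrib_left mult.assoc)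
      also have "\<dots> = (\<Sum>j\<in>D. y j * e j d)" using b d by (intro sum.cong) auto
      also have "\<dots> = y d" using d by (simp add: e_expand)
      finally show ?thesis .
    qed
    moreover have "cmod (x d) \<le> K * (\<Sum>k\<in>D. cmod (y k))" for d
    proof (cases "d \<in> D")
      case True
      have le: "cmod (b j d) \<le> K" if "j \<in> D" for j
      proof -
        have "cmod (b j d) \<le> (\<Sum>k\<in>D. cmod (b j k))" using fin True by (intro member_le_sum) auto
        also have "\<dots> \<le> K" unfolding K_def using fin that
          by (intro member_le_sum[of j D "\<lambda>j. \<Sum>k\<in>D. cmod (b j k)"]) (auto intro: sum_nonneg)
        finally show ?thesis .
      qed
      have "cmod (x d) = cmod (\<Sum>j\<in>D. y j * b j d)" using True by (simp add: x_def e_expand c_def)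
      also have "\<dots> \<le> (\<Sum>j\<in>D. cmod (y j) * K)"
        by (intro order_trans[OF norm_sum] sum_mono) (auto simp: norm_mult le intro: mult_left_mono)
      finally show ?thesis by (simp add: sum_distrib_left sum_distrib_right mult.commute)
    qed (auto simp: x_def e_expand K_def intro!: mult_nonneg_nonneg sum_nonneg)
    ultimately show "\<exists>x. (\<forall>d\<in>D. A x d = y d) \<and> (\<forall>d. cmod (x d) \<le> K * (\<Sum>k\<in>D. cmod (y k)))" by blast
  qed
qed

interpretation edge_functions: vector_space cscale
  by standard (auto simp: cscale_def fun_eq_iff algebra_simps)

text \<open>
  The scalars may be transformed by \<open>\<sigma>\<close> in order to cover complex conjugation, which is not linear.
\<close>

lemma dim_semilinear_image:
  fixes \<Gamma> :: "('a \<Rightarrow> real \<Rightarrow> complex) \<Rightarrow> ('b \<Rightarrow> real \<Rightarrow> complex)"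
  assumes add: "\<And>f g. \<Gamma> (f + g) = \<Gamma> f + \<Gamma> g"
    and scale: "\<And>c f. \<Gamma> (cscale c f) = cscale (\<sigma> c) (\<Gamma> f)"
    and surj: "surj \<sigma>"
    and inj: "inj_on \<Gamma> (edge_functions.span E)"
  shows "vector_space.dim cscale (\<Gamma> ` E) = vector_space.dim cscale E"
proof -
  have zero: "\<Gamma> 0 = 0" using add[of 0 0] by simp
  have span_image: "edge_functions.span (\<Gamma> ` B) = \<Gamma> ` edge_functions.span B" for B
  proof
    show "edge_functions.span (\<Gamma> ` B) \<subseteq> \<Gamma> ` edge_functions.span B"
    proof (rule edge_functions.span_minimal)
      show "edge_functions.subspace (\<Gamma> ` edge_functions.span B)"
      proof (rule edge_functions.subspaceI)
        show "0 \<in> \<Gamma> ` edge_functions.span B" using zero edge_functions.span_zero by force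
        show "x + y \<in> \<Gamma> ` edge_functions.span B"
          if "x \<in> \<Gamma> ` edge_functions.span B" "y \<in> \<Gamma> ` edge_functions.span B" for x y
          using that edge_functions.span_add add by (smt (verit) image_iff)
        show "cscale c x \<in> \<Gamma> ` edge_functions.span B" if "x \<in> \<Gamma> ` edge_functions.span B" for c x
          using that edge_functions.span_scale scale surj by (smt (verit) image_iff surjD)
      qed
    qed (auto intro: edge_functions.span_base)
    show "\<Gamma> ` edge_functions.span B \<subseteq> edge_functions.span (\<Gamma> ` B)"
    proof safe
      fix f assume "f \<in> edge_functions.span B"
      then show "\<Gamma> f \<in> edge_functions.span (\<Gamma> ` B)"
      proof (induction rule: edge_functions.span_induct_alt)
        case base show ?case unfolding zero by (rule edge_functions.span_zero)
      next
        case (step c x y)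
        then show ?case
          unfolding add scale
          by (meson edge_functions.span_add edge_functions.span_scale edge_functions.span_base imageI)
      qed
    qed
  qed
  obtain B where B: "B \<subseteq> E" "edge_functions.independent B" "E \<subseteq> edge_functions.span B"
      "card B = edge_functions.dim E"
    by (rule edge_functions.basis_exists)
  have BE: "edge_functions.span B \<subseteq> edge_functions.span E" by (rule edge_functions.span_mono[OF B(1)])
  have injB: "inj_on \<Gamma> B"
    using inj B(1) edge_functions.span_base by (meson inj_on_subset subsetI subset_iff)
  have "edge_functions.independent (\<Gamma> ` B)"
    unfolding edge_functions.dependent_def
  proof safe
    fix a assume a: "a \<in> B" "\<Gamma> a \<in> edge_functions.span (\<Gamma> ` B - {\<Gamma> a})"
    have "\<Gamma> ` B - {\<Gamma> a} = \<Gamma> ` (B - {a})" using a(1) injB by (auto simp: inj_on_def)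
    then have "\<Gamma> a \<in> \<Gamma> ` edge_functions.span (B - {a})" using a(2) by (simp add: span_image)
    moreover have "edge_functions.span (B - {a}) \<subseteq> edge_functions.span E"
      by (rule edge_functions.span_mono) (use B(1) in auto)
    ultimately have "a \<in> edge_functions.span (B - {a})"
      using inj a(1) B(1) edge_functions.span_base
      by (smt (verit, best) image_iff inj_onD subsetD)
    then show False using B(2) a(1) by (auto simp: edge_functions.dependent_def)
  qed
  moreover have "\<Gamma> ` E \<subseteq> edge_functions.span (\<Gamma> ` B)" using B(3) by (auto simp: span_image)
  ultimately have "edge_functions.dim (\<Gamma> ` E) = card (\<Gamma> ` B)"
    using B(1) by (intro edge_functions.dim_unique[of "\<Gamma> ` B"]) auto
  also have "\<dots> = card B" by (rule card_image[OF injB])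
  finally show ?thesis using B(4) by simp
qed

section \<open>Twisted vertex conditions\<close>

abbreviation darts :: "('v, 'e) metric_graph \<Rightarrow> ('e \<times> bool) set" where
  "darts G \<equiv> edges G \<times> UNIV"

lemma quantum_graph_finite_darts: "quantum_graph G \<Longrightarrow> finite (darts G)"
  by (simp add: quantum_graph_def)

lemma quantum_graph_len_pos: "quantum_graph G \<Longrightarrow> e \<in> edges G \<Longrightarrow> 0 < len G e"
  by (simp add: quantum_graph_def)

lemma quantum_graph_dart_start: "quantum_graph G \<Longrightarrow> d \<in> darts G \<Longrightarrow> dart_start G d \<in> verts G"
  by (cases d) (auto simp: quantum_graph_def)

lemma darts_at_eq: "darts_at G v = {d \<in> darts G. dart_start G d = v}"
  by (auto simp: darts_at_def)

lemma sum_darts_at: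
  assumes "quantum_graph G"
  shows "(\<Sum>v\<in>verts G. sum h (darts_at G v)) = sum h (darts G)"
  unfolding darts_at_eq using assms
  by (intro sum.group) (auto simp: quantum_graph_finite_darts quantum_graph_dart_start, auto simp: quantum_graph_def)

text \<open>
  \<open>w d * val d\<close> is the value that is continuous at the vertices, and \<open>w d * der d\<close> the derivative that
  satisfies the Kirchhoff condition.
\<close>

definition vertex_conditions ::
    "('v, 'e) metric_graph \<Rightarrow> ('e \<times> bool \<Rightarrow> complex) \<Rightarrow> ('e \<times> bool \<Rightarrow> complex) \<Rightarrow>
     ('e \<times> bool \<Rightarrow> complex) \<Rightarrow> bool" where
  "vertex_conditions G w val der \<longleftrightarrow>
     (\<forall>v\<in>verts G. (\<exists>c. \<forall>d\<in>darts_at G v. w d * val d = c) \<and>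
        (\<Sum>d\<in>darts_at G v. of_real (normal_sign d) * (w d * der d)) = 0)"

definition at_dart :: "('v, 'e) metric_graph \<Rightarrow> ('e \<Rightarrow> real \<Rightarrow> 'a) \<Rightarrow> 'e \<times> bool \<Rightarrow> 'a" where
  "at_dart G u d = u (fst d) (end_point G d)"

definition twisted_solution ::
    "('v, 'e) metric_graph \<Rightarrow> ('e \<times> bool \<Rightarrow> complex) \<Rightarrow> complex \<Rightarrow> ('e \<Rightarrow> real \<Rightarrow> complex) \<Rightarrow>
     ('e \<Rightarrow> real \<Rightarrow> complex) \<Rightarrow> ('e \<Rightarrow> real \<Rightarrow> complex) \<Rightarrow> bool" where
  "twisted_solution G w z u u' k \<longleftrightarrow>
     (\<forall>e\<in>edges G. edge_solution (len G e) z (u e) (u' e) (k e)) \<and>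
     vertex_conditions G w (at_dart G u) (at_dart G u')"

definition twisted_eigenspace ::
    "('v, 'e) metric_graph \<Rightarrow> ('e \<times> bool \<Rightarrow> complex) \<Rightarrow> complex \<Rightarrow> ('e \<Rightarrow> real \<Rightarrow> complex) set" where
  "twisted_eigenspace G w z = {u. supported G u \<and> (\<exists>u'. twisted_solution G w z u u' 0)}"

lemma end_point_mem:
  assumes "quantum_graph G" "d \<in> darts G"
  shows "end_point G d \<in> {0..len G (fst d)}"
  using quantum_graph_len_pos[OF assms(1), of "fst d"] assms(2) by (cases d) (auto simp: end_point_def)

lemma edge_solution_cong:
  assumes "edge_solution L z u u' k"
    "\<And>x. x \<in> {0..L} \<Longrightarrow> u x = v x" "\<And>x. x \<in> {0..L} \<Longrightarrow> u' x = v' x"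
    "\<And>x. x \<in> {0..L} \<Longrightarrow> k x = l x"
  shows "edge_solution L z v v' l"
  unfolding edge_solution_def
proof (intro ballI conjI)
  fix x assume x: "x \<in> {0..L}"
  then have sol: "(u' has_integral v x - v 0) {0..x}"
    "((\<lambda>t. - z * u t - k t) has_integral v' x - v' 0) {0..x}"
    using assms by (auto simp: edge_solution_def)
  show "(v' has_integral v x - v 0) {0..x}"
    by (rule has_integral_eq[OF _ sol(1)]) (use assms x in auto)
  show "((\<lambda>t. - z * v t - l t) has_integral v' x - v' 0) {0..x}"
    by (rule has_integral_eq[OF _ sol(2)]) (use assms x in auto)
qed

lemma vertex_conditions_cong:
  assumes "vertex_conditions G w val der"
    "\<And>d. d \<in> darts G \<Longrightarrow> val d = val' d" "\<And>d. d \<in> darts G \<Longrightarrow> der d = der' d"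
  shows "vertex_conditions G w val' der'"
proof -
  have eq: "val d = val' d" "der d = der' d" if "d \<in> darts_at G v" for d v
    using assms(2,3) that by (auto simp: darts_at_eq)
  have "(\<Sum>d\<in>darts_at G v. of_real (normal_sign d) * (w d * der d))
      = (\<Sum>d\<in>darts_at G v. of_real (normal_sign d) * (w d * der' d))" for v
    using eq(2) by (intro sum.cong) auto
  then show ?thesis using assms(1) eq(1) by (simp add: vertex_conditions_def)
qed

lemma twisted_solution_cong:
  assumes "quantum_graph G" "twisted_solution G w z u u' k"
    and eq: "\<And>e x. e \<in> edges G \<Longrightarrow> x \<in> {0..len G e} \<Longrightarrow> u e x = v e x"
    "\<And>e x. e \<in> edges G \<Longrightarrow> x \<in> {0..len G e} \<Longrightarrow> u' e x = v' e x"
    "\<And>e x. e \<in> edges G \<Longrightarrow> x \<in> {0..len G e} \<Longrightarrow> k e x = l e x"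
  shows "twisted_solution G w z v v' l"
  unfolding twisted_solution_def
proof
  show "\<forall>e\<in>edges G. edge_solution (len G e) z (v e) (v' e) (l e)"
  proof
    fix e assume e: "e \<in> edges G"
    then have "edge_solution (len G e) z (u e) (u' e) (k e)" using assms(2) by (simp add: twisted_solution_def)
    then show "edge_solution (len G e) z (v e) (v' e) (l e)"
      by (rule edge_solution_cong) (use eq e in auto)
  qed
  show "vertex_conditions G w (at_dart G v) (at_dart G v')"
  proof (rule vertex_conditions_cong)
    show "vertex_conditions G w (at_dart G u) (at_dart G u')"
      using assms(2) by (simp add: twisted_solution_def)
    fix d assume d: "d \<in> darts G"
    then have "fst d \<in> edges G" by auto
    then show "at_dart G u d = at_dart G v d" "at_dart G u' d = at_dart G v' d"
      unfolding at_dart_def using eq end_point_mem[OF assms(1) d] by blast+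
  qed
qed

definition base_dart :: "('v, 'e) metric_graph \<Rightarrow> 'v \<Rightarrow> 'e \<times> bool" where
  "base_dart G v = (SOME d. d \<in> darts_at G v)"

section \<open>The resolvent equation as a finite linear system\<close>

text \<open>
  The vertex conditions as one equation per dart: at a vertex of degree \<open>n\<close> there are \<open>n - 1\<close>
  equations for continuity, comparing the values with the one at a chosen base dart, and the
  Kirchhoff condition takes the place of the base dart.
\<close>

definition vertex_defect ::
    "('v, 'e) metric_graph \<Rightarrow> ('e \<times> bool \<Rightarrow> complex) \<Rightarrow> ('e \<times> bool \<Rightarrow> complex) \<Rightarrow>
     ('e \<times> bool \<Rightarrow> complex) \<Rightarrow> 'e \<times> bool \<Rightarrow> complex" where
  "vertex_defect G w val der d =
     (let v = dart_start G d; b = base_dart G v in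
      if d = b then \<Sum>d\<in>darts_at G v. of_real (normal_sign d) * (w d * der d)
      else w d * val d - w b * val b)"

lemma base_dart_mem: "d \<in> darts_at G v \<Longrightarrow> base_dart G v \<in> darts_at G v"
  unfolding base_dart_def by (rule someI)

lemma vertex_conditions_iff_defect:
  assumes "quantum_graph G"
  shows "vertex_conditions G w val der \<longleftrightarrow> (\<forall>d\<in>darts G. vertex_defect G w val der d = 0)"
proof
  assume vc: "vertex_conditions G w val der"
  show "\<forall>d\<in>darts G. vertex_defect G w val der d = 0"
  proof
    fix d assume d: "d \<in> darts G"
    then have v: "dart_start G d \<in> verts G" and dv: "d \<in> darts_at G (dart_start G d)"
      using quantum_graph_dart_start[OF assms] by (auto simp: darts_at_eq)
    then show "vertex_defect G w val der d = 0"
      using vc base_dart_mem[OF dv] by (auto simp: vertex_conditions_def vertex_defect_def Let_def)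
  qed
next
  assume vd: "\<forall>d\<in>darts G. vertex_defect G w val der d = 0"
  show "vertex_conditions G w val der"
    unfolding vertex_conditions_def
  proof
    fix v assume "v \<in> verts G"
    show "(\<exists>c. \<forall>d\<in>darts_at G v. w d * val d = c) \<and>
        (\<Sum>d\<in>darts_at G v. of_real (normal_sign d) * (w d * der d)) = 0"
    proof (cases "darts_at G v = {}")
      case False
      then have b: "base_dart G v \<in> darts_at G v" using base_dart_mem by fastforce
      then have "vertex_defect G w val der (base_dart G v) = 0" "dart_start G (base_dart G v) = v"
        using vd by (auto simp: darts_at_eq)
      then have "(\<Sum>d\<in>darts_at G v. of_real (normal_sign d) * (w d * der d)) = 0"
        by (simp add: vertex_defect_def Let_def)
      moreover have "w d * val d = w (base_dart G v) * val (base_dart G v)" if "d \<in> darts_at G v" for d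
      proof -
        have "vertex_defect G w val der d = 0" "dart_start G d = v"
          using vd that by (auto simp: darts_at_eq)
        then show ?thesis by (auto simp: vertex_defect_def Let_def split: if_splits)
      qed
      ultimately show ?thesis by blast
    qed simp
  qed
qed

lemma vertex_defect_add:
  "vertex_defect G w (\<lambda>d. val d + val' d) (\<lambda>d. der d + der' d) d
     = vertex_defect G w val der d + vertex_defect G w val' der' d"
  by (auto simp: vertex_defect_def Let_def algebra_simps sum.distrib)

lemma vertex_defect_scale:
  "vertex_defect G w (\<lambda>d. c * val d) (\<lambda>d. c * der d) d = c * vertex_defect G w val der d"
  by (auto simp: vertex_defect_def Let_def algebra_simps sum_distrib_left)

lemma vertex_defect_bound:
  assumes G: "quantum_graph G" and d: "d \<in> darts G"
    and m: "\<And>d. d \<in> darts G \<Longrightarrow> cmod (val d) \<le> m" "\<And>d. d \<in> darts G \<Longrightarrow> cmod (der d) \<le> m"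
  shows "cmod (vertex_defect G w val der d) \<le> 2 * (\<Sum>d\<in>darts G. cmod (w d)) * m"
proof -
  let ?v = "dart_start G d" and ?W = "\<Sum>d\<in>darts G. cmod (w d)"
  have m0: "0 \<le> m" using m(1)[OF d] norm_ge_zero order_trans by blast
  have W0: "0 \<le> ?W" by (rule sum_nonneg) auto
  have fin: "finite (darts G)" by (rule quantum_graph_finite_darts[OF G])
  have le: "cmod (w d) \<le> ?W" if "d \<in> darts G" for d
    using fin that by (intro member_le_sum) auto
  have b: "base_dart G ?v \<in> darts G"
    using base_dart_mem[of d G ?v] d by (auto simp: darts_at_eq)
  show ?thesis
  proof (cases "d = base_dart G ?v")
    case True
    have "vertex_defect G w val der d = (\<Sum>d\<in>darts_at G ?v. of_real (normal_sign d) * (w d * der d))"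
      unfolding vertex_defect_def Let_def by (rule if_P[OF True])
    also have "cmod \<dots> \<le> (\<Sum>d\<in>darts_at G ?v. cmod (w d) * m)"
      by (intro order_trans[OF norm_sum] sum_mono)
        (auto simp: norm_mult normal_sign_def darts_at_eq m intro!: mult_left_mono)
    also have "\<dots> \<le> (\<Sum>d\<in>darts G. cmod (w d) * m)"
      using fin m0 by (intro sum_mono2) (auto simp: darts_at_eq)
    also have "\<dots> = ?W * m" by (simp add: sum_distrib_right)
    finally show ?thesis using W0 m0 mult_nonneg_nonneg[OF W0 m0] by linarith
  next
    case False
    then have "cmod (vertex_defect G w val der d) = cmod (w d * val d - w (base_dart G ?v) * val (base_dart G ?v))"
      by (simp add: vertex_defect_def Let_def)
    also have "\<dots> \<le> cmod (w d) * cmod (val d) + cmod (w (base_dart G ?v)) * cmod (val (base_dart G ?v))"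
      by (metis norm_mult norm_triangle_ineq4)
    also have "\<dots> \<le> ?W * m + ?W * m"
      using W0 by (intro add_mono mult_mono le m d b) auto
    finally show ?thesis by (simp add: mult_ac)
  qed
qed

lemma fund_sin_nontrivial:
  assumes "0 < L" "\<And>t. t \<in> {0..L} \<Longrightarrow> fund_sin z t * b = 0"
  shows "b = 0"
proof (rule ccontr)
  assume "b \<noteq> 0"
  then have zero: "fund_sin z t = 0" if "t \<in> {0..L}" for t using assms(2)[OF that] by simp
  have "(fund_sin z has_vector_derivative 0) (at 0 within {0..L})"
  proof (rule has_vector_derivative_transform)
    show "((\<lambda>_. 0) has_vector_derivative (0 :: complex)) (at 0 within {0..L})"
      by (rule has_vector_derivative_const)
  qed (use assms(1) zero in auto)
  moreover have "(fund_sin z has_vector_derivative 1) (at 0 within {0..L})"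
    using fund_sin_deriv[of z 0 "{0..L}"] by simp
  ultimately have "0 = (1::complex)"
    using vector_derivative_unique_within_closed_interval[OF assms(1), of 0 "fund_sin z" 0 1] assms(1)
    by simp
  then show False by simp
qed

text \<open>
  The coefficient at \<open>(e, True)\<close> is the value and the one at \<open>(e, False)\<close> the derivative at the
  tail of \<open>e\<close>.  So the initial data on all edges are indexed by the darts, like the equations.
\<close>

definition free_solution :: "complex \<Rightarrow> ('e \<times> bool \<Rightarrow> complex) \<Rightarrow> 'e \<Rightarrow> real \<Rightarrow> complex" where
  "free_solution z x e t = fund_cos z t * x (e, True) + fund_sin z t * x (e, False)"

definition free_solution' :: "complex \<Rightarrow> ('e \<times> bool \<Rightarrow> complex) \<Rightarrow> 'e \<Rightarrow> real \<Rightarrow> complex" where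
  "free_solution' z x e t = - z * fund_sin z t * x (e, True) + fund_cos z t * x (e, False)"

definition boundary_defect ::
    "('v, 'e) metric_graph \<Rightarrow> ('e \<times> bool \<Rightarrow> complex) \<Rightarrow> complex \<Rightarrow> ('e \<times> bool \<Rightarrow> complex) \<Rightarrow>
     'e \<times> bool \<Rightarrow> complex" where
  "boundary_defect G w z x =
     vertex_defect G w (at_dart G (free_solution z x)) (at_dart G (free_solution' z x))"

definition source_defect ::
    "('v, 'e) metric_graph \<Rightarrow> ('e \<times> bool \<Rightarrow> complex) \<Rightarrow> complex \<Rightarrow> ('e \<Rightarrow> real \<Rightarrow> complex) \<Rightarrow>
     'e \<times> bool \<Rightarrow> complex" where
  "source_defect G w z k = vertex_defect G w
     (at_dart G (\<lambda>e. duhamel z (k e))) (at_dart G (\<lambda>e. duhamel' z (k e)))"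

lemma boundary_defect_add:
  "boundary_defect G w z (\<lambda>d. x d + y d) = (\<lambda>d. boundary_defect G w z x d + boundary_defect G w z y d)"
  unfolding boundary_defect_def vertex_defect_add[symmetric]
  by (simp add: at_dart_def[abs_def] free_solution_def free_solution'_def algebra_simps)

lemma boundary_defect_scale:
  "boundary_defect G w z (\<lambda>d. c * x d) = (\<lambda>d. c * boundary_defect G w z x d)"
  unfolding boundary_defect_def vertex_defect_scale[symmetric]
  by (simp add: at_dart_def[abs_def] free_solution_def free_solution'_def algebra_simps)

text \<open>
  The vertex conditions become a linear system for the initial data \<open>x\<close>.  Its
  coefficients depend on \<open>z\<close> and the weights only, and its right hand side on \<open>k\<close>.
\<close>

lemma twisted_solution_free_duhamel:
  assumes G: "quantum_graph G" and k: "\<And>e. e \<in> edges G \<Longrightarrow> square_integrable (len G e) (k e)"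
  shows "twisted_solution G w z (\<lambda>e t. free_solution z x e t + duhamel z (k e) t)
      (\<lambda>e t. free_solution' z x e t + duhamel' z (k e) t) k
    \<longleftrightarrow> (\<forall>d\<in>darts G. boundary_defect G w z x d + source_defect G w z k d = 0)"
proof -
  have "edge_solution (len G e) z (\<lambda>t. free_solution z x e t + duhamel z (k e) t)
      (\<lambda>t. free_solution' z x e t + duhamel' z (k e) t) (k e)" if e: "e \<in> edges G" for e
    using edge_solution_add[OF edge_solution_homogeneous
        edge_solution_duhamel[OF square_integrable_imp_absolutely_integrable[OF k[OF e]]]]
    by (simp add: free_solution_def free_solution'_def)
  then show ?thesis
    unfolding twisted_solution_def vertex_conditions_iff_defect[OF G] boundary_defect_def source_defect_def
      vertex_defect_add[symmetric]
    by (simp add: at_dart_def[abs_def])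
qed

lemma twisted_solution_eq_free_duhamel:
  fixes u u' :: "'e \<Rightarrow> real \<Rightarrow> complex"
  assumes sol: "twisted_solution G w z u u' k"
    and k: "\<And>e. e \<in> edges G \<Longrightarrow> square_integrable (len G e) (k e)"
    and e: "e \<in> edges G" and t: "t \<in> {0..len G e}"
  defines "x \<equiv> (\<lambda>(e, b). if b then u e 0 else u' e 0)"
  shows "u e t = free_solution z x e t + duhamel z (k e) t"
    "u' e t = free_solution' z x e t + duhamel' z (k e) t"
  using edge_solution_variation_of_constants[OF square_integrable_imp_absolutely_integrable[OF k[OF e]] _ t, of z "u e" "u' e"]
    sol e by (auto simp: twisted_solution_def x_def free_solution_def free_solution'_def)

text \<open>
  Initial data that solve the homogeneous system give a homogeneous solution, and this vanishes by
  assumption.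
\<close>

lemma boundary_defect_injective:
  assumes G: "quantum_graph G" and triv: "twisted_eigenspace G w z \<subseteq> {0}"
    and x: "\<forall>d\<in>darts G. boundary_defect G w z x d = 0"
  shows "\<forall>d\<in>darts G. x d = 0"
proof -
  define u where "u e t = (if e \<in> edges G \<and> t \<in> {0..len G e} then free_solution z x e t else 0)" for e t
  have "source_defect G w z 0 d = 0" for d
    by (simp add: source_defect_def duhamel_def duhamel'_def vertex_defect_def at_dart_def Let_def)
  then have "twisted_solution G w z (\<lambda>e t. free_solution z x e t + duhamel z (0 e) t)
      (\<lambda>e t. free_solution' z x e t + duhamel' z (0 e) t) 0"
    using x by (subst twisted_solution_free_duhamel[OF G]) (auto intro: square_integrable_continuous)
  then have "twisted_solution G w z u (free_solution' z x) 0"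
    by (rule twisted_solution_cong[OF G]) (auto simp: u_def duhamel_def duhamel'_def)
  then have "u \<in> twisted_eigenspace G w z" by (auto simp: twisted_eigenspace_def supported_def u_def)
  then have "u = 0" using triv by auto
  then have free0: "free_solution z x e t = 0" if "e \<in> edges G" "t \<in> {0..len G e}" for e t
  proof -
    have "free_solution z x e t = u e t" using that by (simp add: u_def)
    then show ?thesis using \<open>u = 0\<close> by simp
  qed
  have "x (e, True) = 0 \<and> x (e, False) = 0" if e: "e \<in> edges G" for e
  proof -
    have L: "0 < len G e" by (rule quantum_graph_len_pos[OF G e])
    have a: "x (e, True) = 0" using free0[OF e, of 0] L by (simp add: free_solution_def)
    then have "fund_sin z t * x (e, False) = 0" if "t \<in> {0..len G e}" for t
      using free0[OF e that] by (simp add: free_solution_def)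
    then show ?thesis using a fund_sin_nontrivial[OF L] by blast
  qed
  then have "x (e, b) = 0" if "e \<in> edges G" for e b using that by (cases b) auto
  then show ?thesis by auto
qed

lemma L2_norm_on_edge_le:
  assumes "finite S" "e \<in> S"
  shows "edge_L2 (len G e) (f e) \<le> L2_norm_on G S f"
  unfolding L2_norm_on_def using assms
  by (intro real_sqrt_le_mono member_le_sum[of e S "\<lambda>e. integral\<^sup>L (lebesgue_on {0..len G e}) (\<lambda>x. (cmod (f e x))\<^sup>2)"]) auto

lemma L2_norm_on_nonneg: "0 \<le> L2_norm_on G S f"
  by (auto simp: L2_norm_on_def intro!: sum_nonneg)

lemma L2_norm_on_le_sup:
  assumes "\<And>e x. e \<in> S \<Longrightarrow> x \<in> {0..len G e} \<Longrightarrow> cmod (f e x) \<le> m" "0 \<le> m"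
    "\<And>e. e \<in> S \<Longrightarrow> 0 \<le> len G e"
  shows "L2_norm_on G S f \<le> sqrt (\<Sum>e\<in>S. len G e) * m"
proof -
  have "integral\<^sup>L (lebesgue_on {0..len G e}) (\<lambda>x. (cmod (f e x))\<^sup>2) \<le> len G e * m\<^sup>2" if e: "e \<in> S" for e
  proof -
    have "integral\<^sup>L (lebesgue_on {0..len G e}) (\<lambda>x. (cmod (f e x))\<^sup>2) \<le> integral\<^sup>L (lebesgue_on {0..len G e}) (\<lambda>x. m\<^sup>2)"
      by (rule integral_mono') (use assms(1)[OF e] in \<open>auto intro: power_mono\<close>)
    also have "\<dots> = len G e * m\<^sup>2" using assms(3)[OF e] by (simp add: measure_restrict_space)
    finally show ?thesis .
  qed
  then have "L2_norm_on G S f \<le> sqrt (\<Sum>e\<in>S. len G e * m\<^sup>2)"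
    unfolding L2_norm_on_def by (intro real_sqrt_le_mono sum_mono)
  also have "\<dots> = sqrt (\<Sum>e\<in>S. len G e) * m"
    using assms(2) by (simp add: sum_distrib_right[symmetric] real_sqrt_mult)
  finally show ?thesis .
qed

lemma L2_norm_on_pos:
  assumes S: "finite S" "e \<in> S" and c: "continuous_on {0..len G e} (f e)" and L: "0 < len G e"
    and x: "x \<in> {0..len G e}" "f e x \<noteq> 0"
  shows "0 < L2_norm_on G S f"
proof -
  let ?h = "\<lambda>x. (cmod (f e x))\<^sup>2"
  have ch: "continuous_on {0..len G e} ?h" by (intro continuous_intros c)
  have "integrable (lebesgue_on {0..len G e}) ?h"
    using square_integrable_continuous[OF c] by (simp add: square_integrable_def)
  then have "integral\<^sup>L (lebesgue_on {0..len G e}) ?h = integral {0..len G e} ?h"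
    by (rule lebesgue_integral_eq_integral) auto
  moreover have "integral {0..len G e} ?h \<noteq> 0"
    using integral_eq_0_iff[OF ch L] x by auto
  ultimately have "0 < integral\<^sup>L (lebesgue_on {0..len G e}) ?h"
    by (metis integral_nonneg_AE AE_I2 zero_le_power2 order_le_less)
  then show ?thesis using L2_norm_on_edge_le[OF S, of G f] by (meson order_less_le_trans real_sqrt_gt_zero)
qed

text \<open>
  The Fredholm alternative.  The bound holds since a solution has the initial data that solve the
  linear system, and those are bounded by the right hand side of the system and so by \<open>k\<close>.
\<close>

theorem twisted_fredholm:
  fixes G :: "('v, 'e) metric_graph"
  assumes G: "quantum_graph G" and triv: "twisted_eigenspace G w z \<subseteq> {0}"
  shows "\<exists>C. \<forall>u u' k. (\<forall>e\<in>edges G. square_integrable (len G e) (k e)) \<longrightarrow> twisted_solution G w z u u' k \<longrightarrow>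
      L2_norm_on G (edges G) u \<le> C * L2_norm_on G (edges G) k" (is "\<exists>C. \<forall>u u' k. ?bound C u u' k")
    and "\<And>k. \<forall>e\<in>edges G. square_integrable (len G e) (k e) \<Longrightarrow>
      \<exists>u u'. supported G u \<and> twisted_solution G w z u u' k"
proof -
  let ?D = "darts G" and ?A = "boundary_defect G w z"
  have fin: "finite ?D" by (rule quantum_graph_finite_darts[OF G])
  have finE: "finite (edges G)" using G by (simp add: quantum_graph_def)
  have inj: "\<forall>d\<in>?D. x d = 0" if "\<forall>d\<in>?D. ?A x d = 0" for x
    using boundary_defect_injective[OF G triv that] .
  obtain K where K: "0 \<le> K"
    "\<And>y. \<exists>x. (\<forall>d\<in>?D. ?A x d = y d) \<and> (\<forall>d. cmod (x d) \<le> K * (\<Sum>k\<in>?D. cmod (y k)))"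
    by (rule square_system_solvable[of ?D ?A, OF fin boundary_defect_add boundary_defect_scale inj]) blast+
  show "\<exists>u u'. supported G u \<and> twisted_solution G w z u u' k"
    if k: "\<forall>e\<in>edges G. square_integrable (len G e) (k e)" for k
  proof -
    obtain x where x: "\<forall>d\<in>?D. ?A x d = - source_defect G w z k d"
      using K(2)[of "\<lambda>d. - source_defect G w z k d"] by blast
    define u where "u e t = (if e \<in> edges G \<and> t \<in> {0..len G e}
      then free_solution z x e t + duhamel z (k e) t else 0)" for e t
    have "twisted_solution G w z (\<lambda>e t. free_solution z x e t + duhamel z (k e) t)
        (\<lambda>e t. free_solution' z x e t + duhamel' z (k e) t) k"
      using x k by (subst twisted_solution_free_duhamel[OF G]) auto
    then have "twisted_solution G w z u (\<lambda>e t. free_solution' z x e t + duhamel' z (k e) t) k"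
      by (rule twisted_solution_cong[OF G]) (auto simp: u_def)
    moreover have "supported G u" by (auto simp: supported_def u_def)
    ultimately show ?thesis by blast
  qed
  have "\<exists>M\<ge>0. (\<forall>x\<in>{0..len G e}. cmod (fund_cos z x) \<le> M \<and> cmod (fund_sin z x) \<le> M) \<and>
      (\<forall>k x. square_integrable (len G e) k \<longrightarrow> x \<in> {0..len G e} \<longrightarrow>
        cmod (duhamel z k x) \<le> M * edge_L2 (len G e) k \<and> cmod (duhamel' z k x) \<le> M * edge_L2 (len G e) k)"
    (is "\<exists>M\<ge>0. ?P e M") if e: "e \<in> edges G" for e
    by (rule duhamel_bound[OF quantum_graph_len_pos[OF G e], of z]) blast
  then have "\<forall>e\<in>edges G. \<exists>M. 0 \<le> M \<and> ?P e M" by blast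
  from bchoice[OF this] obtain M where M: "\<And>e. e \<in> edges G \<Longrightarrow> 0 \<le> M e" "\<And>e. e \<in> edges G \<Longrightarrow> ?P e (M e)"
    by blast
  define m where "m = (\<Sum>e\<in>edges G. M e)"
  have m0: "0 \<le> m" unfolding m_def using M(1) by (rule sum_nonneg)
  have Mm: "M e \<le> m" if "e \<in> edges G" for e
    unfolding m_def using finE that M(1) by (intro member_le_sum) auto
  define W where "W = (\<Sum>d\<in>?D. cmod (w d))"
  have W0: "0 \<le> W" unfolding W_def by (rule sum_nonneg) auto
  define R where "R = K * (real (card ?D) * (2 * W * m))"
  have R0: "0 \<le> R" using K(1) W0 m0 by (simp add: R_def)
  define C where "C = m * R + m * R + m"
  have C0: "0 \<le> C" using m0 R0 by (simp add: C_def)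
  have "?bound (sqrt (\<Sum>e\<in>edges G. len G e) * C) u u' k" for u u' k
  proof (intro impI)
    assume k: "\<forall>e\<in>edges G. square_integrable (len G e) (k e)" and sol: "twisted_solution G w z u u' k"
    define n where "n = L2_norm_on G (edges G) k"
    have n0: "0 \<le> n" by (simp add: n_def L2_norm_on_nonneg)
    have dh: "cmod (duhamel z (k e) t) \<le> m * n" "cmod (duhamel' z (k e) t) \<le> m * n"
      if e: "e \<in> edges G" and t: "t \<in> {0..len G e}" for e t
    proof -
      have "M e * edge_L2 (len G e) (k e) \<le> m * n"
        unfolding n_def using Mm[OF e] m0 L2_norm_on_edge_le[OF finE e] by (intro mult_mono) auto
      moreover have "cmod (duhamel z (k e) t) \<le> M e * edge_L2 (len G e) (k e)"
        "cmod (duhamel' z (k e) t) \<le> M e * edge_L2 (len G e) (k e)"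
        using M(2)[OF e] k e t by blast+
      ultimately show "cmod (duhamel z (k e) t) \<le> m * n" "cmod (duhamel' z (k e) t) \<le> m * n" by linarith+
    qed
    have sd: "cmod (source_defect G w z k d) \<le> 2 * W * (m * n)" if d: "d \<in> ?D" for d
      unfolding source_defect_def W_def
    proof (rule vertex_defect_bound[OF G d])
      fix d' assume d': "d' \<in> ?D"
      then show "cmod (at_dart G (\<lambda>e. duhamel z (k e)) d') \<le> m * n"
        "cmod (at_dart G (\<lambda>e. duhamel' z (k e)) d') \<le> m * n"
        unfolding at_dart_def using dh[OF _ end_point_mem[OF G d']] by auto
    qed
    define x where "x = (\<lambda>(e, b). if b then u e 0 else u' e 0)"
    have eq: "u e t = free_solution z x e t + duhamel z (k e) t"
      "u' e t = free_solution' z x e t + duhamel' z (k e) t" if "e \<in> edges G" "t \<in> {0..len G e}" for e t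
      unfolding x_def using twisted_solution_eq_free_duhamel[OF sol _ that] k by auto
    have "twisted_solution G w z (\<lambda>e t. free_solution z x e t + duhamel z (k e) t)
        (\<lambda>e t. free_solution' z x e t + duhamel' z (k e) t) k"
      by (rule twisted_solution_cong[OF G sol]) (use eq in auto)
    then have Ax: "\<forall>d\<in>?D. ?A x d = - source_defect G w z k d"
      using k by (subst (asm) twisted_solution_free_duhamel[OF G]) (auto simp: eq_neg_iff_add_eq_0)
    obtain y where y: "\<forall>d\<in>?D. ?A y d = - source_defect G w z k d"
      "\<forall>d. cmod (y d) \<le> K * (\<Sum>d\<in>?D. cmod (- source_defect G w z k d))"
      using K(2)[of "\<lambda>d. - source_defect G w z k d"] by blast
    \<comment> \<open>the initial data \<open>x\<close> of \<open>u\<close> are the bounded solution \<open>y\<close>, by uniqueness\<close>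
    have "?A (\<lambda>d. x d + (-1) * y d) d = ?A x d + (-1) * ?A y d" for d
      unfolding boundary_defect_add boundary_defect_scale ..
    then have "\<forall>d\<in>?D. x d + (-1) * y d = 0" using Ax y(1) by - (rule inj, simp)
    then have xy: "x d = y d" if "d \<in> ?D" for d using that by auto
    have "(\<Sum>d\<in>?D. cmod (- source_defect G w z k d)) \<le> real (card ?D) * (2 * W * (m * n))"
      using sd by (intro sum_bounded_above) simp
    then have "K * (\<Sum>d\<in>?D. cmod (- source_defect G w z k d)) \<le> K * (real (card ?D) * (2 * W * (m * n)))"
      using K(1) by (rule mult_left_mono)
    also have "\<dots> = R * n" by (simp add: R_def)
    finally have xb: "cmod (x d) \<le> R * n" if "d \<in> ?D" for d
      using y(2) xy[OF that] by (metis order_trans)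
    have "cmod (u e t) \<le> C * n" if e: "e \<in> edges G" and t: "t \<in> {0..len G e}" for e t
    proof -
      have cs: "cmod (fund_cos z t) \<le> m" "cmod (fund_sin z t) \<le> m"
        using M(2)[OF e] t Mm[OF e] by (meson order_trans)+
      have "cmod (u e t) \<le> cmod (fund_cos z t) * cmod (x (e, True)) + cmod (fund_sin z t) * cmod (x (e, False))
          + cmod (duhamel z (k e) t)"
        unfolding eq(1)[OF e t] free_solution_def norm_mult[symmetric]
        by (intro order_trans[OF norm_triangle_ineq] add_right_mono norm_triangle_ineq)
      also have "\<dots> \<le> m * (R * n) + m * (R * n) + m * n"
        using e m0 by (intro add_mono mult_mono cs xb dh[OF e t]) auto
      also have "\<dots> = C * n" by (simp add: C_def algebra_simps)
      finally show ?thesis .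
    qed
    then have "L2_norm_on G (edges G) u \<le> sqrt (\<Sum>e\<in>edges G. len G e) * (C * n)"
      using C0 n0 quantum_graph_len_pos[OF G] by (intro L2_norm_on_le_sup) (auto intro: less_imp_le)
    then show "L2_norm_on G (edges G) u \<le> sqrt (\<Sum>e\<in>edges G. len G e) * C * L2_norm_on G (edges G) k"
      by (simp add: n_def mult_ac)
  qed
  then show "\<exists>C. \<forall>u u' k. ?bound C u u' k" by blast
qed

lemma edge_solution_derivs:
  assumes sol: "edge_solution L z u u' k" and x: "x \<in> {0..L}"
  shows "(u has_vector_derivative u' x) (at x within {0..L})"
    "continuous_on {0..L} k \<Longrightarrow> (u' has_vector_derivative - z * u x - k x) (at x within {0..L})"
proof -
  note c = edge_solution_continuous[OF sol]
  show "(u has_vector_derivative u' x) (at x within {0..L})"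
    by (rule primitive_deriv[OF c(2) _ x]) (use sol in \<open>auto simp: edge_solution_def\<close>)
  show "(u' has_vector_derivative - z * u x - k x) (at x within {0..L})" if "continuous_on {0..L} k"
    by (rule primitive_deriv[of L "\<lambda>x. - z * u x - k x", OF _ _ x])
      (use sol that c in \<open>auto simp: edge_solution_def intro!: continuous_intros\<close>)
qed

section \<open>Real eigenvalues and complex conjugation\<close>

text \<open>
  Green's formula: \<open>z \<integral> \<bar>u\<bar>\<^sup>2 - \<integral> \<bar>u'\<bar>\<^sup>2\<close> is a sum of boundary terms
  over the darts.  Because the weights have modulus \<open>1\<close>, they can be inserted into these terms, and then the
  terms at each vertex cancel.
\<close>

theorem twisted_eigenvalue_real:
  fixes G :: "('v, 'e) metric_graph"
  assumes G: "quantum_graph G" and w: "\<And>d. d \<in> darts G \<Longrightarrow> cmod (w d) = 1"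
    and u: "u \<in> twisted_eigenspace G w z" "u \<noteq> 0"
  shows "z \<in> \<real>"
proof -
  obtain u' where sol: "twisted_solution G w z u u' 0" and supp: "supported G u"
    using u(1) by (auto simp: twisted_eigenspace_def)
  have es: "edge_solution (len G e) z (u e) (u' e) (0 e)" if "e \<in> edges G" for e
    using sol that by (simp add: twisted_solution_def)
  have finE: "finite (edges G)" using G by (simp add: quantum_graph_def)
  define I where "I e = integral {0..len G e} (\<lambda>x. (cmod (u e x))\<^sup>2)" for e
  define J where "J e = integral {0..len G e} (\<lambda>x. (cmod (u' e x))\<^sup>2)" for e
  \<comment> \<open>the fundamental theorem of calculus for \<open>u'\<close> times the conjugate of \<open>u\<close>\<close>
  have green: "u' e (len G e) * cnj (u e (len G e)) - u' e 0 * cnj (u e 0) = - z * of_real (I e) + of_real (J e)"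
    if e: "e \<in> edges G" for e
  proof -
    note c = edge_solution_continuous[OF es[OF e]]
    have "((\<lambda>x. - z * of_real ((cmod (u e x))\<^sup>2) + of_real ((cmod (u' e x))\<^sup>2)) has_integral
        u' e (len G e) * cnj (u e (len G e)) - u' e 0 * cnj (u e 0)) {0..len G e}"
    proof (rule fundamental_theorem_of_calculus)
      fix x assume x: "x \<in> {0..len G e}"
      have "((\<lambda>x. u' e x * cnj (u e x)) has_vector_derivative
          u' e x * cnj (u' e x) + (- z * u e x - 0) * cnj (u e x)) (at x within {0..len G e})"
        using edge_solution_derivs[OF es[OF e] x]
        by (intro has_vector_derivative_mult has_vector_derivative_cnj) auto
      then show "((\<lambda>x. u' e x * cnj (u e x)) has_vector_derivative
          - z * of_real ((cmod (u e x))\<^sup>2) + of_real ((cmod (u' e x))\<^sup>2)) (at x within {0..len G e})"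
        by (simp only: complex_norm_square) (simp add: algebra_simps)
    qed (use quantum_graph_len_pos[OF G e] in auto)
    moreover have "((\<lambda>x. - z * of_real ((cmod (u e x))\<^sup>2) + of_real ((cmod (u' e x))\<^sup>2)) has_integral
        - z * of_real (I e) + of_real (J e)) {0..len G e}"
      unfolding I_def J_def
      by (intro has_integral_add has_integral_mult_right has_integral_of_real integrable_integral
          integrable_continuous_real continuous_intros c)
    ultimately show ?thesis by (rule has_integral_unique)
  qed
  have "(\<Sum>d\<in>darts_at G v. of_real (normal_sign d) * (at_dart G u' d * cnj (at_dart G u d))) = 0"
    if v: "v \<in> verts G" for v
  proof -
    obtain c where c: "\<And>d. d \<in> darts_at G v \<Longrightarrow> w d * at_dart G u d = c"
      using sol v by (auto simp: twisted_solution_def vertex_conditions_def)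
    have k: "(\<Sum>d\<in>darts_at G v. of_real (normal_sign d) * (w d * at_dart G u' d)) = 0"
      using sol v by (auto simp: twisted_solution_def vertex_conditions_def)
    have "of_real (normal_sign d) * (at_dart G u' d * cnj (at_dart G u d))
        = of_real (normal_sign d) * (w d * at_dart G u' d) * cnj c" if d: "d \<in> darts_at G v" for d
    proof -
      have "w d * cnj (w d) = 1"
        using w[of d] d complex_norm_square[of "w d"] by (simp add: darts_at_eq)
      then have "of_real (normal_sign d) * (at_dart G u' d * cnj (at_dart G u d))
          = of_real (normal_sign d) * (at_dart G u' d * cnj (at_dart G u d)) * (w d * cnj (w d))"
        by simp
      then show ?thesis unfolding c[OF d, symmetric] complex_cnj_mult by (simp only: mult_ac)
    qed
    then have "(\<Sum>d\<in>darts_at G v. of_real (normal_sign d) * (at_dart G u' d * cnj (at_dart G u d)))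
        = (\<Sum>d\<in>darts_at G v. of_real (normal_sign d) * (w d * at_dart G u' d)) * cnj c"
      unfolding sum_distrib_right by (rule sum.cong[OF HOL.refl])
    then show ?thesis using k by simp
  qed
  then have "0 = (\<Sum>v\<in>verts G. \<Sum>d\<in>darts_at G v. of_real (normal_sign d) * (at_dart G u' d * cnj (at_dart G u d)))"
    by simp
  also have "\<dots> = (\<Sum>d\<in>darts G. of_real (normal_sign d) * (at_dart G u' d * cnj (at_dart G u d)))"
    by (rule sum_darts_at[OF G])
  also have "\<dots> = (\<Sum>e\<in>edges G. \<Sum>b\<in>UNIV. of_real (normal_sign (e, b)) * (at_dart G u' (e, b) * cnj (at_dart G u (e, b))))"
    by (simp add: sum.cartesian_product)
  also have "\<dots> = (\<Sum>e\<in>edges G. - z * of_real (I e) + of_real (J e))"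
    by (intro sum.cong HOL.refl) (use green in \<open>simp add: UNIV_bool at_dart_def end_point_def normal_sign_def\<close>)
  also have "\<dots> = - z * of_real (\<Sum>e\<in>edges G. I e) + of_real (\<Sum>e\<in>edges G. J e)"
    by (simp add: sum.distrib sum_negf sum_subtractf sum_distrib_left)
  finally have zI: "z * of_real (\<Sum>e\<in>edges G. I e) = of_real (\<Sum>e\<in>edges G. J e)" by (simp add: algebra_simps)
  have "(\<Sum>e\<in>edges G. I e) \<noteq> 0"
  proof
    assume "(\<Sum>e\<in>edges G. I e) = 0"
    moreover have "0 \<le> I e" for e
      unfolding I_def
      by (cases "(\<lambda>x. (cmod (u e x))\<^sup>2) integrable_on {0..len G e}")
        (simp_all add: Henstock_Kurzweil_Integration.integral_nonneg not_integrable_integral)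
    ultimately have I0: "\<forall>e\<in>edges G. I e = 0" using sum_nonneg_eq_0_iff[OF finE, of I] by simp
    have "u e x = 0" for e x
    proof (cases "e \<in> edges G \<and> x \<in> {0..len G e}")
      case True
      then have "continuous_on {0..len G e} (\<lambda>x. (cmod (u e x))\<^sup>2)"
        using edge_solution_continuous[OF es[of e]] by (auto intro!: continuous_intros)
      from integral_eq_0_iff[OF this quantum_graph_len_pos[OF G]] show ?thesis
        using I0 True by (auto simp: I_def)
    qed (use supp in \<open>auto simp: supported_def\<close>)
    then have "u = 0" by (simp add: fun_eq_iff)
    then show False using u(2) by simp
  qed
  then have "z = of_real ((\<Sum>e\<in>edges G. J e) / (\<Sum>e\<in>edges G. I e))"
    using zI unfolding of_real_divide by (metis nonzero_mult_div_cancel_right of_real_eq_0_iff)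
  then show ?thesis by (metis Reals_of_real)
qed

lemma edge_solution_cnj:
  assumes "edge_solution L z u u' k"
  shows "edge_solution L (cnj z) (\<lambda>x. cnj (u x)) (\<lambda>x. cnj (u' x)) (\<lambda>x. cnj (k x))"
  unfolding edge_solution_def
proof (intro ballI conjI)
  fix x assume x: "x \<in> {0..L}"
  have "(cnj \<circ> u' has_integral cnj (u x - u 0)) {0..x}"
    "(cnj \<circ> (\<lambda>t. - z * u t - k t) has_integral cnj (u' x - u' 0)) {0..x}"
    unfolding has_integral_cnj using assms x by (auto simp: edge_solution_def)
  then show "((\<lambda>x. cnj (u' x)) has_integral cnj (u x) - cnj (u 0)) {0..x}"
    "((\<lambda>t. - cnj z * cnj (u t) - cnj (k t)) has_integral cnj (u' x) - cnj (u' 0)) {0..x}"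
    by (simp_all add: o_def)
qed

lemma twisted_eigenspace_cnj:
  fixes G :: "('v, 'e) metric_graph"
  assumes "u \<in> twisted_eigenspace G w z"
  shows "(\<lambda>e x. cnj (u e x)) \<in> twisted_eigenspace G (\<lambda>d. cnj (w d)) (cnj z)"
proof -
  obtain u' where sol: "twisted_solution G w z u u' 0" and supp: "supported G u"
    using assms by (auto simp: twisted_eigenspace_def)
  have "twisted_solution G (\<lambda>d. cnj (w d)) (cnj z) (\<lambda>e x. cnj (u e x)) (\<lambda>e x. cnj (u' e x)) 0"
    unfolding twisted_solution_def
  proof
    show "\<forall>e\<in>edges G. edge_solution (len G e) (cnj z) (\<lambda>x. cnj (u e x)) (\<lambda>x. cnj (u' e x)) (0 e)"
    proof
      fix e assume "e \<in> edges G"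
      then have "edge_solution (len G e) z (u e) (u' e) (0 e)" using sol by (simp add: twisted_solution_def)
      from edge_solution_cnj[OF this]
      show "edge_solution (len G e) (cnj z) (\<lambda>x. cnj (u e x)) (\<lambda>x. cnj (u' e x)) (0 e)"
        by (simp add: zero_fun_def)
    qed
    show "vertex_conditions G (\<lambda>d. cnj (w d)) (at_dart G (\<lambda>e x. cnj (u e x))) (at_dart G (\<lambda>e x. cnj (u' e x)))"
      unfolding vertex_conditions_def
    proof (intro ballI conjI)
      fix v assume v: "v \<in> verts G"
      obtain c where "\<forall>d\<in>darts_at G v. w d * at_dart G u d = c"
        using sol v unfolding twisted_solution_def vertex_conditions_def by blast
      then show "\<exists>c. \<forall>d\<in>darts_at G v. cnj (w d) * at_dart G (\<lambda>e x. cnj (u e x)) d = c"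
        by (intro exI[of _ "cnj c"]) (auto simp: at_dart_def)
      have "cnj (\<Sum>d\<in>darts_at G v. of_real (normal_sign d) * (w d * at_dart G u' d)) = 0"
        using sol v by (auto simp: twisted_solution_def vertex_conditions_def)
      then show "(\<Sum>d\<in>darts_at G v. of_real (normal_sign d) * (cnj (w d) * at_dart G (\<lambda>e x. cnj (u' e x)) d)) = 0"
        by (simp add: at_dart_def)
    qed
  qed
  then show ?thesis using supp by (auto simp: twisted_eigenspace_def supported_def)
qed

text \<open>
  Conjugation of functions also conjugates \<open>z\<close>, but nonzero eigenspaces occur for real \<open>z\<close> only.
\<close>

theorem twisted_eigenspace_cnj_weights:
  fixes G :: "('v, 'e) metric_graph"
  assumes G: "quantum_graph G" and w: "\<And>d. d \<in> darts G \<Longrightarrow> cmod (w d) = 1"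
  shows "twisted_eigenspace G (\<lambda>d. cnj (w d)) z \<subseteq> {0} \<longleftrightarrow> twisted_eigenspace G w z \<subseteq> {0}"
    and "\<not> twisted_eigenspace G w z \<subseteq> {0} \<Longrightarrow>
      vector_space.dim cscale (twisted_eigenspace G (\<lambda>d. cnj (w d)) z) =
      vector_space.dim cscale (twisted_eigenspace G w z)"
proof -
  let ?c = "\<lambda>(u :: 'e \<Rightarrow> real \<Rightarrow> complex) e x. cnj (u e x)"
  have real: "cnj z = z" if "\<not> twisted_eigenspace G w' z \<subseteq> {0}" "\<And>d. d \<in> darts G \<Longrightarrow> cmod (w' d) = 1" for w'
  proof -
    obtain u where "u \<in> twisted_eigenspace G w' z" "u \<noteq> 0" using \<open>\<not> _\<close> by blast
    then have "z \<in> \<real>" using twisted_eigenvalue_real[of G w' u z] G \<open>\<And>d. d \<in> darts G \<Longrightarrow> cmod (w' d) = 1\<close> by blast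
    then show ?thesis by (simp add: Reals_cnj_iff)
  qed
  have img: "twisted_eigenspace G (\<lambda>d. cnj (w d)) z = ?c ` twisted_eigenspace G w z" if "cnj z = z"
  proof
    show "?c ` twisted_eigenspace G w z \<subseteq> twisted_eigenspace G (\<lambda>d. cnj (w d)) z"
      using twisted_eigenspace_cnj[of _ G w z] that by auto
    show "twisted_eigenspace G (\<lambda>d. cnj (w d)) z \<subseteq> ?c ` twisted_eigenspace G w z"
    proof
      fix u assume "u \<in> twisted_eigenspace G (\<lambda>d. cnj (w d)) z"
      from twisted_eigenspace_cnj[OF this] have "?c u \<in> twisted_eigenspace G w z" using that by simp
      then show "u \<in> ?c ` twisted_eigenspace G w z" by (intro image_eqI[of _ _ "?c u"]) simp_all
    qed
  qed
  have c0: "?c u = 0 \<longleftrightarrow> u = 0" for u by (simp add: fun_eq_iff)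
  show triv: "twisted_eigenspace G (\<lambda>d. cnj (w d)) z \<subseteq> {0} \<longleftrightarrow> twisted_eigenspace G w z \<subseteq> {0}"
  proof (cases "cnj z = z")
    case True
    then show ?thesis unfolding img[OF True] image_subset_iff using c0 by blast
  next
    case False
    then show ?thesis using real[of w] real[of "\<lambda>d. cnj (w d)"] w by auto
  qed
  assume "\<not> twisted_eigenspace G w z \<subseteq> {0}"
  then have "cnj z = z" using real[of w] w by auto
  from img[OF this] have eq: "twisted_eigenspace G (\<lambda>d. cnj (w d)) z = ?c ` twisted_eigenspace G w z" .
  show "vector_space.dim cscale (twisted_eigenspace G (\<lambda>d. cnj (w d)) z) =
      vector_space.dim cscale (twisted_eigenspace G w z)"
    unfolding eq
  proof (rule dim_semilinear_image[where \<sigma> = cnj])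
    show "surj cnj" by (metis complex_cnj_cnj surj_def)
    show "inj_on ?c X" for X
      by (rule inj_onI) (metis (no_types, opaque_lifting) complex_cnj_cnj ext)
  qed (auto simp: cscale_def fun_eq_iff)
qed

section \<open>Spectra from twisted eigenspaces\<close>

lemma twisted_solution_shift:
  "twisted_solution G w z u u' (k - cscale z u) \<longleftrightarrow> twisted_solution G w 0 u u' k"
  by (simp add: twisted_solution_def edge_solution_def cscale_def)

text \<open>
  A right hand side of norm \<open>0\<close> does not contribute to the variation of constants formula.
\<close>

lemma twisted_solution_null_source:
  assumes G: "quantum_graph G" and k: "\<And>e. e \<in> edges G \<Longrightarrow> square_integrable (len G e) (k e)"
    and null: "L2_norm_on G (edges G) k = 0" and sol: "twisted_solution G w z u u' k"
  shows "twisted_solution G w z u u' 0"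
proof -
  have finE: "finite (edges G)" using G by (simp add: quantum_graph_def)
  have dh: "duhamel z (k e) t = 0 \<and> duhamel' z (k e) t = 0" if e: "e \<in> edges G" and t: "t \<in> {0..len G e}" for e t
  proof -
    have n: "edge_L2 (len G e) (k e) = 0"
      using L2_norm_on_edge_le[OF finE e, of G k] null by (intro order_antisym) auto
    obtain M where "cmod (duhamel z (k e) t) \<le> M * edge_L2 (len G e) (k e) \<and>
        cmod (duhamel' z (k e) t) \<le> M * edge_L2 (len G e) (k e)"
      using duhamel_bound[OF quantum_graph_len_pos[OF G e], of z] k[OF e] t by metis
    then show ?thesis unfolding n by simp
  qed
  define x where "x = (\<lambda>(e, b). if b then u e 0 else u' e 0)"
  have eq: "u e t = free_solution z x e t" "u' e t = free_solution' z x e t"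
    if "e \<in> edges G" "t \<in> {0..len G e}" for e t
    unfolding x_def using twisted_solution_eq_free_duhamel[OF sol k that] dh[OF that] by auto
  have "edge_solution (len G e) z (u e) (u' e) (0 e)" if e: "e \<in> edges G" for e
    by (rule edge_solution_cong[OF edge_solution_homogeneous[of "len G e" z "x (e, True)" "x (e, False)"]])
      (use eq[OF e] in \<open>auto simp: free_solution_def free_solution'_def\<close>)
  then show ?thesis using sol by (simp add: twisted_solution_def)
qed

text \<open>
  The common core of the two spectral computations.  The gauge transformation \<open>\<Gamma>\<close> carries the operator
  with graph \<open>T\<close> to \<open>-u''\<close> with twisted vertex conditions, and \<open>backward\<close> says that a
  solution for a right hand side coming from \<open>X\<close> is regular enough to come from the domain of the operator.
  Injectivity is required on a space \<open>Y\<close> that contains the domain because \<open>\<Gamma>\<close> may see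
  only part of the values of a function, such as those over a fundamental domain.
\<close>

theorem spectrum_mult_gauge:
  fixes G :: "('v, 'e) metric_graph" and \<Gamma> :: "('a \<Rightarrow> real \<Rightarrow> complex) \<Rightarrow> ('e \<Rightarrow> real \<Rightarrow> complex)"
  assumes G: "quantum_graph G"
    and add: "\<And>f g. \<Gamma> (f + g) = \<Gamma> f + \<Gamma> g"
    and scale: "\<And>c f. \<Gamma> (cscale c f) = cscale c (\<Gamma> f)"
    and norm: "\<And>f. N f = L2_norm_on G (edges G) (\<Gamma> f)"
    and Y: "edge_functions.subspace Y" "inj_on \<Gamma> Y"
    and forward: "\<And>f g. (f, g) \<in> T \<Longrightarrow> f \<in> Y \<and> supported G (\<Gamma> f) \<and>
      (\<forall>e\<in>edges G. square_integrable (len G e) (\<Gamma> g e)) \<and> (\<exists>u'. twisted_solution G w 0 (\<Gamma> f) u' (\<Gamma> g))"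
    and X: "0 \<in> X" "\<And>h e. h \<in> X \<Longrightarrow> e \<in> edges G \<Longrightarrow> square_integrable (len G e) (\<Gamma> h e)"
    and backward: "\<And>z h u u'. h \<in> X \<Longrightarrow> supported G u \<Longrightarrow> twisted_solution G w z u u' (\<Gamma> h) \<Longrightarrow>
      \<exists>(f, g)\<in>T. \<Gamma> f = u \<and> \<Gamma> g = cscale z u + \<Gamma> h"
  shows "spectrum_mult N X T = {(z, m). \<not> twisted_eigenspace G w z \<subseteq> {0} \<and>
    m = vector_space.dim cscale (twisted_eigenspace G w z)}"
proof -
  have finE: "finite (edges G)" using G by (simp add: quantum_graph_def)
  have zero: "\<Gamma> 0 = 0" using add[of 0 0] by simp
  have minus: "\<Gamma> (f - g) = \<Gamma> f - \<Gamma> g" for f g using add[of "f - g" g] by (simp add: algebra_simps)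
  have null: "L2_norm_on G (edges G) (0 :: 'e \<Rightarrow> real \<Rightarrow> complex) = 0" by (simp add: L2_norm_on_def)
  have fwd: "\<exists>u'. twisted_solution G w z (\<Gamma> f) u' (\<Gamma> (g - cscale z f))" if "(f, g) \<in> T" for f g z
    using forward[OF that] by (simp add: minus scale twisted_solution_shift)
  have sq: "square_integrable (len G e) (\<Gamma> (g - cscale z f) e)" if T: "(f, g) \<in> T" and e: "e \<in> edges G" for f g z e
  proof -
    obtain u' where "edge_solution (len G e) 0 (\<Gamma> f e) (u' e) (\<Gamma> g e)"
      using forward[OF T] e by (auto simp: twisted_solution_def)
    then have "square_integrable (len G e) (\<lambda>x. - z * \<Gamma> f e x)"
      by (intro square_integrable_continuous continuous_intros edge_solution_continuous(1))
    then have "square_integrable (len G e) (\<lambda>x. \<Gamma> g e x + - z * \<Gamma> f e x)"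
      using forward[OF T] e by (intro square_integrable_add) auto
    then show ?thesis unfolding minus scale by (rule square_integrable_cong) (simp add: cscale_def)
  qed
  have eigen: "\<Gamma> ` eigenspace N T z = twisted_eigenspace G w z" for z
  proof
    show "\<Gamma> ` eigenspace N T z \<subseteq> twisted_eigenspace G w z"
    proof
      fix u assume "u \<in> \<Gamma> ` eigenspace N T z"
      then obtain f g where fg: "u = \<Gamma> f" "(f, g) \<in> T" "N (g - cscale z f) = 0" by (auto simp: eigenspace_def)
      obtain u' where "twisted_solution G w z (\<Gamma> f) u' (\<Gamma> (g - cscale z f))" using fwd[OF fg(2)] by blast
      then have "twisted_solution G w z u u' 0"
        unfolding fg(1) using sq[OF fg(2)] fg(3) unfolding norm
        by (intro twisted_solution_null_source[OF G, of "\<Gamma> (g - cscale z f)"]) auto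
      then show "u \<in> twisted_eigenspace G w z" using forward[OF fg(2)] fg(1) by (auto simp: twisted_eigenspace_def)
    qed
    show "twisted_eigenspace G w z \<subseteq> \<Gamma> ` eigenspace N T z"
    proof
      fix u assume "u \<in> twisted_eigenspace G w z"
      then obtain u' where "supported G u" "twisted_solution G w z u u' (\<Gamma> 0)"
        by (auto simp: twisted_eigenspace_def zero)
      from backward[OF X(1) this] obtain f g where fg: "(f, g) \<in> T" "\<Gamma> f = u" "\<Gamma> g = cscale z u"
        by (auto simp: zero)
      then have "N (g - cscale z f) = 0" unfolding norm minus scale by (simp add: null del: zero_fun_apply)
      then show "u \<in> \<Gamma> ` eigenspace N T z" using fg by (auto simp: eigenspace_def)
    qed
  qed
  have dim: "vector_space.dim cscale (eigenspace N T z) = vector_space.dim cscale (twisted_eigenspace G w z)" for z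
  proof -
    have "eigenspace N T z \<subseteq> Y" using forward by (auto simp: eigenspace_def)
    then have "edge_functions.span (eigenspace N T z) \<subseteq> Y" by (rule edge_functions.span_minimal[OF _ Y(1)])
    then have "inj_on \<Gamma> (edge_functions.span (eigenspace N T z))" by (rule inj_on_subset[OF Y(2)])
    then have "vector_space.dim cscale (\<Gamma> ` eigenspace N T z) = vector_space.dim cscale (eigenspace N T z)"
      by (intro dim_semilinear_image[where \<sigma> = "\<lambda>c. c"] add scale) auto
    then show ?thesis by (simp add: eigen)
  qed
  have res: "z \<in> resolvent_set N X T \<longleftrightarrow> twisted_eigenspace G w z \<subseteq> {0}" for z
  proof
    assume triv: "twisted_eigenspace G w z \<subseteq> {0}"
    obtain C where C: "\<And>u u' k. \<forall>e\<in>edges G. square_integrable (len G e) (k e) \<Longrightarrow> twisted_solution G w z u u' k \<Longrightarrow>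
      L2_norm_on G (edges G) u \<le> C * L2_norm_on G (edges G) k"
      using twisted_fredholm(1)[OF G triv] by blast
    have "N f \<le> C * N (g - cscale z f)" if "(f, g) \<in> T" for f g
      unfolding norm using fwd[OF that, of z] sq[OF that, of _ z] C by blast
    moreover have "\<exists>(f, g)\<in>T. N (g - cscale z f - h) < \<epsilon>" if h: "h \<in> X" and \<epsilon>: "0 < \<epsilon>" for h \<epsilon>
    proof -
      obtain u u' where "supported G u" "twisted_solution G w z u u' (\<Gamma> h)"
        using twisted_fredholm(2)[OF G triv, of "\<Gamma> h"] X(2)[OF h] by blast
      from backward[OF h this] obtain f g where fg: "(f, g) \<in> T" "\<Gamma> f = u" "\<Gamma> g = cscale z u + \<Gamma> h" by auto
      then have "N (g - cscale z f - h) = 0" unfolding norm minus scale by (simp add: null del: zero_fun_apply)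
      then show ?thesis using fg(1) \<epsilon> by (intro bexI[of _ "(f, g)"]) auto
    qed
    ultimately show "z \<in> resolvent_set N X T" unfolding resolvent_set_def by blast
  next
    assume "z \<in> resolvent_set N X T"
    then obtain C where "\<forall>(f, g)\<in>T. N f \<le> C * N (g - cscale z f)"
      unfolding resolvent_set_def by blast
    then have C: "N f \<le> C * N (g - cscale z f)" if "(f, g) \<in> T" for f g using that by fast
    show "twisted_eigenspace G w z \<subseteq> {0}"
    proof (rule ccontr)
      assume "\<not> twisted_eigenspace G w z \<subseteq> {0}"
      then obtain u where u: "u \<in> twisted_eigenspace G w z" "u \<noteq> 0" by blast
      then obtain f g where fg: "u = \<Gamma> f" "(f, g) \<in> T" "N (g - cscale z f) = 0"
        using eigen[of z] unfolding eigenspace_def by blast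
      obtain u' where sol: "twisted_solution G w z u u' 0" and supp: "supported G u"
        using u(1) by (auto simp: twisted_eigenspace_def)
      obtain e x where ex: "u e x \<noteq> 0" using u(2) by (auto simp: fun_eq_iff)
      then have e: "e \<in> edges G" "x \<in> {0..len G e}" using supp by (auto simp: supported_def)
      then have "continuous_on {0..len G e} (u e)"
        using sol edge_solution_continuous(1) unfolding twisted_solution_def by blast
      then have "0 < N f" unfolding norm fg(1)[symmetric]
        by (intro L2_norm_on_pos[of _ e _ u x] finE e quantum_graph_len_pos[OF G] ex)
      then show False using C[OF fg(2)] fg(3) by simp
    qed
  qed
  show ?thesis unfolding spectrum_mult_def res dim by simp
qed

section \<open>The Bloch operator\<close>

text \<open>
  The gauge factors: \<open>s = 1\<close> transforms the Bloch operator to \<open>-u''\<close>, and \<open>s = -1\<close> transforms back.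
\<close>

definition phase :: "real \<Rightarrow> (real \<Rightarrow> real) \<Rightarrow> real \<Rightarrow> complex" where
  "phase s a x = exp (2 * complex_of_real pi * \<i> * of_real (s * integral {0..x} a))"

definition potential :: "(real \<Rightarrow> real) \<Rightarrow> real \<Rightarrow> complex" where
  "potential a x = 2 * complex_of_real pi * \<i> * complex_of_real (a x)"

lemma phase_at_0 [simp]: "phase s a 0 = 1"
  by (simp add: phase_def)

lemma norm_phase [simp]: "cmod (phase s a x) = 1"
  by (simp add: phase_def norm_exp_eq_Re)

lemma phase_mult_phase [simp]: "phase (-1) a x * phase 1 a x = 1" "phase 1 a x * phase (-1) a x = 1"
  by (auto simp: phase_def exp_add[symmetric])

lemma phase_mult_phase' [simp]:
  "phase (-1) a x * (phase 1 a x * y) = y" "phase 1 a x * (phase (-1) a x * y) = y"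
  by (simp_all flip: mult.assoc)

lemma phase_deriv:
  assumes "continuous_on {0..L} a" "x \<in> {0..L}"
  shows "(phase s a has_vector_derivative of_real s * potential a x * phase s a x) (at x within {0..L})"
proof -
  have "((\<lambda>x. integral {0..x} a) has_real_derivative a x) (at x within {0..L})"
    unfolding has_real_derivative_iff_has_vector_derivative
    by (rule integral_has_vector_derivative[OF assms])
  then have "((\<lambda>x. 2 * complex_of_real pi * \<i> * of_real (s * integral {0..x} a)) has_vector_derivative
      2 * complex_of_real pi * \<i> * of_real (s * a x)) (at x within {0..L})"
    by (intro has_vector_derivative_mult_right has_vector_derivative_of_real DERIV_cmult)
  moreover have "(exp has_field_derivative phase s a x)
      (at (2 * complex_of_real pi * \<i> * of_real (s * integral {0..x} a)) within
        (\<lambda>x. 2 * complex_of_real pi * \<i> * of_real (s * integral {0..x} a)) ` {0..L})"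
    unfolding phase_def by (rule has_field_derivative_at_within[OF DERIV_exp])
  ultimately have "(exp \<circ> (\<lambda>x. 2 * complex_of_real pi * \<i> * of_real (s * integral {0..x} a))
      has_vector_derivative 2 * complex_of_real pi * \<i> * of_real (s * a x) * phase s a x) (at x within {0..L})"
    by (rule field_vector_diff_chain_within)
  then show ?thesis by (simp add: phase_def[abs_def] potential_def o_def mult_ac)
qed

lemma phase_continuous:
  assumes "continuous_on {0..L} a"
  shows "continuous_on {0..L} (phase s a)"
  by (rule continuous_on_vector_derivative[OF phase_deriv[OF assms]])

lemma potential_continuous:
  assumes "continuous_on {0..L} a"
  shows "continuous_on {0..L} (potential a)"
  unfolding potential_def by (intro continuous_intros assms)

lemma smooth_on_edge_continuous:
  assumes "smooth_on_edge L f"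
  shows "continuous_on {0..L} f"
proof -
  obtain D where D: "\<And>x. x \<in> {0..L} \<Longrightarrow> D 0 x = f x"
    "\<And>n x. x \<in> {0..L} \<Longrightarrow> (D n has_vector_derivative D (Suc n) x) (at x within {0..L})"
    using assms unfolding smooth_on_edge_def by blast
  have "continuous_on {0..L} (D 0)" using D(2) by (meson continuous_on_vector_derivative)
  then show ?thesis by (rule continuous_on_eq) (rule D(1))
qed

lemma edge_deriv_eq:
  fixes f :: "real \<Rightarrow> 'a::euclidean_space"
  assumes "0 < L" "x \<in> {0..L}" "(f has_vector_derivative f') (at x within {0..L})"
  shows "edge_deriv L f x = f'"
  unfolding edge_deriv_def using vector_derivative_within_closed_interval[of 0 L x f f'] assms by simp

lemma has_weak_derivD:
  assumes "has_weak_deriv L u w"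
  shows "w absolutely_integrable_on {0..L}" "square_integrable L w"
    "\<And>x. x \<in> {0..L} \<Longrightarrow> (w has_integral (u x - u 0)) {0..x}" "continuous_on {0..L} u"
  using assms primitive_continuous[of L w u]
  by (auto simp: has_weak_deriv_def intro: square_integrable_imp_absolutely_integrable)

lemma weak_deriv_product:
  assumes u: "has_weak_deriv L u w"
    and c: "\<And>x. x \<in> {0..L} \<Longrightarrow> (c has_vector_derivative c' x) (at x within {0..L})" "continuous_on {0..L} c'"
  shows "has_weak_deriv L (\<lambda>x. c x * u x) (\<lambda>x. c x * w x + c' x * u x)"
  unfolding has_weak_deriv_def
proof (intro conjI ballI)
  have cc: "continuous_on {0..L} c" using c by (meson continuous_on_vector_derivative)
  show "square_integrable L (\<lambda>x. c x * w x + c' x * u x)"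
    by (intro square_integrable_add square_integrable_continuous_mult square_integrable_continuous
        continuous_intros cc c has_weak_derivD[OF u])
  show "((\<lambda>x. c x * w x + c' x * u x) has_integral c x * u x - c 0 * u 0) {0..x}" if "x \<in> {0..L}" for x
    by (rule primitive_product_rule[OF has_weak_derivD(1)[OF u] has_weak_derivD(3)[OF u] c that])
qed

lemma weak_deriv_diff:
  assumes "has_weak_deriv L u w" "has_weak_deriv L v w'"
  shows "has_weak_deriv L (\<lambda>x. u x - v x) (\<lambda>x. w x - w' x)"
  unfolding has_weak_deriv_def
proof (intro conjI ballI)
  have "square_integrable L (\<lambda>x. w x + (-1) * w' x)"
    using assms by (intro square_integrable_add square_integrable_continuous_mult continuous_intros has_weak_derivD)
  then show "square_integrable L (\<lambda>x. w x - w' x)" by simp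
  show "((\<lambda>x. w x - w' x) has_integral u x - v x - (u 0 - v 0)) {0..x}" if "x \<in> {0..L}" for x
    using has_integral_diff[OF has_weak_derivD(3)[OF assms(1) that] has_weak_derivD(3)[OF assms(2) that]]
    by (simp add: algebra_simps)
qed

lemma weak_deriv_cong:
  assumes "has_weak_deriv L u w" "\<And>x. x \<in> {0..L} \<Longrightarrow> u x = v x" "\<And>x. x \<in> {0..L} \<Longrightarrow> w x = w' x"
  shows "has_weak_deriv L v w'"
  unfolding has_weak_deriv_def
proof (intro conjI ballI)
  show "square_integrable L w'" by (rule square_integrable_cong[OF has_weak_derivD(2)[OF assms(1)] assms(3)])
  fix x assume x: "x \<in> {0..L}"
  have "(w has_integral v x - v 0) {0..x}" using has_weak_derivD(3)[OF assms(1) x] x assms(2) by simp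
  then show "(w' has_integral v x - v 0) {0..x}" by (rule has_integral_eq[rotated]) (use x assms(3) in auto)
qed

lemma edge_solution_weak_derivs:
  assumes "edge_solution L z u v k" "square_integrable L k"
  shows "has_weak_deriv L u v" "has_weak_deriv L v (\<lambda>x. - z * u x - k x)"
proof -
  note c = edge_solution_continuous[OF assms(1)]
  have "square_integrable L (\<lambda>x. - z * u x + (-1) * k x)"
    by (intro square_integrable_add square_integrable_continuous_mult[of _ "\<lambda>_. -1"] square_integrable_continuous
        continuous_intros c assms(2))
  then show "has_weak_deriv L v (\<lambda>x. - z * u x - k x)"
    using assms(1) by (simp add: has_weak_deriv_def edge_solution_def)
  show "has_weak_deriv L u v"
    using assms(1) square_integrable_continuous[OF c(2)] by (simp add: has_weak_deriv_def edge_solution_def)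
qed

text \<open>
  For \<open>u = exp (\<i> \<theta>) f\<close> with \<open>\<theta>' = 2 \<pi> a\<close>, the derivative \<open>u'\<close> is \<open>exp (\<i> \<theta>) (f' + 2 \<pi> \<i> a f)\<close>.
\<close>

lemma bloch_edge_forward:
  assumes L: "0 < L" and a: "continuous_on {0..L} a" and f: "sobolev2 L f" and h: "has_weak_deriv L h h'"
    and eqs: "\<And>x. x \<in> {0..L} \<Longrightarrow> h x = edge_deriv L f x + potential a x * f x"
    "\<And>x. x \<in> {0..L} \<Longrightarrow> g x = - (h' x + potential a x * h x)"
  shows "edge_solution L 0 (\<lambda>x. phase 1 a x * f x) (\<lambda>x. phase 1 a x * h x) (\<lambda>x. phase 1 a x * g x)"
proof -
  obtain f' f'' where f': "has_weak_deriv L f f'" "has_weak_deriv L f' f''"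
    using f by (auto simp: sobolev2_def)
  have ed: "edge_deriv L f x = f' x" if "x \<in> {0..L}" for x
    by (rule edge_deriv_eq[OF L that primitive_deriv[OF has_weak_derivD(4)[OF f'(2)] has_weak_derivD(3)[OF f'(1)] that]])
  have c: "continuous_on {0..L} (\<lambda>x. of_real 1 * potential a x * phase 1 a x)"
    by (intro continuous_intros potential_continuous phase_continuous a)
  have 1: "has_weak_deriv L (\<lambda>x. phase 1 a x * f x) (\<lambda>x. phase 1 a x * h x)"
    by (rule weak_deriv_cong[OF weak_deriv_product[OF f'(1) phase_deriv[OF a] c]])
      (auto simp: eqs ed algebra_simps)
  have 2: "has_weak_deriv L (\<lambda>x. phase 1 a x * h x) (\<lambda>x. - (phase 1 a x * g x))"
    by (rule weak_deriv_cong[OF weak_deriv_product[OF h phase_deriv[OF a] c]])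
      (auto simp: eqs(2) algebra_simps)
  show ?thesis using has_weak_derivD(3)[OF 1] has_weak_derivD(3)[OF 2] by (simp add: edge_solution_def)
qed

text \<open>
  That \<open>f\<close> has a second weak derivative needs the smoothness of the form: it is computed from
  \<open>f' = h - 2 \<pi> \<i> a f\<close>, where \<open>h = exp (-\<i> \<theta>) u'\<close>.
\<close>

lemma bloch_edge_backward:
  assumes L: "0 < L" and a: "smooth_on_edge L a" and k: "square_integrable L k" and sol: "edge_solution L z u v k"
  defines "f \<equiv> (\<lambda>x. phase (-1) a x * u x)"
  shows "sobolev2 L f"
    "\<And>x. x \<in> {0..L} \<Longrightarrow> edge_deriv L f x = phase (-1) a x * (v x - potential a x * u x)"
    "\<exists>h h'. has_weak_deriv L h h' \<and> (\<forall>x\<in>{0..L}. h x = edge_deriv L f x + potential a x * f x \<and>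
      z * f x + phase (-1) a x * k x = - (h' x + potential a x * h x))"
proof -
  let ?q = "phase (-1) a" and ?c = "potential a"
  obtain D where D: "\<And>x. x \<in> {0..L} \<Longrightarrow> D 0 x = a x"
    "\<And>n x. x \<in> {0..L} \<Longrightarrow> (D n has_vector_derivative D (Suc n) x) (at x within {0..L})"
    using a unfolding smooth_on_edge_def by blast
  have ca: "continuous_on {0..L} a" by (rule smooth_on_edge_continuous[OF a])
  have cD1: "continuous_on {0..L} (D 1)" by (rule continuous_on_vector_derivative[OF D(2)])
  have da: "(a has_real_derivative D 1 x) (at x within {0..L})" if "x \<in> {0..L}" for x
    unfolding has_real_derivative_iff_has_vector_derivative
    by (rule has_vector_derivative_transform[OF that, of _ "D 0"]) (use D that in auto)
  have dc: "(?c has_vector_derivative potential (D 1) x) (at x within {0..L})" if "x \<in> {0..L}" for x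
    unfolding potential_def by (intro has_vector_derivative_mult_right has_vector_derivative_of_real da that)
  have cq: "continuous_on {0..L} (\<lambda>x. of_real (-1) * ?c x * ?q x)"
    by (intro continuous_intros potential_continuous phase_continuous ca)
  note uv = edge_solution_weak_derivs[OF sol k]
  define f' where "f' x = ?q x * (v x - ?c x * u x)" for x
  define h where "h x = ?q x * v x" for x
  define h' where "h' x = ?q x * (- z * u x - k x) - ?c x * ?q x * v x" for x
  have wf: "has_weak_deriv L f f'"
    unfolding f_def f'_def
    by (rule weak_deriv_cong[OF weak_deriv_product[OF uv(1) phase_deriv[OF ca] cq]]) (auto simp: algebra_simps)
  have wh: "has_weak_deriv L h h'"
    unfolding h_def h'_def
    by (rule weak_deriv_cong[OF weak_deriv_product[OF uv(2) phase_deriv[OF ca] cq]]) (auto simp: algebra_simps)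
  have "has_weak_deriv L (\<lambda>x. h x - ?c x * f x) (\<lambda>x. h' x - (?c x * f' x + potential (D 1) x * f x))"
    by (rule weak_deriv_diff[OF wh weak_deriv_product[OF wf dc potential_continuous[OF cD1]]])
  then have wf': "has_weak_deriv L f' (\<lambda>x. h' x - (?c x * f' x + potential (D 1) x * f x))"
    by (rule weak_deriv_cong) (auto simp: h_def f_def f'_def algebra_simps)
  show "sobolev2 L f" unfolding sobolev2_def using wf wf' by blast
  show ed: "edge_deriv L f x = ?q x * (v x - ?c x * u x)" if "x \<in> {0..L}" for x
    unfolding f'_def[symmetric]
    by (rule edge_deriv_eq[OF L that primitive_deriv[OF has_weak_derivD(4)[OF wf'] has_weak_derivD(3)[OF wf] that]])
  show "\<exists>h h'. has_weak_deriv L h h' \<and> (\<forall>x\<in>{0..L}. h x = edge_deriv L f x + potential a x * f x \<and>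
      z * f x + phase (-1) a x * k x = - (h' x + potential a x * h x))"
    by (intro exI[of _ h] exI[of _ h'] conjI wh ballI)
      (simp_all add: ed, simp_all add: h_def h'_def f_def algebra_simps)
qed

text \<open>
  The factor is \<open>1\<close> at the tail and \<open>exp (-2 \<pi> \<i> \<integral>\<^sub>e \<alpha>)\<close> at the head.
\<close>

definition bloch_weight :: "('v, 'e) metric_graph \<Rightarrow> ('e \<Rightarrow> real \<Rightarrow> real) \<Rightarrow> 'e \<times> bool \<Rightarrow> complex" where
  "bloch_weight G \<alpha> d = phase (-1) (\<alpha> (fst d)) (end_point G d)"

text \<open>
  The condition on 1-forms at a vertex makes the Kirchhoff conditions for \<open>f'\<close> and for
  \<open>f' + 2 \<pi> \<i> a f\<close> equivalent when \<open>f\<close> is continuous there.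
\<close>

lemma one_forms_vertex_sum:
  assumes "\<alpha> \<in> one_forms G" "v \<in> verts G"
  shows "(\<Sum>d\<in>darts_at G v. of_real (normal_sign d) * potential (\<alpha> (fst d)) (end_point G d)) = 0"
proof -
  have "(\<Sum>d\<in>darts_at G v. of_real (normal_sign d) * potential (\<alpha> (fst d)) (end_point G d))
      = 2 * complex_of_real pi * \<i> * of_real (\<Sum>d\<in>darts_at G v. normal_sign d * \<alpha> (fst d) (end_point G d))"
    by (simp add: potential_def sum_distrib_left mult_ac)
  moreover have "(\<Sum>d\<in>darts_at G v. normal_sign d * \<alpha> (fst d) (end_point G d)) = 0"
    using assms by (simp add: one_forms_def)
  ultimately show ?thesis by (simp only: of_real_0 mult_zero_right)
qed

theorem Spec_form_eq_twisted:
  fixes G :: "('v, 'e) metric_graph"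
  assumes G: "quantum_graph G" and \<alpha>: "\<alpha> \<in> one_forms G"
  shows "Spec_form G \<alpha> = {(z, m). \<not> twisted_eigenspace G (bloch_weight G \<alpha>) z \<subseteq> {0} \<and>
    m = vector_space.dim cscale (twisted_eigenspace G (bloch_weight G \<alpha>) z)}"
  unfolding Spec_form_def
proof (rule spectrum_mult_gauge[OF G, where \<Gamma> = "\<lambda>f e x. phase 1 (\<alpha> e) x * f e x" and Y = UNIV])
  let ?\<Gamma> = "\<lambda>f e x. phase 1 (\<alpha> e) x * f e x" and ?w = "bloch_weight G \<alpha>"
  have smooth: "smooth_on_edge (len G e) (\<alpha> e)" if "e \<in> edges G" for e
    using \<alpha> that by (simp add: one_forms_def)
  have ca: "continuous_on {0..len G e} (\<alpha> e)" if "e \<in> edges G" for e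
    by (rule smooth_on_edge_continuous[OF smooth[OF that]])
  note L = quantum_graph_len_pos[OF G]
  have sq: "square_integrable (len G e) (?\<Gamma> h e)" if "h \<in> L2_space G" "e \<in> edges G" for h e
    using that by (intro square_integrable_continuous_mult phase_continuous ca) (auto simp: L2_space_def)
  show "?\<Gamma> (f + g) = ?\<Gamma> f + ?\<Gamma> g" for f g by (simp add: fun_eq_iff algebra_simps)
  show "?\<Gamma> (cscale c f) = cscale c (?\<Gamma> f)" for c f by (simp add: fun_eq_iff cscale_def)
  show "L2_norm_on G (edges G) f = L2_norm_on G (edges G) (?\<Gamma> f)" for f
    by (simp add: L2_norm_on_def norm_mult)
  show "inj_on ?\<Gamma> UNIV"
  proof (rule injI)
    fix f g :: "'e \<Rightarrow> real \<Rightarrow> complex" assume "?\<Gamma> f = ?\<Gamma> g"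
    then have "phase (-1) (\<alpha> e) x * ?\<Gamma> f e x = phase (-1) (\<alpha> e) x * ?\<Gamma> g e x" for e x by metis
    then show "f = g" by (simp add: fun_eq_iff)
  qed
  show "0 \<in> L2_space G"
    by (auto simp: L2_space_def supported_def zero_fun_def intro: square_integrable_continuous)
  show "square_integrable (len G e) (?\<Gamma> h e)" if "h \<in> L2_space G" "e \<in> edges G" for h e
    by (rule sq[OF that])
  show "f \<in> UNIV \<and> supported G (?\<Gamma> f) \<and> (\<forall>e\<in>edges G. square_integrable (len G e) (?\<Gamma> g e)) \<and>
      (\<exists>u'. twisted_solution G ?w 0 (?\<Gamma> f) u' (?\<Gamma> g))" if T: "(f, g) \<in> bloch_laplacian G \<alpha>" for f g
  proof (intro conjI ballI)
    have fd: "f \<in> bloch_domain G" and gd: "g \<in> L2_space G" using T by (auto simp: bloch_laplacian_def)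
    show "supported G (?\<Gamma> f)" using fd by (auto simp: bloch_domain_def supported_def)
    show "square_integrable (len G e) (?\<Gamma> g e)" if "e \<in> edges G" for e by (rule sq[OF gd that])
    have "\<forall>e\<in>edges G. \<exists>h. \<exists>h'. has_weak_deriv (len G e) h h' \<and> (\<forall>x\<in>{0..len G e}.
        h x = edge_deriv (len G e) (f e) x + potential (\<alpha> e) x * f e x \<and>
        g e x = - (h' x + potential (\<alpha> e) x * h x))"
      using T by (simp add: bloch_laplacian_def potential_def)
    from bchoice[OF this] obtain h where h: "\<forall>e\<in>edges G. \<exists>h'. has_weak_deriv (len G e) (h e) h' \<and> (\<forall>x\<in>{0..len G e}.
        h e x = edge_deriv (len G e) (f e) x + potential (\<alpha> e) x * f e x \<and>
        g e x = - (h' x + potential (\<alpha> e) x * h e x))" by blast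
    have "twisted_solution G ?w 0 (?\<Gamma> f) (?\<Gamma> h) (?\<Gamma> g)"
      unfolding twisted_solution_def
    proof
      show "\<forall>e\<in>edges G. edge_solution (len G e) 0 (?\<Gamma> f e) (?\<Gamma> h e) (?\<Gamma> g e)"
      proof
        fix e assume e: "e \<in> edges G"
        from h e obtain h' where h': "has_weak_deriv (len G e) (h e) h'" "\<And>x. x \<in> {0..len G e} \<Longrightarrow>
            h e x = edge_deriv (len G e) (f e) x + potential (\<alpha> e) x * f e x"
          "\<And>x. x \<in> {0..len G e} \<Longrightarrow> g e x = - (h' x + potential (\<alpha> e) x * h e x)" by blast
        show "edge_solution (len G e) 0 (?\<Gamma> f e) (?\<Gamma> h e) (?\<Gamma> g e)"
          by (rule bloch_edge_forward[OF L[OF e] ca[OF e] _ h']) (use fd e in \<open>auto simp: bloch_domain_def\<close>)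
      qed
      show "vertex_conditions G ?w (at_dart G (?\<Gamma> f)) (at_dart G (?\<Gamma> h))"
        unfolding vertex_conditions_def
      proof (intro ballI conjI)
        fix v assume v: "v \<in> verts G"
        obtain c where c: "\<And>d. d \<in> darts_at G v \<Longrightarrow> f (fst d) (end_point G d) = c"
          using fd v unfolding bloch_domain_def continuous_at_vertices_def by blast
        show "\<exists>c. \<forall>d\<in>darts_at G v. ?w d * at_dart G (?\<Gamma> f) d = c"
          by (intro exI[of _ c]) (simp add: bloch_weight_def at_dart_def c)
        have hd: "?w d * at_dart G (?\<Gamma> h) d = edge_deriv (len G (fst d)) (f (fst d)) (end_point G d)
            + potential (\<alpha> (fst d)) (end_point G d) * c" if d: "d \<in> darts_at G v" for d
        proof -
          have "d \<in> darts G" using d by (simp add: darts_at_eq)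
          then have "h (fst d) (end_point G d) = edge_deriv (len G (fst d)) (f (fst d)) (end_point G d)
              + potential (\<alpha> (fst d)) (end_point G d) * f (fst d) (end_point G d)"
            using h end_point_mem[OF G, of d] by fastforce
          then show ?thesis by (simp add: bloch_weight_def at_dart_def c[OF d])
        qed
        have "(\<Sum>d\<in>darts_at G v. of_real (normal_sign d) * (?w d * at_dart G (?\<Gamma> h) d))
          = (\<Sum>d\<in>darts_at G v. normal_sign d *\<^sub>R edge_deriv (len G (fst d)) (f (fst d)) (end_point G d))
          + (\<Sum>d\<in>darts_at G v. of_real (normal_sign d) * potential (\<alpha> (fst d)) (end_point G d)) * c"
          unfolding sum_distrib_right sum.distrib[symmetric]
          by (rule sum.cong[OF HOL.refl]) (simp add: hd scaleR_conv_of_real distrib_left mult.assoc)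
        then show "(\<Sum>d\<in>darts_at G v. of_real (normal_sign d) * (?w d * at_dart G (?\<Gamma> h) d)) = 0"
          using fd v one_forms_vertex_sum[OF \<alpha> v] by (simp add: bloch_domain_def kirchhoff_def)
      qed
    qed
    then show "\<exists>u'. twisted_solution G ?w 0 (?\<Gamma> f) u' (?\<Gamma> g)" by blast
  qed simp
  show "\<exists>(f, g)\<in>bloch_laplacian G \<alpha>. ?\<Gamma> f = u \<and> ?\<Gamma> g = cscale z u + ?\<Gamma> r"
    if r: "r \<in> L2_space G" and u: "supported G u" and sol: "twisted_solution G ?w z u u' (?\<Gamma> r)" for z r u u'
  proof -
    define f where "f e x = phase (-1) (\<alpha> e) x * u e x" for e x
    define g where "g = cscale z f + r"
    have es: "edge_solution (len G e) z (u e) (u' e) (?\<Gamma> r e)" if "e \<in> edges G" for e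
      using sol that by (simp add: twisted_solution_def)
    note bk = bloch_edge_backward[OF L smooth sq[OF r] es, folded f_def]
    have supp: "supported G f" using u by (simp add: supported_def f_def)
    have fd: "f \<in> bloch_domain G"
      unfolding bloch_domain_def
    proof (intro CollectI conjI ballI supp)
      show "sobolev2 (len G e) (f e)" if "e \<in> edges G" for e
        using bk(1)[OF that that that that] .
      show "continuous_at_vertices G f"
        unfolding continuous_at_vertices_def
      proof
        fix v assume "v \<in> verts G"
        then obtain c where c: "\<And>d. d \<in> darts_at G v \<Longrightarrow> ?w d * at_dart G u d = c"
          using sol unfolding twisted_solution_def vertex_conditions_def by blast
        then show "\<exists>c. \<forall>d\<in>darts_at G v. f (fst d) (end_point G d) = c"
          by (intro exI[of _ c]) (simp add: f_def bloch_weight_def at_dart_def)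
      qed
      show "kirchhoff G f"
        unfolding kirchhoff_def
      proof
        fix v assume v: "v \<in> verts G"
        then obtain c where c: "\<And>d. d \<in> darts_at G v \<Longrightarrow> ?w d * at_dart G u d = c"
          using sol unfolding twisted_solution_def vertex_conditions_def by blast
        have "normal_sign d *\<^sub>R edge_deriv (len G (fst d)) (f (fst d)) (end_point G d)
            = of_real (normal_sign d) * (?w d * at_dart G u' d)
              - of_real (normal_sign d) * potential (\<alpha> (fst d)) (end_point G d) * c" if d: "d \<in> darts_at G v" for d
        proof -
          have e: "fst d \<in> edges G" and dd: "d \<in> darts G" using d by (auto simp: darts_at_eq)
          show ?thesis
            unfolding bk(2)[OF e e e e end_point_mem[OF G dd]] c[OF d, symmetric]
            by (simp add: bloch_weight_def at_dart_def scaleR_conv_of_real algebra_simps)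
        qed
        then have "(\<Sum>d\<in>darts_at G v. normal_sign d *\<^sub>R edge_deriv (len G (fst d)) (f (fst d)) (end_point G d))
            = (\<Sum>d\<in>darts_at G v. of_real (normal_sign d) * (?w d * at_dart G u' d))
            - (\<Sum>d\<in>darts_at G v. of_real (normal_sign d) * potential (\<alpha> (fst d)) (end_point G d)) * c"
          by (simp add: sum_subtractf sum_distrib_right)
        then show "(\<Sum>d\<in>darts_at G v. normal_sign d *\<^sub>R edge_deriv (len G (fst d)) (f (fst d)) (end_point G d)) = 0"
          using sol v one_forms_vertex_sum[OF \<alpha> v] by (simp add: twisted_solution_def vertex_conditions_def)
      qed
    qed
    have "g \<in> L2_space G"
      unfolding L2_space_def
    proof (intro CollectI conjI ballI)
      show "supported G g" using supp r by (auto simp: g_def cscale_def supported_def L2_space_def)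
      fix e assume e: "e \<in> edges G"
      have "square_integrable (len G e) (\<lambda>x. z * f e x + r e x)"
      proof (rule square_integrable_add)
        show "square_integrable (len G e) (\<lambda>x. z * f e x)"
          unfolding f_def using edge_solution_continuous(1)[OF es[OF e]]
          by (intro square_integrable_continuous continuous_intros phase_continuous ca[OF e])
        show "square_integrable (len G e) (r e)" using r e by (simp add: L2_space_def)
      qed
      then show "square_integrable (len G e) (g e)" by (rule square_integrable_cong) (simp add: g_def cscale_def)
    qed
    moreover have "\<exists>h h'. has_weak_deriv (len G e) h h' \<and> (\<forall>x\<in>{0..len G e}.
        h x = edge_deriv (len G e) (f e) x + potential (\<alpha> e) x * f e x \<and>
        g e x = - (h' x + potential (\<alpha> e) x * h x))" if e: "e \<in> edges G" for e
      using bk(3)[OF e e e e] by (simp add: g_def cscale_def)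
    ultimately have "(f, g) \<in> bloch_laplacian G \<alpha>"
      using fd by (simp add: bloch_laplacian_def potential_def)
    moreover have "?\<Gamma> f = u" "?\<Gamma> g = cscale z u + ?\<Gamma> r"
      by (simp_all add: fun_eq_iff f_def g_def cscale_def algebra_simps)
    ultimately show ?thesis by (intro bexI[of _ "(f, g)"]) auto
  qed
qed auto

section \<open>Walks up to homotopy\<close>

definition rev_walk :: "('e \<times> bool) list \<Rightarrow> ('e \<times> bool) list" where
  "rev_walk p = map rev_dart (rev p)"

lemma rev_dart_rev_dart [simp]: "rev_dart (rev_dart d) = d"
  by (cases d) simp

lemma fst_rev_dart [simp]: "fst (rev_dart d) = fst d"
  by (cases d) simp

lemma rev_walk_simps [simp]: "rev_walk [] = []" "rev_walk (d # p) = rev_walk p @ [rev_dart d]"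
  "rev_walk (p @ q) = rev_walk q @ rev_walk p"
  by (simp_all add: rev_walk_def)

lemma rev_walk_rev_walk [simp]: "rev_walk (rev_walk p) = p"
  by (induction p) auto

lemma dart_start_rev [simp]: "dart_start G (rev_dart d) = dart_end G d"
  and dart_end_rev [simp]: "dart_end G (rev_dart d) = dart_start G d"
  by (simp_all add: dart_end_def)

lemma rev_dart_mem_darts_at: "d \<in> darts_at G u \<Longrightarrow> rev_dart d \<in> darts_at G (dart_end G d)"
  by (simp add: darts_at_def)

lemma walk_append:
  "walk G u (p @ q) w \<longleftrightarrow> (\<exists>v. walk G u p v \<and> walk G v q w)"
  if "quantum_graph G" "u \<in> verts G"
  using that(2)
proof (induction p arbitrary: u)
  case (Cons d p)
  show ?case
  proof (cases "d \<in> darts_at G u")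
    case True
    then have "dart_end G d \<in> verts G"
      using quantum_graph_dart_start[OF that(1), of "rev_dart d"]
      by (cases d) (auto simp: darts_at_def dart_end_def)
    then show ?thesis using Cons.IH True by simp
  qed simp
qed simp

lemma walk_verts:
  assumes "quantum_graph G" "walk G u p v"
  shows "u \<in> verts G" "v \<in> verts G"
proof -
  have "u \<in> verts G \<and> v \<in> verts G"
    using assms(2)
  proof (induction p arbitrary: u)
    case (Cons d p)
    then have "d \<in> darts_at G u" "v \<in> verts G" by auto
    then show ?case using quantum_graph_dart_start[OF assms(1), of d] by (cases d) (auto simp: darts_at_def)
  qed auto
  then show "u \<in> verts G" "v \<in> verts G" by auto
qed

lemma walk_appendI:
  assumes "quantum_graph G" "walk G u p v" "walk G v q w"
  shows "walk G u (p @ q) w"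
  using walk_append[OF assms(1) walk_verts(1)[OF assms(1,2)]] assms(2,3) by blast

lemma walk_end_unique: "walk G u p v \<Longrightarrow> walk G u p w \<Longrightarrow> v = w"
  by (induction p arbitrary: u) auto

lemma walk_single:
  assumes "quantum_graph G" "d \<in> darts_at G u"
  shows "walk G u [d] (dart_end G d)"
  using assms quantum_graph_dart_start[OF assms(1), of "rev_dart d"]
  by (cases d) (auto simp: darts_at_def dart_end_def)

lemma walk_rev:
  assumes "quantum_graph G" "walk G u p v"
  shows "walk G v (rev_walk p) u"
  using assms(2)
proof (induction p arbitrary: u)
  case (Cons d p)
  then have d: "d \<in> darts_at G u" and p: "walk G v (rev_walk p) (dart_end G d)" by auto
  have "walk G (dart_end G d) [rev_dart d] u"
    using walk_single[OF assms(1) rev_dart_mem_darts_at[OF d]] d by (simp add: darts_at_def)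
  from walk_appendI[OF assms(1) p this] show ?case by simp
qed simp

lemma walk_backtrack_iff:
  assumes G: "quantum_graph G" and u: "u \<in> verts G" and w: "walk G u (p @ [d, rev_dart d] @ q) v"
  shows "walk G u (p @ q) v"
proof -
  obtain x where x: "walk G u p x" "walk G x ([d, rev_dart d] @ q) v"
    using w walk_append[OF G u] by blast
  then have "walk G x q v" by (auto simp: darts_at_def)
  then show ?thesis by (rule walk_appendI[OF G x(1)])
qed

lemma dart_integral_rev [simp]: "dart_integral G \<alpha> (rev_dart d) = - dart_integral G \<alpha> d"
  by (cases d) (simp add: dart_integral_def)

lemma walk_integral_simps [simp]:
  "walk_integral G \<alpha> [] = 0" "walk_integral G \<alpha> (d # p) = dart_integral G \<alpha> d + walk_integral G \<alpha> p"
  "walk_integral G \<alpha> (p @ q) = walk_integral G \<alpha> p + walk_integral G \<alpha> q"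
  by (simp_all add: walk_integral_def)

lemma walk_integral_rev [simp]: "walk_integral G \<alpha> (rev_walk p) = - walk_integral G \<alpha> p"
  by (induction p) auto

lemma homotopic_walks:
  assumes G: "quantum_graph G" and u: "u \<in> verts G" and h: "homotopic G u p q"
  shows "\<exists>v. walk G u p v \<and> walk G u q v"
  using h
proof (induction rule: homotopic.induct)
  case (trans p q r)
  then show ?case using walk_end_unique by metis
next
  case (backtrack p d q v)
  then show ?case using walk_backtrack_iff[OF G u] by blast
qed blast+

lemma homotopic_walk_integral: "homotopic G u p q \<Longrightarrow> walk_integral G \<alpha> p = walk_integral G \<alpha> q"
  by (induction rule: homotopic.induct) auto

lemma homotopic_walk:
  assumes "quantum_graph G" "u \<in> verts G" "homotopic G u p q" "walk G u p v"
  shows "walk G u q v"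
  using homotopic_walks[OF assms(1-3)] assms(4) walk_end_unique by metis

lemma homotopic_append_right:
  assumes G: "quantum_graph G" and u: "u \<in> verts G"
    and h: "homotopic G u p q" and r: "walk G u p v" "walk G v r w"
  shows "homotopic G u (p @ r) (q @ r)"
  using h r
proof (induction arbitrary: v rule: homotopic.induct)
  case (refl p v')
  then show ?case by (meson homotopic.refl walk_appendI[OF G])
next
  case (sym p q)
  then show ?case by (meson homotopic.sym homotopic_walk[OF G u])
next
  case (trans p q r')
  then show ?case by (meson homotopic.trans homotopic_walk[OF G u])
next
  case (backtrack p d q v')
  then have "walk G u (p @ [d, rev_dart d] @ q @ r) w"
    using walk_appendI[OF G backtrack(2) backtrack(3)] by simp
  from homotopic.backtrack[OF this] show ?case by simp
qed

lemma homotopic_append_left: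
  assumes G: "quantum_graph G" and h: "homotopic G v p q" and r: "walk G u r v"
  shows "homotopic G u (r @ p) (r @ q)"
  using h
proof (induction rule: homotopic.induct)
  case (refl p w)
  then show ?case by (meson homotopic.refl walk_appendI[OF G r])
next
  case (sym p q)
  then show ?case by (meson homotopic.sym)
next
  case (trans p q s)
  then show ?case by (meson homotopic.trans)
next
  case (backtrack p d q w)
  then have "walk G u ((r @ p) @ [d, rev_dart d] @ q) w"
    using walk_appendI[OF G r backtrack] by simp
  from homotopic.backtrack[OF this] show ?case by simp
qed

text \<open>
  By induction from the inside out: first the walk behind the first dart cancels, then the dart itself.
\<close>

lemma homotopic_rev_cancel:
  assumes G: "quantum_graph G" and p: "walk G u p v"
  shows "homotopic G u (p @ rev_walk p) []"
  using p
proof (induction p arbitrary: u)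
  case Nil
  then show ?case by (auto intro: homotopic.refl)
next
  case (Cons d p)
  then have d: "d \<in> darts_at G u" and p: "walk G (dart_end G d) p v" by auto
  have u: "u \<in> verts G" using walk_verts[OF G Cons.prems] by simp
  have d1: "walk G u [d] (dart_end G d)" by (rule walk_single[OF G d])
  have d2: "walk G (dart_end G d) [rev_dart d] u"
    using walk_single[OF G rev_dart_mem_darts_at[OF d]] d by (simp add: darts_at_def)
  have "homotopic G (dart_end G d) ((p @ rev_walk p) @ [rev_dart d]) ([] @ [rev_dart d])"
    by (rule homotopic_append_right[OF G walk_verts(1)[OF G p] Cons.IH[OF p] _ d2])
      (rule walk_appendI[OF G p walk_rev[OF G p]])
  from homotopic_append_left[OF G this d1]
  have "homotopic G u (d # p @ rev_walk p @ [rev_dart d]) ([] @ [d, rev_dart d] @ [])" by simp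
  moreover have "homotopic G u ([] @ [d, rev_dart d] @ []) ([] @ [])"
    by (rule homotopic.backtrack[where v = u]) (use walk_appendI[OF G d1 d2] in \<open>simp del: walk.simps\<close>)
  ultimately show ?case using homotopic.trans by fastforce
qed

lemma hclass_eq_iff:
  assumes "walk G u q v"
  shows "hclass G u p = hclass G u q \<longleftrightarrow> homotopic G u p q"
proof
  assume "hclass G u p = hclass G u q"
  then show "homotopic G u p q" using homotopic.refl[OF assms] by (auto simp: hclass_def)
next
  assume "homotopic G u p q"
  then show "hclass G u p = hclass G u q"
    unfolding hclass_def by (intro Collect_cong) (blast intro: homotopic.sym homotopic.trans)
qed

lemma hclass_self: "walk G u p v \<Longrightarrow> p \<in> hclass G u p"
  by (simp add: hclass_def homotopic.refl)

text \<open>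
  The set \<open>Y\<close> is either a full homotopy class, for the group law and the deck transformations, or a single
  dart, as in the definition of the heads of the edges of the cover.
\<close>

lemma hconcat_hclass:
  assumes G: "quantum_graph G" and u: "u \<in> verts G" and p: "walk G u p v" and q: "walk G v q w"
    and Y: "q \<in> Y" "\<And>r. r \<in> Y \<Longrightarrow> homotopic G v q r"
  shows "hconcat G u (hclass G u p) Y = hclass G u (p @ q)"
proof
  show "hconcat G u (hclass G u p) Y \<subseteq> hclass G u (p @ q)"
  proof
    fix r assume "r \<in> hconcat G u (hclass G u p) Y"
    then obtain p' q' where pq: "homotopic G u p p'" "q' \<in> Y" "homotopic G u (p' @ q') r"
      by (auto simp: hconcat_def hclass_def)
    have p': "walk G u p' v" by (rule homotopic_walk[OF G u pq(1) p])
    have "homotopic G u (p @ q) (p' @ q)" by (rule homotopic_append_right[OF G u pq(1) p q])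
    moreover have "homotopic G u (p' @ q) (p' @ q')" by (rule homotopic_append_left[OF G Y(2)[OF pq(2)] p'])
    ultimately show "r \<in> hclass G u (p @ q)"
      using pq(3) unfolding hclass_def by (meson CollectI homotopic.trans)
  qed
  show "hclass G u (p @ q) \<subseteq> hconcat G u (hclass G u p) Y"
    using hclass_self[OF p] Y(1) by (auto simp: hconcat_def hclass_def)
qed

lemma hconcat_hclass_hclass:
  assumes "quantum_graph G" "u \<in> verts G" "walk G u p u" "walk G u q w"
  shows "hconcat G u (hclass G u p) (hclass G u q) = hclass G u (p @ q)"
  by (rule hconcat_hclass[OF assms hclass_self[OF assms(4)]]) (simp add: hclass_def)

lemma hconcat_dart:
  assumes G: "quantum_graph G" and u: "u \<in> verts G" and p: "walk G u p v" and d: "d \<in> darts_at G v"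
  shows "hconcat G u (hclass G u p) {[d]} = hclass G u (p @ [d])"
proof (rule hconcat_hclass[OF G u p])
  show w: "walk G v [d] (dart_end G d)" by (rule walk_single[OF G d])
  show "[d] \<in> {[d]}" by (rule singletonI)
  show "homotopic G v [d] r" if "r \<in> {[d]}" for r
    unfolding singletonD[OF that] by (rule homotopic.refl[OF w])
qed

lemma class_integral_hclass:
  assumes "walk G u p v"
  shows "class_integral G \<alpha> (hclass G u p) = walk_integral G \<alpha> p"
proof -
  have "walk_integral G \<alpha> q = walk_integral G \<alpha> p" if "q \<in> hclass G u p" for q
    using homotopic_walk_integral[of G u p q \<alpha>] that by (simp add: hclass_def)
  then have "walk_integral G \<alpha> ` hclass G u p = (\<lambda>_. walk_integral G \<alpha> p) ` hclass G u p"
    by (rule image_cong[OF HOL.refl])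
  also have "\<dots> = {walk_integral G \<alpha> p}"
    using hclass_self[OF assms] by blast
  finally have "walk_integral G \<alpha> ` hclass G u p = {walk_integral G \<alpha> p}" .
  then show ?thesis by (simp add: class_integral_def)
qed

lemma pi1_simps [simp]:
  "carrier (pi1 G v0) = {hclass G v0 p | p. walk G v0 p v0}" "mult (pi1 G v0) = hconcat G v0"
  "one (pi1 G v0) = hclass G v0 []"
  by (simp_all add: pi1_def)

section \<open>Characters of forms and the universal cover\<close>

definition character_of :: "real \<Rightarrow> complex" where
  "character_of t = exp (- 2 * complex_of_real pi * \<i> * complex_of_real t)"

lemma character_of_add: "character_of (s + t) = character_of s * character_of t"
  by (simp add: character_of_def exp_add[symmetric] algebra_simps)

lemma character_of_0 [simp]: "character_of 0 = 1"
  by (simp add: character_of_def)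

lemma norm_character_of [simp]: "cmod (character_of t) = 1"
  by (simp add: character_of_def)

lemma character_of_uminus: "character_of (- t) * character_of t = 1" "character_of t * character_of (- t) = 1"
  by (simp_all flip: character_of_add)

lemma form_character_hclass:
  assumes "walk G v0 p v0"
  shows "form_character G v0 \<alpha> (hclass G v0 p) = character_of (walk_integral G \<alpha> p)"
  using assms class_integral_hclass[OF assms, of \<alpha>]
  by (auto simp: form_character_def character_of_def)

lemma cover_simps [simp]:
  "verts (universal_cover G v0) = {hclass G v0 p | p v. walk G v0 p v}"
  "tail (universal_cover G v0) = fst"
  "head (universal_cover G v0) (X, e) = hconcat G v0 X {[(e, True)]}"
  "len (universal_cover G v0) (X, e) = len G e"
  by (simp_all add: universal_cover_def)

lemma cover_edge_iff:
  "(X, e) \<in> edges (universal_cover G v0) \<longleftrightarrow> e \<in> edges G \<and> (\<exists>p. X = hclass G v0 p \<and> walk G v0 p (tail G e))"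
  by (auto simp: universal_cover_def)

lemma cover_edgeE:
  assumes "\<epsilon> \<in> edges (universal_cover G v0)"
  obtains p e where "\<epsilon> = (hclass G v0 p, e)" "e \<in> edges G" "walk G v0 p (tail G e)"
  using assms by (auto simp: universal_cover_def)

lemma edge_lift:
  assumes "quantum_graph G" "v0 \<in> verts G" "e \<in> edges G"
  obtains p where "edge_lift G v0 e = (hclass G v0 p, e)" "walk G v0 p (tail G e)"
proof -
  obtain p where "walk G v0 p (tail G e)" using assms by (fastforce simp: quantum_graph_def)
  then have "\<exists>\<epsilon>. \<epsilon> \<in> edges (universal_cover G v0) \<and> snd \<epsilon> = e"
    using assms(3) by (auto simp: cover_edge_iff)
  then have "edge_lift G v0 e \<in> edges (universal_cover G v0) \<and> snd (edge_lift G v0 e) = e"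
    unfolding edge_lift_def by (rule someI_ex)
  then show thesis by (metis cover_edgeE snd_conv that)
qed

text \<open>
  The edge end over \<open>d\<close> at the vertex of the cover given by \<open>p\<close>.  Edges of the cover are labelled by their
  tails, so a dart that points against its edge is found on the edge whose tail lies one step further.
\<close>

definition lift_dart :: "('v, 'e) metric_graph \<Rightarrow> 'v \<Rightarrow> ('e \<times> bool) list \<Rightarrow> 'e \<times> bool \<Rightarrow>
    (('e \<times> bool) list set \<times> 'e) \<times> bool" where
  "lift_dart G v0 p d = ((hclass G v0 (if snd d then p else p @ [d]), fst d), snd d)"

text \<open>
  The cover looks like \<open>G\<close> near each vertex.  For a dart against its edge this uses that
  going along an edge and back is homotopic to staying.
\<close>

lemma lift_dart_bij:
  assumes G: "quantum_graph G" and v0: "v0 \<in> verts G" and p: "walk G v0 p v"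
  shows "bij_betw (lift_dart G v0 p) (darts_at G v) (darts_at (universal_cover G v0) (hclass G v0 p))"
  unfolding bij_betw_def
proof
  show "inj_on (lift_dart G v0 p) (darts_at G v)" by (auto simp: inj_on_def lift_dart_def prod_eq_iff)
  show "lift_dart G v0 p ` darts_at G v = darts_at (universal_cover G v0) (hclass G v0 p)"
  proof (intro equalityI subsetI)
    fix \<delta> assume "\<delta> \<in> lift_dart G v0 p ` darts_at G v"
    then obtain e b where eb: "(e, b) \<in> darts_at G v" "\<delta> = lift_dart G v0 p (e, b)" by auto
    show "\<delta> \<in> darts_at (universal_cover G v0) (hclass G v0 p)"
    proof (cases b)
      case True
      then show ?thesis using eb p by (auto simp: lift_dart_def darts_at_def cover_edge_iff)
    next
      case False
      then have e: "e \<in> edges G" "head G e = v" using eb(1) by (auto simp: darts_at_def)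
      have w1: "walk G v0 (p @ [(e, False)]) (tail G e)"
        using walk_appendI[OF G p walk_single[OF G, of "(e, False)" v]] eb(1) False
        by (simp add: dart_end_def)
      have tr: "(e, True) \<in> darts_at G (tail G e)" using e by (simp add: darts_at_def)
      have "walk G v0 ((p @ [(e, False)]) @ [(e, True)]) (head G e)"
        using walk_appendI[OF G w1 walk_single[OF G tr]] by (simp add: dart_end_def)
      then have "homotopic G v0 ((p @ [(e, False)]) @ [(e, True)]) p"
        using homotopic.backtrack[of G v0 p "(e, False)" "[]" "head G e"] by simp
      then have "hconcat G v0 (hclass G v0 (p @ [(e, False)])) {[(e, True)]} = hclass G v0 p"
        using hconcat_dart[OF G v0 w1 tr] hclass_eq_iff[OF p] by simp
      then show ?thesis using eb(2) False e w1
        by (auto simp: lift_dart_def darts_at_def cover_edge_iff)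
    qed
  next
    fix \<delta> assume \<delta>: "\<delta> \<in> darts_at (universal_cover G v0) (hclass G v0 p)"
    obtain \<epsilon> b where \<delta>': "\<delta> = (\<epsilon>, b)" by (cases \<delta>)
    with \<delta> have "\<epsilon> \<in> edges (universal_cover G v0)" by (simp add: darts_at_def)
    then obtain q e where q: "\<epsilon> = (hclass G v0 q, e)" "e \<in> edges G" "walk G v0 q (tail G e)"
      by (rule cover_edgeE)
    have tr: "(e, True) \<in> darts_at G (tail G e)" using q by (simp add: darts_at_def)
    show "\<delta> \<in> lift_dart G v0 p ` darts_at G v"
    proof (cases b)
      case True
      then have eq: "hclass G v0 q = hclass G v0 p" using \<delta> \<delta>' q by (simp add: darts_at_def)
      then have "homotopic G v0 q p" by (simp add: hclass_eq_iff[OF p])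
      then have "tail G e = v" using homotopic_walk[OF G v0 _ q(3)] walk_end_unique[OF p] by metis
      then show ?thesis using True \<delta>' q(1,2) eq
        by (intro image_eqI[of _ _ "(e, True)"]) (auto simp: lift_dart_def darts_at_def)
    next
      case False
      have w: "walk G v0 (q @ [(e, True)]) (head G e)"
        using walk_appendI[OF G q(3) walk_single[OF G tr]] by (simp add: dart_end_def)
      have "hclass G v0 (q @ [(e, True)]) = hclass G v0 p"
        using \<delta> \<delta>' q False hconcat_dart[OF G v0 q(3) tr] by (simp add: darts_at_def)
      then have h: "homotopic G v0 (q @ [(e, True)]) p" by (simp add: hclass_eq_iff[OF p])
      then have v: "head G e = v" using homotopic_walk[OF G v0 _ w] walk_end_unique[OF p] by metis
      have fl: "(e, False) \<in> darts_at G v" using v q(2) by (simp add: darts_at_def)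
      have w2: "walk G v0 (q @ [(e, True), (e, False)]) (tail G e)"
        using walk_appendI[OF G w, of "[(e, False)]" "tail G e"] walk_single[OF G fl] v
        by (simp add: dart_end_def)
      have h1: "homotopic G v0 (q @ [(e, True), (e, False)]) q"
        using homotopic.backtrack[of G v0 q "(e, True)" "[]" "tail G e"] w2 by simp
      have "walk G (head G e) [(e, False)] (tail G e)"
        using walk_single[OF G fl] v by (simp add: dart_end_def)
      from homotopic_append_right[OF G v0 h w this]
      have h2: "homotopic G v0 (q @ [(e, True), (e, False)]) (p @ [(e, False)])" by simp
      have "homotopic G v0 (p @ [(e, False)]) q"
        by (rule homotopic.trans[OF homotopic.sym[OF h2] h1])
      then have "hclass G v0 (p @ [(e, False)]) = hclass G v0 q" by (simp add: hclass_eq_iff[OF q(3)])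
      then show ?thesis using False \<delta>' q(1) fl
        by (intro image_eqI[of _ _ "(e, False)"]) (auto simp: lift_dart_def)
    qed
  qed
qed

lemma deck_hclass:
  assumes "quantum_graph G" "v0 \<in> verts G" "walk G v0 g v0" "walk G v0 p v"
  shows "deck G v0 (hclass G v0 g) (hclass G v0 p, e) = (hclass G v0 (g @ p), e)"
  using hconcat_hclass_hclass[OF assms] by (simp add: deck_def)

section \<open>Smooth functions on an edge\<close>

lemma smooth_on_edge_zero: "smooth_on_edge L 0"
  unfolding smooth_on_edge_def by (intro exI[of _ "\<lambda>_ _. 0"]) (auto intro: has_vector_derivative_const)

lemma smooth_edge_deriv:
  fixes f :: "real \<Rightarrow> 'a::euclidean_space"
  assumes L: "0 < L" and f: "smooth_on_edge L f"
  shows "\<And>x. x \<in> {0..L} \<Longrightarrow> (f has_vector_derivative edge_deriv L f x) (at x within {0..L})"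
    "smooth_on_edge L (edge_deriv L f)"
proof -
  obtain D where D: "\<And>x. x \<in> {0..L} \<Longrightarrow> D 0 x = f x"
    "\<And>n x. x \<in> {0..L} \<Longrightarrow> (D n has_vector_derivative D (Suc n) x) (at x within {0..L})"
    using f unfolding smooth_on_edge_def by blast
  have d: "(f has_vector_derivative D 1 x) (at x within {0..L})" if "x \<in> {0..L}" for x
    by (rule has_vector_derivative_transform[OF that, of _ "D 0"]) (use D that in auto)
  then have eq: "edge_deriv L f x = D 1 x" if "x \<in> {0..L}" for x
    using edge_deriv_eq[OF L that] that by blast
  show "(f has_vector_derivative edge_deriv L f x) (at x within {0..L})" if "x \<in> {0..L}" for x
    using d[OF that] eq[OF that] by simp
  show "smooth_on_edge L (edge_deriv L f)"
    unfolding smooth_on_edge_def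
    by (rule exI[of _ "\<lambda>n. D (Suc n)"]) (use D(2) eq in auto)
qed

lemma smooth_scaled:
  fixes f g :: "real \<Rightarrow> complex"
  assumes L: "0 < L" and f: "smooth_on_edge L f" and g: "\<And>x. x \<in> {0..L} \<Longrightarrow> g x = c * f x"
  shows "smooth_on_edge L g" "\<And>x. x \<in> {0..L} \<Longrightarrow> edge_deriv L g x = c * edge_deriv L f x"
proof -
  obtain D where D: "\<And>x. x \<in> {0..L} \<Longrightarrow> D 0 x = f x"
    "\<And>n x. x \<in> {0..L} \<Longrightarrow> (D n has_vector_derivative D (Suc n) x) (at x within {0..L})"
    using f unfolding smooth_on_edge_def by blast
  show "smooth_on_edge L g"
    unfolding smooth_on_edge_def
    by (rule exI[of _ "\<lambda>n x. c * D n x"]) (auto simp: D(1) g intro!: has_vector_derivative_mult_right D(2))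
  show "edge_deriv L g x = c * edge_deriv L f x" if "x \<in> {0..L}" for x
  proof (rule edge_deriv_eq[OF L that])
    show "(g has_vector_derivative c * edge_deriv L f x) (at x within {0..L})"
      by (rule has_vector_derivative_transform[OF that g])
        (auto intro!: has_vector_derivative_mult_right smooth_edge_deriv(1)[OF L f] that)
  qed
qed

lemma edge_solution_smooth:
  assumes L: "0 < L" and u: "smooth_on_edge L u"
  shows "edge_solution L 0 u (edge_deriv L u) (\<lambda>x. - edge_deriv L (edge_deriv L u) x)"
proof -
  have *: "(edge_deriv L f has_integral f x - f 0) {0..x}"
    if f: "smooth_on_edge L f" and x: "x \<in> {0..L}" for f :: "real \<Rightarrow> complex" and x
  proof (rule fundamental_theorem_of_calculus)
    show "(f has_vector_derivative edge_deriv L f t) (at t within {0..x})" if "t \<in> {0..x}" for t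
      by (rule has_vector_derivative_within_subset[OF smooth_edge_deriv(1)[OF L f]]) (use that x in auto)
  qed (use x in auto)
  show ?thesis unfolding edge_solution_def using *[OF u] *[OF smooth_edge_deriv(2)[OF L u]] by simp
qed

fun solution_deriv :: "complex \<Rightarrow> (real \<Rightarrow> complex) \<Rightarrow> (real \<Rightarrow> complex) \<Rightarrow> (nat \<Rightarrow> real \<Rightarrow> complex) \<Rightarrow> nat \<Rightarrow> real \<Rightarrow> complex" where
  "solution_deriv z u u' D 0 = u"
| "solution_deriv z u u' D (Suc 0) = u'"
| "solution_deriv z u u' D (Suc (Suc n)) = (\<lambda>x. - z * solution_deriv z u u' D n x - D n x)"

text \<open>
  The equation expresses the derivatives of order \<open>n + 2\<close> of \<open>u\<close> by those of order \<open>n\<close> of \<open>u\<close> and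
  \<open>k\<close>; \<open>solution_deriv\<close> is the resulting sequence.
\<close>

lemma edge_solution_smooth_source:
  assumes sol: "edge_solution L z u u' k" and k: "smooth_on_edge L k"
  shows "smooth_on_edge L u"
proof -
  obtain D where D: "\<And>x. x \<in> {0..L} \<Longrightarrow> D 0 x = k x"
    "\<And>n x. x \<in> {0..L} \<Longrightarrow> (D n has_vector_derivative D (Suc n) x) (at x within {0..L})"
    using k unfolding smooth_on_edge_def by blast
  have "\<forall>x\<in>{0..L}. (solution_deriv z u u' D n has_vector_derivative solution_deriv z u u' D (Suc n) x) (at x within {0..L})" for n
  proof (induction n rule: induct_nat_012)
    case 0
    show ?case using edge_solution_derivs(1)[OF sol] by simp
  next
    case 1
    show ?case
      using edge_solution_derivs(2)[OF sol _ smooth_on_edge_continuous[OF k]] by (simp add: D(1))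
  next
    case (ge2 n)
    have "((\<lambda>x. - z * solution_deriv z u u' D n x - D n x) has_vector_derivative
        - z * solution_deriv z u u' D (Suc n) x - D (Suc n) x) (at x within {0..L})" if "x \<in> {0..L}" for x
      using ge2(1) that by (intro has_vector_derivative_diff has_vector_derivative_mult_right D(2)) auto
    then show ?case by simp
  qed
  then show ?thesis unfolding smooth_on_edge_def by (intro exI[of _ "solution_deriv z u u' D"]) auto
qed

section \<open>The Laplacian on equivariant functions\<close>

text \<open>
  The factor is \<open>1\<close> at the tail and \<open>exp (2 \<pi> \<i> \<integral>\<^sub>e \<alpha>)\<close> at the head.
\<close>

definition cover_weight :: "('v, 'e) metric_graph \<Rightarrow> ('e \<Rightarrow> real \<Rightarrow> real) \<Rightarrow> 'e \<times> bool \<Rightarrow> complex" where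
  "cover_weight G \<alpha> d = (if snd d then 1 else character_of (dart_integral G \<alpha> d))"

lemma norm_cover_weight [simp]: "cmod (cover_weight G \<alpha> d) = 1"
  by (simp add: cover_weight_def)

lemma bloch_weight_eq_cnj: "bloch_weight G \<alpha> d = cnj (cover_weight G \<alpha> d)"
  by (cases d) (simp add: bloch_weight_def cover_weight_def end_point_def dart_integral_def phase_def
      character_of_def exp_cnj)

text \<open>
  On the copy of the edge \<open>e\<close> that starts at the class of \<open>p\<close>, the function \<open>f\<close> is \<open>u\<close> times the phase of the
  integral along \<open>p\<close>.  Exactly the equivariant functions arise in this way.
\<close>

definition lifts :: "('v, 'e) metric_graph \<Rightarrow> 'v \<Rightarrow> ('e \<Rightarrow> real \<Rightarrow> real) \<Rightarrow>
    (('e \<times> bool) list set \<times> 'e \<Rightarrow> real \<Rightarrow> complex) \<Rightarrow> ('e \<Rightarrow> real \<Rightarrow> complex) \<Rightarrow> bool" where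
  "lifts G v0 \<alpha> f u \<longleftrightarrow> (\<forall>e\<in>edges G. \<forall>p x. walk G v0 p (tail G e) \<longrightarrow> x \<in> {0..len G e} \<longrightarrow>
     f (hclass G v0 p, e) x = character_of (walk_integral G \<alpha> p) * u e x)"

text \<open>
  At a head the walk to the tail of the edge is one step longer than \<open>p\<close>; the weight accounts for this step.
\<close>

lemma lifts_at_dart:
  assumes G: "quantum_graph G" and f: "lifts G v0 \<alpha> f u" and p: "walk G v0 p v"
    and d: "d \<in> darts_at G v" and x: "x \<in> {0..len G (fst d)}"
  shows "f (fst (lift_dart G v0 p d)) x
    = character_of (walk_integral G \<alpha> p) * cover_weight G \<alpha> d * u (fst d) x"
proof (cases "snd d")
  case True
  then have "tail G (fst d) = v" "fst d \<in> edges G" using d by (cases d; auto simp: darts_at_def)+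
  then show ?thesis using f p x True by (auto simp: lifts_def lift_dart_def cover_weight_def)
next
  case False
  then have e: "fst d \<in> edges G" and t: "dart_end G d = tail G (fst d)"
    using d by (cases d; auto simp: darts_at_def dart_end_def)+
  have "walk G v0 (p @ [d]) (tail G (fst d))"
    using walk_appendI[OF G p walk_single[OF G d]] t by simp
  then have "f (hclass G v0 (p @ [d]), fst d) x = character_of (walk_integral G \<alpha> (p @ [d])) * u (fst d) x"
    using f e x unfolding lifts_def by blast
  then show ?thesis using False by (simp add: lift_dart_def cover_weight_def character_of_add)
qed

text \<open>
  The conditions at the vertex of the cover given by \<open>p\<close> are those at the end of \<open>p\<close>, multiplied
  by the phase of \<open>p\<close>.
\<close>

lemma lifts_vertex_conditions:
  fixes G :: "('v, 'e) metric_graph"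
  assumes G: "quantum_graph G" and v0: "v0 \<in> verts G" and f: "lifts G v0 \<alpha> f u"
    and u: "\<And>e. e \<in> edges G \<Longrightarrow> smooth_on_edge (len G e) (u e)"
  shows "continuous_at_vertices (universal_cover G v0) f \<and> kirchhoff (universal_cover G v0) f \<longleftrightarrow>
    vertex_conditions G (cover_weight G \<alpha>) (at_dart G u) (at_dart G (\<lambda>e. edge_deriv (len G e) (u e)))"
proof -
  let ?cov = "universal_cover G v0" and ?w = "cover_weight G \<alpha>"
  let ?\<chi> = "\<lambda>p. character_of (walk_integral G \<alpha> p)"
  let ?u' = "\<lambda>e. edge_deriv (len G e) (u e)"
  have \<chi>0: "?\<chi> p \<noteq> 0" for p by (metis norm_character_of norm_zero zero_neq_one)
  have ends: "end_point ?cov (lift_dart G v0 p d) = end_point G d" "normal_sign (lift_dart G v0 p d) = normal_sign d"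
    "len ?cov (fst (lift_dart G v0 p d)) = len G (fst d)" for p d
    by (simp_all add: lift_dart_def end_point_def normal_sign_def)
  have val: "f (fst (lift_dart G v0 p d)) (end_point G d) = ?\<chi> p * (?w d * at_dart G u d)"
    and der: "edge_deriv (len G (fst d)) (f (fst (lift_dart G v0 p d))) (end_point G d) = ?\<chi> p * (?w d * at_dart G ?u' d)"
    if p: "walk G v0 p v" and d: "d \<in> darts_at G v" for p v d
  proof -
    have e: "fst d \<in> edges G" and dd: "d \<in> darts G" using d by (auto simp: darts_at_eq)
    note x = end_point_mem[OF G dd]
    show "f (fst (lift_dart G v0 p d)) (end_point G d) = ?\<chi> p * (?w d * at_dart G u d)"
      using lifts_at_dart[OF G f p d x] by (simp add: at_dart_def)
    show "edge_deriv (len G (fst d)) (f (fst (lift_dart G v0 p d))) (end_point G d) = ?\<chi> p * (?w d * at_dart G ?u' d)"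
      using smooth_scaled(2)[OF quantum_graph_len_pos[OF G e] u[OF e] lifts_at_dart[OF G f p d] x]
      by (simp add: at_dart_def)
  qed
  have cont: "(\<exists>c. \<forall>\<delta>\<in>darts_at ?cov (hclass G v0 p). f (fst \<delta>) (end_point ?cov \<delta>) = c) \<longleftrightarrow>
      (\<exists>c. \<forall>d\<in>darts_at G v. ?w d * at_dart G u d = c)" if p: "walk G v0 p v" for p v
  proof -
    have "(\<exists>c. \<forall>\<delta>\<in>darts_at ?cov (hclass G v0 p). f (fst \<delta>) (end_point ?cov \<delta>) = c) \<longleftrightarrow>
        (\<exists>c. \<forall>d\<in>darts_at G v. ?\<chi> p * (?w d * at_dart G u d) = c)"
      unfolding bij_betw_imp_surj_on[OF lift_dart_bij[OF G v0 p], symmetric] ball_simps ends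
      using val[OF p] by simp
    also have "\<dots> \<longleftrightarrow> (\<exists>c. \<forall>d\<in>darts_at G v. ?w d * at_dart G u d = c)"
    proof
      assume "\<exists>c. \<forall>d\<in>darts_at G v. ?\<chi> p * (?w d * at_dart G u d) = c"
      then obtain c where "\<forall>d\<in>darts_at G v. ?\<chi> p * (?w d * at_dart G u d) = c" by blast
      then have "\<forall>d\<in>darts_at G v. ?w d * at_dart G u d = c / ?\<chi> p"
        using \<chi>0[of p] by (simp add: field_simps)
      then show "\<exists>c. \<forall>d\<in>darts_at G v. ?w d * at_dart G u d = c" by blast
    qed auto
    finally show ?thesis .
  qed
  have kirch: "(\<Sum>\<delta>\<in>darts_at ?cov (hclass G v0 p). normal_sign \<delta> *\<^sub>R
        edge_deriv (len ?cov (fst \<delta>)) (f (fst \<delta>)) (end_point ?cov \<delta>)) = 0 \<longleftrightarrow>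
      (\<Sum>d\<in>darts_at G v. of_real (normal_sign d) * (?w d * at_dart G ?u' d)) = 0" if p: "walk G v0 p v" for p v
  proof -
    have "(\<Sum>\<delta>\<in>darts_at ?cov (hclass G v0 p). normal_sign \<delta> *\<^sub>R
        edge_deriv (len ?cov (fst \<delta>)) (f (fst \<delta>)) (end_point ?cov \<delta>))
      = (\<Sum>d\<in>darts_at G v. normal_sign d *\<^sub>R (?\<chi> p * (?w d * at_dart G ?u' d)))"
      unfolding sum.reindex_bij_betw[OF lift_dart_bij[OF G v0 p], symmetric] ends
      using der[OF p] by (intro sum.cong) auto
    also have "\<dots> = ?\<chi> p * (\<Sum>d\<in>darts_at G v. of_real (normal_sign d) * (?w d * at_dart G ?u' d))"
      by (simp add: sum_distrib_left scaleR_conv_of_real mult_ac)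
    finally show ?thesis using \<chi>0[of p] by simp
  qed
  have verts: "(\<forall>Y\<in>verts ?cov. P Y) \<longleftrightarrow> (\<forall>v p. walk G v0 p v \<longrightarrow> P (hclass G v0 p))" for P by auto
  have reach: "v \<in> verts G \<longleftrightarrow> (\<exists>p. walk G v0 p v)" for v
    using G v0 walk_verts(2)[OF G] by (auto simp: quantum_graph_def)
  have transfer: "(\<forall>v p. W p v \<longrightarrow> C p) \<and> (\<forall>v p. W p v \<longrightarrow> K p) \<longleftrightarrow> (\<forall>v\<in>V. A v \<and> B v)"
    if "\<And>p v. W p v \<Longrightarrow> C p \<longleftrightarrow> A v" "\<And>p v. W p v \<Longrightarrow> K p \<longleftrightarrow> B v" "\<And>v. v \<in> V \<longleftrightarrow> (\<exists>p. W p v)"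
    for W :: "('e \<times> bool) list \<Rightarrow> 'v \<Rightarrow> bool" and C K A B and V :: "'v set"
    using that by blast
  show ?thesis
    unfolding continuous_at_vertices_def kirchhoff_def vertex_conditions_def verts
    by (rule transfer[OF cont kirch reach])
qed

text \<open>
  The function \<open>u\<close> that \<open>f\<close> lifts, read off from the copy of each edge in the fundamental domain.
\<close>

definition descend :: "('v, 'e) metric_graph \<Rightarrow> 'v \<Rightarrow> ('e \<Rightarrow> real \<Rightarrow> real) \<Rightarrow>
    (('e \<times> bool) list set \<times> 'e \<Rightarrow> real \<Rightarrow> complex) \<Rightarrow> 'e \<Rightarrow> real \<Rightarrow> complex" where
  "descend G v0 \<alpha> f e x = (if e \<in> edges G \<and> x \<in> {0..len G e}
     then character_of (- class_integral G \<alpha> (fst (edge_lift G v0 e))) * f (edge_lift G v0 e) x else 0)"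

lemma descend_lifts:
  assumes G: "quantum_graph G" and v0: "v0 \<in> verts G" and f: "lifts G v0 \<alpha> f u" and u: "supported G u"
  shows "descend G v0 \<alpha> f = u"
proof (intro ext)
  fix e x
  show "descend G v0 \<alpha> f e x = u e x"
  proof (cases "e \<in> edges G \<and> x \<in> {0..len G e}")
    case True
    then obtain p where p: "edge_lift G v0 e = (hclass G v0 p, e)" "walk G v0 p (tail G e)"
      using edge_lift[OF G v0] by blast
    have "f (hclass G v0 p, e) x = character_of (walk_integral G \<alpha> p) * u e x"
      using f True p(2) unfolding lifts_def by blast
    then show ?thesis using True p
      by (simp add: descend_def class_integral_hclass character_of_uminus flip: mult.assoc)
  next
    case False
    then have "u e x = 0" using u unfolding supported_def by blast
    then show ?thesis using False unfolding descend_def by auto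
  qed
qed

text \<open>
  For walks \<open>p\<close> and \<open>q\<close> to the tail of an edge, the deck transformation of the closed walk \<open>p q\<^sup>-\<^sup>1\<close> takes
  the copy of the edge at \<open>q\<close> to the copy at \<open>p\<close>.
\<close>

lemma lifts_descend:
  assumes G: "quantum_graph G" and v0: "v0 \<in> verts G"
    and f: "equivariant G v0 (form_character G v0 \<alpha>) f"
  shows "lifts G v0 \<alpha> f (descend G v0 \<alpha> f)"
  unfolding lifts_def
proof (intro ballI allI impI)
  fix e p x assume e: "e \<in> edges G" and p: "walk G v0 p (tail G e)" and x: "x \<in> {0..len G e}"
  obtain q where q: "edge_lift G v0 e = (hclass G v0 q, e)" "walk G v0 q (tail G e)"
    using edge_lift[OF G v0 e] .
  have g: "walk G v0 (p @ rev_walk q) v0" by (rule walk_appendI[OF G p walk_rev[OF G q(2)]])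
  have "homotopic G v0 (p @ rev_walk q @ q) (p @ [])"
    using homotopic_append_left[OF G homotopic_rev_cancel[OF G walk_rev[OF G q(2)]] p] by simp
  then have "hclass G v0 ((p @ rev_walk q) @ q) = hclass G v0 p" by (simp add: hclass_eq_iff[OF p])
  then have dk: "deck G v0 (hclass G v0 (p @ rev_walk q)) (hclass G v0 q, e) = (hclass G v0 p, e)"
    using deck_hclass[OF G v0 g q(2), of e] by simp
  have "hclass G v0 (p @ rev_walk q) \<in> carrier (pi1 G v0)" using g by auto
  moreover have "(hclass G v0 q, e) \<in> edges (universal_cover G v0)" using e q(2) by (auto simp: cover_edge_iff)
  moreover have "x \<in> {0..len (universal_cover G v0) (hclass G v0 q, e)}" using x by simp
  ultimately have "f (deck G v0 (hclass G v0 (p @ rev_walk q)) (hclass G v0 q, e)) x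
      = form_character G v0 \<alpha> (hclass G v0 (p @ rev_walk q)) * f (hclass G v0 q, e) x"
    using f unfolding equivariant_def by blast
  then have "f (hclass G v0 p, e) x
      = character_of (walk_integral G \<alpha> p) * character_of (- walk_integral G \<alpha> q) * f (hclass G v0 q, e) x"
    unfolding dk form_character_hclass[OF g] character_of_add[symmetric] by simp
  then show "f (hclass G v0 p, e) x = character_of (walk_integral G \<alpha> p) * descend G v0 \<alpha> f e x"
    using e x q class_integral_hclass[OF q(2), of \<alpha>] by (simp add: descend_def)
qed

lemma lifts_equivariant:
  assumes G: "quantum_graph G" and v0: "v0 \<in> verts G" and f: "lifts G v0 \<alpha> f u"
  shows "equivariant G v0 (form_character G v0 \<alpha>) f"
  unfolding equivariant_def
proof (intro ballI)
  fix \<gamma> \<epsilon> x assume "\<gamma> \<in> carrier (pi1 G v0)" and \<epsilon>: "\<epsilon> \<in> edges (universal_cover G v0)"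
    and x: "x \<in> {0..len (universal_cover G v0) \<epsilon>}"
  then obtain g where g: "\<gamma> = hclass G v0 g" "walk G v0 g v0" by auto
  obtain p e where p: "\<epsilon> = (hclass G v0 p, e)" "e \<in> edges G" "walk G v0 p (tail G e)"
    using cover_edgeE[OF \<epsilon>] .
  have x': "x \<in> {0..len G e}" using x p by simp
  have "f (hclass G v0 (g @ p), e) x = character_of (walk_integral G \<alpha> (g @ p)) * u e x"
    using f p(2) x' walk_appendI[OF G g(2) p(3)] unfolding lifts_def by blast
  moreover have "f (hclass G v0 p, e) x = character_of (walk_integral G \<alpha> p) * u e x"
    using f p(2,3) x' unfolding lifts_def by blast
  ultimately show "f (deck G v0 \<gamma> \<epsilon>) x = form_character G v0 \<alpha> \<gamma> * f \<epsilon> x"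
    unfolding g(1) p(1) deck_hclass[OF G v0 g(2) p(3)] form_character_hclass[OF g(2)]
    by (simp add: character_of_add)
qed

lemma lifts_std_laplacian:
  assumes G: "quantum_graph G" and v0: "v0 \<in> verts G" and f: "lifts G v0 \<alpha> f u"
    and u: "\<And>e. e \<in> edges G \<Longrightarrow> smooth_on_edge (len G e) (u e)"
  shows "lifts G v0 \<alpha> (std_laplacian (universal_cover G v0) f)
    (\<lambda>e x. - edge_deriv (len G e) (edge_deriv (len G e) (u e)) x)"
  unfolding lifts_def
proof (intro ballI allI impI)
  fix e p x assume e: "e \<in> edges G" and p: "walk G v0 p (tail G e)" and x: "x \<in> {0..len G e}"
  let ?\<epsilon> = "(hclass G v0 p, e)" and ?\<chi> = "character_of (walk_integral G \<alpha> p)"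
  have \<epsilon>: "?\<epsilon> \<in> edges (universal_cover G v0)" using e p by (auto simp: cover_edge_iff)
  note L = quantum_graph_len_pos[OF G e]
  have 0: "f ?\<epsilon> y = ?\<chi> * u e y" if "y \<in> {0..len G e}" for y
    using f e p that unfolding lifts_def by blast
  have 1: "ext_d (universal_cover G v0) f ?\<epsilon> y = ?\<chi> * edge_deriv (len G e) (u e) y" if "y \<in> {0..len G e}" for y
    using smooth_scaled(2)[OF L u[OF e] 0 that] \<epsilon> that by (simp add: ext_d_def)
  have "ext_d (universal_cover G v0) (ext_d (universal_cover G v0) f) ?\<epsilon> x
      = ?\<chi> * edge_deriv (len G e) (edge_deriv (len G e) (u e)) x"
    using smooth_scaled(2)[OF L smooth_edge_deriv(2)[OF L u[OF e]] 1 x] \<epsilon> x by (subst ext_d_def) simp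
  then show "std_laplacian (universal_cover G v0) f ?\<epsilon> x
      = ?\<chi> * - edge_deriv (len G e) (edge_deriv (len G e) (u e)) x"
    by (simp add: std_laplacian_def)
qed

lemma descend_smooth:
  assumes G: "quantum_graph G" and v0: "v0 \<in> verts G" and e: "e \<in> edges G"
    and f: "\<And>\<epsilon>. \<epsilon> \<in> edges (universal_cover G v0) \<Longrightarrow> smooth_on_edge (len (universal_cover G v0) \<epsilon>) (f \<epsilon>)"
  shows "smooth_on_edge (len G e) (descend G v0 \<alpha> f e)"
proof -
  obtain p where p: "edge_lift G v0 e = (hclass G v0 p, e)" "walk G v0 p (tail G e)"
    using edge_lift[OF G v0 e] .
  have "smooth_on_edge (len G e) (f (hclass G v0 p, e))"
    using f[of "(hclass G v0 p, e)"] e p(2) by (auto simp: cover_edge_iff)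
  then show ?thesis
    by (rule smooth_scaled(1)[OF quantum_graph_len_pos[OF G e]]) (use e p in \<open>auto simp: descend_def\<close>)
qed

lemma descend_L2_norm:
  assumes G: "quantum_graph G" and v0: "v0 \<in> verts G"
  shows "L2_norm_on (universal_cover G v0) (edge_lift G v0 ` edges G) f = L2_norm_on G (edges G) (descend G v0 \<alpha> f)"
proof -
  have snd: "snd (edge_lift G v0 e) = e \<and> len (universal_cover G v0) (edge_lift G v0 e) = len G e" if "e \<in> edges G" for e
    using edge_lift[OF G v0 that] by (metis cover_simps(4) snd_conv)
  have inj: "inj_on (edge_lift G v0) (edges G)" by (rule inj_onI) (metis snd)
  have "integral\<^sup>L (lebesgue_on {0..len (universal_cover G v0) (edge_lift G v0 e)}) (\<lambda>x. (cmod (f (edge_lift G v0 e) x))\<^sup>2)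
      = integral\<^sup>L (lebesgue_on {0..len G e}) (\<lambda>x. (cmod (descend G v0 \<alpha> f e x))\<^sup>2)" if e: "e \<in> edges G" for e
    using snd[OF e] e by (auto simp: descend_def norm_mult intro!: Bochner_Integration.integral_cong)
  then show ?thesis unfolding L2_norm_on_def by (simp add: sum.reindex[OF inj])
qed

theorem pi1_spectrum_eq_twisted:
  fixes G :: "('v, 'e) metric_graph"
  assumes G: "quantum_graph G" and v0: "v0 \<in> verts G"
  shows "pi1_spectrum G v0 (form_character G v0 \<alpha>) = {(z, m). \<not> twisted_eigenspace G (cover_weight G \<alpha>) z \<subseteq> {0} \<and>
    m = vector_space.dim cscale (twisted_eigenspace G (cover_weight G \<alpha>) z)}"
  unfolding pi1_spectrum_def
proof (rule spectrum_mult_gauge[OF G, where \<Gamma> = "descend G v0 \<alpha>" and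
      Y = "{f. supported (universal_cover G v0) f \<and> equivariant G v0 (form_character G v0 \<alpha>) f}"])
  let ?cov = "universal_cover G v0" and ?\<psi> = "form_character G v0 \<alpha>" and ?w = "cover_weight G \<alpha>"
  let ?\<Gamma> = "descend G v0 \<alpha>" and ?Y = "{f. supported (universal_cover G v0) f \<and> equivariant G v0 (form_character G v0 \<alpha>) f}"
  note L = quantum_graph_len_pos[OF G]
  show "?\<Gamma> (f + g) = ?\<Gamma> f + ?\<Gamma> g" for f g by (intro ext) (simp add: descend_def algebra_simps)
  show "?\<Gamma> (cscale c f) = cscale c (?\<Gamma> f)" for c f by (intro ext) (simp add: descend_def cscale_def)
  show "L2_norm_on ?cov (edge_lift G v0 ` edges G) f = L2_norm_on G (edges G) (?\<Gamma> f)" for f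
    by (rule descend_L2_norm[OF G v0])
  show "edge_functions.subspace ?Y"
    by (rule edge_functions.subspaceI)
      (auto simp: supported_def equivariant_def cscale_def algebra_simps simp del: cover_simps pi1_simps)
  show "inj_on ?\<Gamma> ?Y"
  proof (rule inj_onI, intro ext)
    fix f g \<epsilon> x assume f: "f \<in> ?Y" and g: "g \<in> ?Y" and eq: "?\<Gamma> f = ?\<Gamma> g"
    show "f \<epsilon> x = g \<epsilon> x"
    proof (cases "\<epsilon> \<in> edges ?cov \<and> x \<in> {0..len ?cov \<epsilon>}")
      case True
      then have "\<epsilon> \<in> edges ?cov" by simp
      then obtain p e where p: "\<epsilon> = (hclass G v0 p, e)" "e \<in> edges G" "walk G v0 p (tail G e)"
        by (rule cover_edgeE)
      have x: "x \<in> {0..len G e}" using True p by simp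
      have "lifts G v0 \<alpha> f (?\<Gamma> f)" "lifts G v0 \<alpha> g (?\<Gamma> f)"
        using lifts_descend[OF G v0, of \<alpha> f] lifts_descend[OF G v0, of \<alpha> g] f g eq by auto
      then show ?thesis using p x unfolding lifts_def p(1) by metis
    next
      case False
      have "f \<epsilon> x = 0" "g \<epsilon> x = 0" using f g False unfolding supported_def by blast+
      then show ?thesis by simp
    qed
  qed
  have supp: "supported G (?\<Gamma> f)" for f by (auto simp: supported_def descend_def)
  show "0 \<in> equivariant_smooth G v0 ?\<psi>"
    using smooth_on_edge_zero by (auto simp: equivariant_smooth_def supported_def equivariant_def simp del: cover_simps pi1_simps)
  have smoothX: "smooth_on_edge (len G e) (?\<Gamma> h e)" if "h \<in> equivariant_smooth G v0 ?\<psi>" "e \<in> edges G" for h e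
    by (rule descend_smooth[OF G v0 that(2)]) (use that(1) in \<open>simp add: equivariant_smooth_def\<close>)
  show "square_integrable (len G e) (?\<Gamma> h e)" if "h \<in> equivariant_smooth G v0 ?\<psi>" "e \<in> edges G" for h e
    by (rule square_integrable_continuous[OF smooth_on_edge_continuous[OF smoothX[OF that]]])
  have laplace: "?\<Gamma> (std_laplacian ?cov f) e x = - edge_deriv (len G e) (edge_deriv (len G e) (u e)) x"
    if "lifts G v0 \<alpha> f u" "\<And>e. e \<in> edges G \<Longrightarrow> smooth_on_edge (len G e) (u e)" "e \<in> edges G" "x \<in> {0..len G e}" for f u e x
  proof -
    let ?k = "\<lambda>e x. if e \<in> edges G \<and> x \<in> {0..len G e} then - edge_deriv (len G e) (edge_deriv (len G e) (u e)) x else 0"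
    have "lifts G v0 \<alpha> (std_laplacian ?cov f) ?k"
      using lifts_std_laplacian[OF G v0 that(1,2)] unfolding lifts_def by auto
    moreover have "supported G ?k" by (simp add: supported_def)
    ultimately have "?\<Gamma> (std_laplacian ?cov f) = ?k" by (rule descend_lifts[OF G v0])
    then show ?thesis using that(3,4) by simp
  qed
  show "f \<in> ?Y \<and> supported G (?\<Gamma> f) \<and> (\<forall>e\<in>edges G. square_integrable (len G e) (?\<Gamma> g e)) \<and>
      (\<exists>u'. twisted_solution G ?w 0 (?\<Gamma> f) u' (?\<Gamma> g))"
    if T: "(f, g) \<in> (\<lambda>f. (f, std_laplacian ?cov f)) ` Lambda0 G v0 ?\<psi>" for f g
  proof -
    have g: "g = std_laplacian ?cov f" and f: "f \<in> zero_forms ?cov" "equivariant G v0 ?\<psi> f"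
      using T by (auto simp: Lambda0_def)
    note li = lifts_descend[OF G v0 f(2)]
    have sm: "smooth_on_edge (len G e) (?\<Gamma> f e)" if "e \<in> edges G" for e
      by (rule descend_smooth[OF G v0 that]) (use f(1) in \<open>simp add: zero_forms_def\<close>)
    let ?u' = "\<lambda>e. edge_deriv (len G e) (?\<Gamma> f e)"
    have k: "?\<Gamma> g e x = - edge_deriv (len G e) (?u' e) x" if "e \<in> edges G" "x \<in> {0..len G e}" for e x
      unfolding g by (rule laplace[OF li sm that])
    have es: "edge_solution (len G e) 0 (?\<Gamma> f e) (?u' e) (?\<Gamma> g e)" if e: "e \<in> edges G" for e
      by (rule edge_solution_cong[OF edge_solution_smooth[OF L[OF e] sm[OF e]]]) (use k[OF e] in auto)
    have "vertex_conditions G ?w (at_dart G (?\<Gamma> f)) (at_dart G ?u')"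
      using lifts_vertex_conditions[OF G v0 li sm] f(1) by (simp add: zero_forms_def)
    then have "twisted_solution G ?w 0 (?\<Gamma> f) ?u' (?\<Gamma> g)" using es by (simp add: twisted_solution_def)
    moreover have "square_integrable (len G e) (?\<Gamma> g e)" if e: "e \<in> edges G" for e
    proof -
      have "smooth_on_edge (len G e) (edge_deriv (len G e) (?u' e))"
        by (intro smooth_edge_deriv(2) L sm e)
      then have "continuous_on {0..len G e} (\<lambda>x. - edge_deriv (len G e) (?u' e) x)"
        by (intro continuous_intros smooth_on_edge_continuous)
      from square_integrable_continuous[OF this] show ?thesis
        by (rule square_integrable_cong) (simp add: k[OF e])
    qed
    ultimately show ?thesis using supp f by (auto simp: zero_forms_def)
  qed
  show "\<exists>(f, g)\<in>(\<lambda>f. (f, std_laplacian ?cov f)) ` Lambda0 G v0 ?\<psi>. ?\<Gamma> f = u \<and> ?\<Gamma> g = cscale z u + ?\<Gamma> h"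
    if h: "h \<in> equivariant_smooth G v0 ?\<psi>" and u: "supported G u"
      and sol: "twisted_solution G ?w z u u' (?\<Gamma> h)" for z h u u'
  proof -
    define f where "f = (\<lambda>(X, e) x. if (X, e) \<in> edges ?cov \<and> x \<in> {0..len G e}
      then character_of (class_integral G \<alpha> X) * u e x else 0)"
    have es: "edge_solution (len G e) z (u e) (u' e) (?\<Gamma> h e)" if "e \<in> edges G" for e
      using sol that by (simp add: twisted_solution_def)
    have sm: "smooth_on_edge (len G e) (u e)" if "e \<in> edges G" for e
      by (rule edge_solution_smooth_source[OF es[OF that] smoothX[OF h that]])
    have li: "lifts G v0 \<alpha> f u"
      by (auto simp: lifts_def f_def cover_edge_iff class_integral_hclass)
    have ed: "edge_deriv (len G e) (u e) x = u' e x" if "e \<in> edges G" "x \<in> {0..len G e}" for e x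
      by (rule edge_deriv_eq[OF L[OF that(1)] that(2) edge_solution_derivs(1)[OF es[OF that(1)] that(2)]])
    have ed2: "edge_deriv (len G e) (edge_deriv (len G e) (u e)) x = - z * u e x - ?\<Gamma> h e x"
      if e: "e \<in> edges G" and x: "x \<in> {0..len G e}" for e x
    proof (rule edge_deriv_eq[OF L[OF e] x], rule has_vector_derivative_transform[OF x ed[OF e]])
      show "(u' e has_vector_derivative - z * u e x - ?\<Gamma> h e x) (at x within {0..len G e})"
        by (rule edge_solution_derivs(2)[OF es[OF e] x smooth_on_edge_continuous[OF smoothX[OF h e]]])
    qed
    have "vertex_conditions G ?w (at_dart G u) (at_dart G (\<lambda>e. edge_deriv (len G e) (u e)))"
    proof (rule vertex_conditions_cong)
      show "vertex_conditions G ?w (at_dart G u) (at_dart G u')" using sol by (simp add: twisted_solution_def)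
      fix d assume d: "d \<in> darts G"
      then have "fst d \<in> edges G" by auto
      from ed[OF this end_point_mem[OF G d]]
      show "at_dart G u' d = at_dart G (\<lambda>e. edge_deriv (len G e) (u e)) d" by (simp add: at_dart_def)
    qed simp
    then have vc: "continuous_at_vertices ?cov f" "kirchhoff ?cov f"
      using lifts_vertex_conditions[OF G v0 li sm] by auto
    have "smooth_on_edge (len ?cov \<epsilon>) (f \<epsilon>)" if \<epsilon>: "\<epsilon> \<in> edges ?cov" for \<epsilon>
    proof -
      obtain p e where p: "\<epsilon> = (hclass G v0 p, e)" "e \<in> edges G" "walk G v0 p (tail G e)"
        using cover_edgeE[OF \<epsilon>] .
      have "smooth_on_edge (len G e) (f \<epsilon>)"
        by (rule smooth_scaled(1)[OF L[OF p(2)] sm[OF p(2)], of _ "character_of (walk_integral G \<alpha> p)"])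
          (use li p in \<open>simp add: lifts_def\<close>)
      then show ?thesis by (simp add: p(1))
    qed
    moreover have "supported ?cov f" by (auto simp: supported_def f_def)
    ultimately have fL: "f \<in> Lambda0 G v0 ?\<psi>"
      using vc lifts_equivariant[OF G v0 li] by (simp add: Lambda0_def zero_forms_def)
    have "?\<Gamma> (std_laplacian ?cov f) e x = (cscale z u + ?\<Gamma> h) e x" for e x
    proof (cases "e \<in> edges G \<and> x \<in> {0..len G e}")
      case True
      then show ?thesis using laplace[OF li sm, of e x] ed2[of e x] by (simp add: cscale_def)
    next
      case False
      then have "u e x = 0" "?\<Gamma> h e x = 0" "?\<Gamma> (std_laplacian ?cov f) e x = 0"
        using u supp unfolding supported_def by blast+
      then show ?thesis by (simp add: cscale_def)
    qed
    then have "?\<Gamma> (std_laplacian ?cov f) = cscale z u + ?\<Gamma> h" by (intro ext)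
    then show ?thesis
      using fL descend_lifts[OF G v0 li u] by (intro bexI[of _ "(f, std_laplacian ?cov f)"]) auto
  qed
qed

text \<open>
  The weights of the two problems are complex conjugates of each other.
\<close>

theorem pi1_spectrum_eq_Spec_form:
  fixes G :: "('v, 'e) metric_graph"
  assumes G: "quantum_graph G" and v0: "v0 \<in> verts G" and \<alpha>: "\<alpha> \<in> one_forms G"
  shows "pi1_spectrum G v0 (form_character G v0 \<alpha>) = Spec_form G \<alpha>"
proof -
  have w: "bloch_weight G \<alpha> = (\<lambda>d. cnj (cover_weight G \<alpha> d))" by (rule ext) (rule bloch_weight_eq_cnj)
  note conj = twisted_eigenspace_cnj_weights[where w = "cover_weight G \<alpha>", OF G norm_cover_weight]
  have "\<not> twisted_eigenspace G (\<lambda>d. cnj (cover_weight G \<alpha> d)) z \<subseteq> {0} \<and>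
      m = vector_space.dim cscale (twisted_eigenspace G (\<lambda>d. cnj (cover_weight G \<alpha> d)) z) \<longleftrightarrow>
    \<not> twisted_eigenspace G (cover_weight G \<alpha>) z \<subseteq> {0} \<and>
      m = vector_space.dim cscale (twisted_eigenspace G (cover_weight G \<alpha>) z)" for z m
    using conj(1)[of z] conj(2)[of z] by metis
  then show ?thesis
    unfolding pi1_spectrum_eq_twisted[OF G v0] Spec_form_eq_twisted[OF G \<alpha>] w by simp
qed

section \<open>Classes of 1-forms\<close>

lemma smooth_on_edge_add:
  assumes "smooth_on_edge L f" "smooth_on_edge L g"
  shows "smooth_on_edge L (f + g)"
proof -
  obtain D where D: "\<And>x. x \<in> {0..L} \<Longrightarrow> D 0 x = f x"
    "\<And>n x. x \<in> {0..L} \<Longrightarrow> (D n has_vector_derivative D (Suc n) x) (at x within {0..L})"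
    using assms(1) unfolding smooth_on_edge_def by blast
  obtain D' where D': "\<And>x. x \<in> {0..L} \<Longrightarrow> D' 0 x = g x"
    "\<And>n x. x \<in> {0..L} \<Longrightarrow> (D' n has_vector_derivative D' (Suc n) x) (at x within {0..L})"
    using assms(2) unfolding smooth_on_edge_def by blast
  show ?thesis
    unfolding smooth_on_edge_def
    by (rule exI[of _ "\<lambda>n x. D n x + D' n x"]) (auto simp: D(1) D'(1) intro!: has_vector_derivative_add D(2) D'(2))
qed

lemma smooth_on_edge_minus:
  assumes "smooth_on_edge L f"
  shows "smooth_on_edge L (- f)"
proof -
  obtain D where D: "\<And>x. x \<in> {0..L} \<Longrightarrow> D 0 x = f x"
    "\<And>n x. x \<in> {0..L} \<Longrightarrow> (D n has_vector_derivative D (Suc n) x) (at x within {0..L})"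
    using assms(1) unfolding smooth_on_edge_def by blast
  show ?thesis
    unfolding smooth_on_edge_def
    by (rule exI[of _ "\<lambda>n x. - D n x"]) (auto simp: D(1) intro!: has_vector_derivative_minus D(2))
qed

lemma one_forms_add:
  assumes "\<alpha> \<in> one_forms G" "\<beta> \<in> one_forms G"
  shows "\<alpha> + \<beta> \<in> one_forms G"
  unfolding one_forms_def
proof (intro CollectI conjI ballI)
  show "supported G (\<alpha> + \<beta>)" using assms by (auto simp: one_forms_def supported_def)
  show "smooth_on_edge (len G e) ((\<alpha> + \<beta>) e)" if "e \<in> edges G" for e
    using assms that smooth_on_edge_add[of "len G e" "\<alpha> e" "\<beta> e"] by (simp add: one_forms_def plus_fun_def)
  show "(\<Sum>d\<in>darts_at G v. normal_sign d * (\<alpha> + \<beta>) (fst d) (end_point G d)) = 0" if "v \<in> verts G" for v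
    using assms that by (simp add: one_forms_def distrib_left sum.distrib)
qed

lemma one_forms_minus:
  assumes "\<alpha> \<in> one_forms G"
  shows "- \<alpha> \<in> one_forms G"
  unfolding one_forms_def
proof (intro CollectI conjI ballI)
  show "supported G (- \<alpha>)" using assms by (auto simp: one_forms_def supported_def)
  show "smooth_on_edge (len G e) ((- \<alpha>) e)" if "e \<in> edges G" for e
    using assms that smooth_on_edge_minus[of "len G e" "\<alpha> e"] by (simp add: one_forms_def fun_Compl_def)
  show "(\<Sum>d\<in>darts_at G v. normal_sign d * (- \<alpha>) (fst d) (end_point G d)) = 0" if "v \<in> verts G" for v
    using assms that by (simp add: one_forms_def sum_negf)
qed

lemma one_forms_diff: "\<alpha> \<in> one_forms G \<Longrightarrow> \<beta> \<in> one_forms G \<Longrightarrow> \<alpha> - \<beta> \<in> one_forms G"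
  using one_forms_add[OF _ one_forms_minus, of \<alpha> G \<beta>] by simp

lemma exact_forms_zero: 
  assumes G: "quantum_graph G"
  shows "0 \<in> exact_forms G"
proof -
  have d0: "edge_deriv (len G e) (\<lambda>x. 0 :: real) x = 0" if "e \<in> edges G" "x \<in> {0..len G e}" for e x
    by (rule edge_deriv_eq[OF quantum_graph_len_pos[OF G that(1)] that(2) has_vector_derivative_const])
  have "(0 :: 'b \<Rightarrow> real \<Rightarrow> real) \<in> zero_forms G"
    unfolding zero_forms_def
  proof (intro CollectI conjI ballI)
    show "kirchhoff G (0 :: 'b \<Rightarrow> real \<Rightarrow> real)"
      unfolding kirchhoff_def
    proof (intro ballI sum.neutral)
      fix v d assume "d \<in> darts_at G v"
      then have "fst d \<in> edges G" "d \<in> darts G" by (auto simp: darts_at_eq)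
      then show "normal_sign d *\<^sub>R edge_deriv (len G (fst d)) ((0 :: 'b \<Rightarrow> real \<Rightarrow> real) (fst d)) (end_point G d) = 0"
        using d0[of "fst d"] end_point_mem[OF G] by (simp add: zero_fun_def)
    qed
  qed (use smooth_on_edge_zero in \<open>auto simp: supported_def continuous_at_vertices_def\<close>)
  moreover have "ext_d G (0 :: 'b \<Rightarrow> real \<Rightarrow> real) = 0"
    by (intro ext) (use d0 in \<open>simp add: ext_d_def zero_fun_def\<close>)
  ultimately show ?thesis unfolding exact_forms_def by (metis imageI)
qed

lemma edge_deriv_add:
  fixes f g :: "real \<Rightarrow> real"
  assumes L: "0 < L" and f: "smooth_on_edge L f" and g: "smooth_on_edge L g" and x: "x \<in> {0..L}"
  shows "edge_deriv L (f + g) x = edge_deriv L f x + edge_deriv L g x"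
  unfolding plus_fun_def
  by (rule edge_deriv_eq[OF L x has_vector_derivative_add[OF smooth_edge_deriv(1)[OF L f x] smooth_edge_deriv(1)[OF L g x]]])

lemma exact_forms_add:
  assumes G: "quantum_graph G" and "\<eta> \<in> exact_forms G" "\<theta> \<in> exact_forms G"
  shows "\<eta> + \<theta> \<in> exact_forms G"
proof -
  obtain f g where f: "f \<in> zero_forms G" "\<eta> = ext_d G f" and g: "g \<in> zero_forms G" "\<theta> = ext_d G g"
    using assms by (auto simp: exact_forms_def)
  have sm: "smooth_on_edge (len G e) (f e)" "smooth_on_edge (len G e) (g e)" if "e \<in> edges G" for e
    using f g that by (auto simp: zero_forms_def)
  have d: "edge_deriv (len G e) ((f + g) e) x = edge_deriv (len G e) (f e) x + edge_deriv (len G e) (g e) x"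
    if "e \<in> edges G" "x \<in> {0..len G e}" for e x
    using edge_deriv_add[OF quantum_graph_len_pos[OF G that(1)] sm[OF that(1)] that(2)] by (simp add: plus_fun_def)
  have "f + g \<in> zero_forms G"
    unfolding zero_forms_def
  proof (intro CollectI conjI ballI)
    show "supported G (f + g)" using f g by (auto simp: zero_forms_def supported_def)
    show "smooth_on_edge (len G e) ((f + g) e)" if "e \<in> edges G" for e
      using smooth_on_edge_add[OF sm[OF that]] by (simp add: plus_fun_def)
    show "continuous_at_vertices G (f + g)"
      unfolding continuous_at_vertices_def
    proof
      fix v assume v: "v \<in> verts G"
      obtain a b where "\<forall>d\<in>darts_at G v. f (fst d) (end_point G d) = a" "\<forall>d\<in>darts_at G v. g (fst d) (end_point G d) = b"
        using f(1) g(1) v unfolding zero_forms_def continuous_at_vertices_def by blast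
      then show "\<exists>c. \<forall>d\<in>darts_at G v. (f + g) (fst d) (end_point G d) = c" by (intro exI[of _ "a + b"]) simp
    qed
    show "kirchhoff G (f + g)"
      unfolding kirchhoff_def
    proof
      fix v assume v: "v \<in> verts G"
      have "(\<Sum>d\<in>darts_at G v. normal_sign d *\<^sub>R edge_deriv (len G (fst d)) ((f + g) (fst d)) (end_point G d))
        = (\<Sum>d\<in>darts_at G v. normal_sign d *\<^sub>R edge_deriv (len G (fst d)) (f (fst d)) (end_point G d)
            + normal_sign d *\<^sub>R edge_deriv (len G (fst d)) (g (fst d)) (end_point G d))"
      proof (rule sum.cong[OF HOL.refl])
        fix d assume "d \<in> darts_at G v"
        then have "fst d \<in> edges G" "d \<in> darts G" by (auto simp: darts_at_eq)
        then show "normal_sign d *\<^sub>R edge_deriv (len G (fst d)) ((f + g) (fst d)) (end_point G d)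
          = normal_sign d *\<^sub>R edge_deriv (len G (fst d)) (f (fst d)) (end_point G d)
            + normal_sign d *\<^sub>R edge_deriv (len G (fst d)) (g (fst d)) (end_point G d)"
          using d[OF _ end_point_mem[OF G]] by (simp add: distrib_left del: plus_fun_apply)
      qed
      then show "(\<Sum>d\<in>darts_at G v. normal_sign d *\<^sub>R edge_deriv (len G (fst d)) ((f + g) (fst d)) (end_point G d)) = 0"
        using f(1) g(1) v by (simp add: zero_forms_def kirchhoff_def sum.distrib)
    qed
  qed
  moreover have "ext_d G (f + g) = \<eta> + \<theta>"
    by (intro ext) (use d in \<open>simp add: ext_d_def f(2) g(2) del: plus_fun_apply, simp\<close>)
  ultimately show ?thesis unfolding exact_forms_def by (metis imageI)
qed

text \<open>
  The integral of \<open>d f\<close> along a dart is the difference of the values of \<open>f\<close> at the two vertices, which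
  exist by continuity; along a closed walk the differences telescope.
\<close>

lemma exact_forms_closed_walk:
  assumes G: "quantum_graph G" and \<eta>: "\<eta> \<in> exact_forms G" and p: "walk G v p v"
  shows "walk_integral G \<eta> p = 0"
proof -
  obtain f where f: "f \<in> zero_forms G" "\<eta> = ext_d G f" using \<eta> by (auto simp: exact_forms_def)
  have "\<forall>v\<in>verts G. \<exists>c. \<forall>d\<in>darts_at G v. f (fst d) (end_point G d) = c"
    using f(1) unfolding zero_forms_def continuous_at_vertices_def by blast
  from bchoice[OF this] obtain c where c: "\<And>v d. v \<in> verts G \<Longrightarrow> d \<in> darts_at G v \<Longrightarrow> f (fst d) (end_point G d) = c v"
    by blast
  have edge: "integral {0..len G e} (\<eta> e) = f e (len G e) - f e 0" if e: "e \<in> edges G" for e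
  proof -
    have "(edge_deriv (len G e) (f e) has_integral f e (len G e) - f e 0) {0..len G e}"
      using quantum_graph_len_pos[OF G e] f(1) e
      by (intro fundamental_theorem_of_calculus smooth_edge_deriv(1)) (auto simp: zero_forms_def)
    then have "(\<eta> e has_integral f e (len G e) - f e 0) {0..len G e}"
      by (rule has_integral_eq[rotated]) (simp add: f(2) ext_d_def e)
    then show ?thesis by (rule integral_unique)
  qed
  have dart: "dart_integral G \<eta> d = c (dart_end G d) - c u" if d: "d \<in> darts_at G u" for d u
  proof -
    obtain e b where eb: "d = (e, b)" "e \<in> edges G" using d by (cases d) (auto simp: darts_at_def)
    have t: "f e 0 = c (tail G e)" and h: "f e (len G e) = c (head G e)"
      using c[of "tail G e" "(e, True)"] c[of "head G e" "(e, False)"] eb(2) G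
      by (auto simp: darts_at_def end_point_def quantum_graph_def)
    show ?thesis using d t h edge[OF eb(2)] by (cases b) (auto simp: eb(1) dart_integral_def dart_end_def darts_at_def)
  qed
  have "walk_integral G \<eta> p = c w - c u" if "walk G u p w" for u p w
    using that by (induction p arbitrary: u) (auto simp: dart)
  from this[OF p] show ?thesis by simp
qed

lemma walk_integral_add:
  assumes \<alpha>: "\<alpha> \<in> one_forms G" and \<beta>: "\<beta> \<in> one_forms G" and p: "walk G u p v"
  shows "walk_integral G (\<alpha> + \<beta>) p = walk_integral G \<alpha> p + walk_integral G \<beta> p"
proof -
  have "dart_integral G (\<alpha> + \<beta>) d = dart_integral G \<alpha> d + dart_integral G \<beta> d" if "fst d \<in> edges G" for d
  proof -
    have "\<alpha> (fst d) integrable_on {0..len G (fst d)}" "\<beta> (fst d) integrable_on {0..len G (fst d)}"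
      using \<alpha> \<beta> that by (auto simp: one_forms_def intro!: integrable_continuous_real smooth_on_edge_continuous)
    then have "integral {0..len G (fst d)} ((\<alpha> + \<beta>) (fst d)) = integral {0..len G (fst d)} (\<alpha> (fst d)) + integral {0..len G (fst d)} (\<beta> (fst d))"
      using Henstock_Kurzweil_Integration.integral_add[of "\<alpha> (fst d)" "{0..len G (fst d)}" "\<beta> (fst d)"]
      by (simp add: plus_fun_def)
    then show ?thesis by (simp add: dart_integral_def)
  qed
  then show ?thesis using p by (induction p arbitrary: u) (auto simp: darts_at_def)
qed

lemma walk_integral_uminus: "walk_integral G (- \<alpha>) p = - walk_integral G \<alpha> p"
proof -
  have "dart_integral G (- \<alpha>) d = - dart_integral G \<alpha> d" for d
    by (simp add: dart_integral_def fun_Compl_def)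
  then show ?thesis by (induction p) auto
qed

definition integral_forms :: "('v, 'e) metric_graph \<Rightarrow> ('e \<Rightarrow> real \<Rightarrow> real) set" where
  "integral_forms G = {\<alpha> \<in> one_forms G. \<forall>v p. walk G v p v \<longrightarrow> walk_integral G \<alpha> p \<in> \<int>}"

lemma H1_class_eq: "H1_class G \<alpha> = {\<eta> + \<alpha> | \<eta>. \<eta> \<in> exact_forms G}"
  by (auto simp: H1_class_def r_coset_def one_form_group_def)

lemma carrier_H1_dR: "carrier (H1_dR G) = H1_class G ` one_forms G"
  by (auto simp: H1_dR_def FactGroup_def RCOSETS_def H1_class_def one_form_group_def)

lemma carrier_H1_torus: "carrier (H1_torus G) = torus_class G ` one_forms G"
  unfolding H1_torus_def FactGroup_def RCOSETS_def torus_class_def by (auto simp: carrier_H1_dR)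

lemma exact_forms_subset: 
  assumes G: "quantum_graph G"
  shows "exact_forms G \<subseteq> one_forms G"
proof
  fix \<eta> assume "\<eta> \<in> exact_forms G"
  then obtain f where f: "f \<in> zero_forms G" "\<eta> = ext_d G f" by (auto simp: exact_forms_def)
  have eq: "\<eta> e x = edge_deriv (len G e) (f e) x" if "e \<in> edges G" "x \<in> {0..len G e}" for e x
    using that by (simp add: f(2) ext_d_def)
  show "\<eta> \<in> one_forms G"
    unfolding one_forms_def
  proof (intro CollectI conjI ballI)
    show "supported G \<eta>" by (auto simp: f(2) supported_def ext_d_def)
    fix e assume e: "e \<in> edges G"
    have "smooth_on_edge (len G e) (edge_deriv (len G e) (f e))"
      using f(1) e quantum_graph_len_pos[OF G e] by (intro smooth_edge_deriv(2)) (auto simp: zero_forms_def)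
    then show "smooth_on_edge (len G e) (\<eta> e)" unfolding smooth_on_edge_def using eq[OF e] by simp
  next
    fix v assume v: "v \<in> verts G"
    have "(\<Sum>d\<in>darts_at G v. normal_sign d * \<eta> (fst d) (end_point G d))
      = (\<Sum>d\<in>darts_at G v. normal_sign d *\<^sub>R edge_deriv (len G (fst d)) (f (fst d)) (end_point G d))"
    proof (rule sum.cong[OF HOL.refl])
      fix d assume "d \<in> darts_at G v"
      then have "fst d \<in> edges G" "d \<in> darts G" by (auto simp: darts_at_eq)
      then show "normal_sign d * \<eta> (fst d) (end_point G d) = normal_sign d *\<^sub>R edge_deriv (len G (fst d)) (f (fst d)) (end_point G d)"
        using eq[OF _ end_point_mem[OF G]] by simp
    qed
    then show "(\<Sum>d\<in>darts_at G v. normal_sign d * \<eta> (fst d) (end_point G d)) = 0"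
      using f(1) v by (simp add: zero_forms_def kirchhoff_def)
  qed
qed

lemma integral_forms_exact_add:
  assumes G: "quantum_graph G" and \<eta>: "\<eta> \<in> exact_forms G" and \<alpha>: "\<alpha> \<in> one_forms G"
  shows "\<eta> + \<alpha> \<in> integral_forms G \<longleftrightarrow> \<alpha> \<in> integral_forms G"
proof -
  have \<eta>1: "\<eta> \<in> one_forms G" using exact_forms_subset[OF G] \<eta> by blast
  show ?thesis
    using walk_integral_add[OF \<eta>1 \<alpha>] exact_forms_closed_walk[OF G \<eta>] one_forms_add[OF \<eta>1 \<alpha>] \<alpha>
    by (auto simp: integral_forms_def)
qed

lemma H1_dR_int_eq:
  assumes G: "quantum_graph G"
  shows "H1_dR_int G = H1_class G ` integral_forms G"
proof (intro equalityI subsetI)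
  fix c assume c: "c \<in> H1_dR_int G"
  then obtain \<alpha> where \<alpha>: "\<alpha> \<in> one_forms G" "c = H1_class G \<alpha>" by (auto simp: H1_dR_int_def carrier_H1_dR)
  have "0 + \<alpha> \<in> c" using exact_forms_zero[OF G] unfolding \<alpha>(2) H1_class_eq by blast
  then have "\<alpha> \<in> integral_forms G" using c \<alpha>(1) by (auto simp: H1_dR_int_def integral_forms_def)
  then show "c \<in> H1_class G ` integral_forms G" using \<alpha>(2) by blast
next
  fix c assume "c \<in> H1_class G ` integral_forms G"
  then obtain \<alpha> where \<alpha>: "\<alpha> \<in> integral_forms G" "c = H1_class G \<alpha>" by blast
  then have \<alpha>1: "\<alpha> \<in> one_forms G" by (simp add: integral_forms_def)
  have "\<beta> \<in> integral_forms G" if "\<beta> \<in> c" for \<beta>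
    using that integral_forms_exact_add[OF G _ \<alpha>1] \<alpha> by (auto simp: H1_class_eq)
  then show "c \<in> H1_dR_int G" using \<alpha>(2) \<alpha>1 by (auto simp: H1_dR_int_def carrier_H1_dR integral_forms_def)
qed

lemma H1_class_add:
  assumes G: "quantum_graph G"
  shows "H1_class G \<alpha> <#>\<^bsub>one_form_group G\<^esub> H1_class G \<beta> = H1_class G (\<alpha> + \<beta>)"
proof (intro equalityI subsetI)
  fix \<gamma> assume "\<gamma> \<in> H1_class G \<alpha> <#>\<^bsub>one_form_group G\<^esub> H1_class G \<beta>"
  then obtain \<eta> \<theta> where "\<eta> \<in> exact_forms G" "\<theta> \<in> exact_forms G" "\<gamma> = (\<eta> + \<alpha>) + (\<theta> + \<beta>)"
    by (auto simp: set_mult_def one_form_group_def H1_class_eq)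
  moreover have "(\<eta> + \<alpha>) + (\<theta> + \<beta>) = (\<eta> + \<theta>) + (\<alpha> + \<beta>)" for \<eta> \<theta> :: "'b \<Rightarrow> real \<Rightarrow> real"
    by (simp add: algebra_simps)
  ultimately show "\<gamma> \<in> H1_class G (\<alpha> + \<beta>)" using exact_forms_add[OF G] unfolding H1_class_eq by blast
next
  fix \<gamma> assume "\<gamma> \<in> H1_class G (\<alpha> + \<beta>)"
  then obtain \<eta> where \<eta>: "\<eta> \<in> exact_forms G" "\<gamma> = \<eta> + (\<alpha> + \<beta>)" by (auto simp: H1_class_eq)
  have "\<eta> + \<alpha> \<in> H1_class G \<alpha>" "0 + \<beta> \<in> H1_class G \<beta>"
    using \<eta>(1) exact_forms_zero[OF G] unfolding H1_class_eq by blast+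
  moreover have "\<gamma> = (\<eta> + \<alpha>) + (0 + \<beta>)" using \<eta>(2) by (simp add: add.assoc)
  ultimately show "\<gamma> \<in> H1_class G \<alpha> <#>\<^bsub>one_form_group G\<^esub> H1_class G \<beta>"
    unfolding set_mult_def one_form_group_def by auto
qed

lemma torus_class_eq:
  assumes G: "quantum_graph G"
  shows "torus_class G \<alpha> = {H1_class G (\<beta> + \<alpha>) | \<beta>. \<beta> \<in> integral_forms G}"
  by (auto simp: torus_class_def r_coset_def H1_dR_int_eq[OF G] H1_dR_def FactGroup_def H1_class_add[OF G])

lemma integral_forms_add:
  assumes "\<alpha> \<in> integral_forms G" "\<beta> \<in> integral_forms G"
  shows "\<alpha> + \<beta> \<in> integral_forms G"
  using assms walk_integral_add[of \<alpha> G \<beta>] one_forms_add[of \<alpha> G \<beta>] by (auto simp: integral_forms_def)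

lemma integral_forms_minus: "\<alpha> \<in> integral_forms G \<Longrightarrow> - \<alpha> \<in> integral_forms G"
  using one_forms_minus[of \<alpha> G] by (auto simp: integral_forms_def walk_integral_uminus)

text \<open>
  The torus class of \<open>\<alpha>\<close> consists of the classes of all \<open>\<beta> + \<alpha>\<close> with \<open>\<beta>\<close> of integral periods, and a
  class determines a form up to exact forms, which have zero periods.
\<close>

theorem torus_class_eq_iff:
  assumes G: "quantum_graph G" and \<alpha>: "\<alpha> \<in> one_forms G" and \<beta>: "\<beta> \<in> one_forms G"
  shows "torus_class G \<alpha> = torus_class G \<beta> \<longleftrightarrow> \<alpha> - \<beta> \<in> integral_forms G"
proof
  assume eq: "torus_class G \<alpha> = torus_class G \<beta>"
  have "0 \<in> integral_forms G"
    using exact_forms_subset[OF G] exact_forms_zero[OF G] exact_forms_closed_walk[OF G exact_forms_zero[OF G]]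
    by (auto simp: integral_forms_def)
  then have "H1_class G (0 + \<alpha>) \<in> torus_class G \<alpha>" unfolding torus_class_eq[OF G] by blast
  then have "H1_class G (0 + \<alpha>) \<in> torus_class G \<beta>" by (simp only: eq)
  then obtain \<gamma> where \<gamma>: "\<gamma> \<in> integral_forms G" "H1_class G (0 + \<alpha>) = H1_class G (\<gamma> + \<beta>)"
    unfolding torus_class_eq[OF G] by blast
  have "0 + (0 + \<alpha>) \<in> H1_class G (0 + \<alpha>)" using exact_forms_zero[OF G] unfolding H1_class_eq by blast
  then have "\<alpha> \<in> H1_class G (\<gamma> + \<beta>)" unfolding \<gamma>(2) by simp
  then obtain \<eta> where \<eta>: "\<eta> \<in> exact_forms G" "\<alpha> = \<eta> + (\<gamma> + \<beta>)" unfolding H1_class_eq by blast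
  then have "\<alpha> - \<beta> = \<eta> + \<gamma>" by (simp add: algebra_simps)
  then show "\<alpha> - \<beta> \<in> integral_forms G"
    using integral_forms_exact_add[OF G \<eta>(1), of \<gamma>] \<gamma>(1) by (simp add: integral_forms_def)
next
  have *: "torus_class G \<alpha> \<subseteq> torus_class G \<beta>" if "\<alpha> - \<beta> \<in> integral_forms G" for \<alpha> \<beta>
  proof
    fix c assume "c \<in> torus_class G \<alpha>"
    then obtain \<gamma> where \<gamma>: "\<gamma> \<in> integral_forms G" "c = H1_class G (\<gamma> + \<alpha>)" unfolding torus_class_eq[OF G] by blast
    have "\<gamma> + \<alpha> = (\<gamma> + (\<alpha> - \<beta>)) + \<beta>" by simp
    then have "c = H1_class G ((\<gamma> + (\<alpha> - \<beta>)) + \<beta>)" using \<gamma>(2) by (simp only:)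
    then show "c \<in> torus_class G \<beta>"
      unfolding torus_class_eq[OF G] using integral_forms_add[OF \<gamma>(1) that] by blast
  qed
  assume i: "\<alpha> - \<beta> \<in> integral_forms G"
  have "\<beta> - \<alpha> \<in> integral_forms G" using integral_forms_minus[OF i] by simp
  then show "torus_class G \<alpha> = torus_class G \<beta>" using *[OF i] *[of \<beta> \<alpha>] by blast
qed

section \<open>Unitary characters\<close>

lemma character_of_eq_iff: "character_of s = character_of t \<longleftrightarrow> s - t \<in> \<int>"
proof -
  have "character_of s = character_of t \<longleftrightarrow> character_of (s - t) = 1"
  proof -
    have "character_of (s - t) * character_of t = character_of s" by (simp flip: character_of_add)
    moreover have "character_of t \<noteq> 0" by (metis norm_character_of norm_zero zero_neq_one)
    ultimately show ?thesis by (metis mult_cancel_right1 mult_1)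
  qed
  also have "\<dots> \<longleftrightarrow> (\<exists>n::int. - 2 * pi * (s - t) = of_int (2 * n) * pi)"
    unfolding character_of_def exp_eq_1 by simp
  also have "\<dots> \<longleftrightarrow> (\<exists>n::int. s - t = of_int (- n))"
  proof (intro ex_cong1)
    fix n :: int
    have "- 2 * pi * (s - t) - of_int (2 * n) * pi = - 2 * pi * ((s - t) - of_int (- n))"
      by (simp add: algebra_simps)
    then have "- 2 * pi * (s - t) = of_int (2 * n) * pi \<longleftrightarrow> - 2 * pi * ((s - t) - of_int (- n)) = 0"
      by linarith
    then show "- 2 * pi * (s - t) = of_int (2 * n) * pi \<longleftrightarrow> s - t = of_int (- n)"
      by (simp add: eq_neg_iff_add_eq_0)
  qed
  also have "\<dots> \<longleftrightarrow> s - t \<in> \<int>" unfolding Ints_def by (metis (mono_tags, lifting) imageE minus_minus rangeI)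
  finally show ?thesis .
qed

text \<open>
  A closed walk at another vertex is conjugate to a closed walk at \<open>v0\<close> with the same integral.
\<close>

theorem form_character_eq_iff:
  assumes G: "quantum_graph G" and v0: "v0 \<in> verts G" and \<alpha>: "\<alpha> \<in> one_forms G" and \<beta>: "\<beta> \<in> one_forms G"
  shows "form_character G v0 \<alpha> = form_character G v0 \<beta> \<longleftrightarrow> \<alpha> - \<beta> \<in> integral_forms G"
proof -
  have diff: "walk_integral G (\<alpha> - \<beta>) p = walk_integral G \<alpha> p - walk_integral G \<beta> p" if "walk G u p v" for u p v
    using walk_integral_add[OF \<alpha> one_forms_minus[OF \<beta>] that] by (simp add: walk_integral_uminus)
  have "form_character G v0 \<alpha> = form_character G v0 \<beta> \<longleftrightarrow>
      (\<forall>\<gamma>\<in>carrier (pi1 G v0). form_character G v0 \<alpha> \<gamma> = form_character G v0 \<beta> \<gamma>)"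
    by (auto simp: fun_eq_iff form_character_def)
  also have "\<dots> \<longleftrightarrow> (\<forall>p. walk G v0 p v0 \<longrightarrow> form_character G v0 \<alpha> (hclass G v0 p) = form_character G v0 \<beta> (hclass G v0 p))"
    unfolding pi1_simps by blast
  also have "\<dots> \<longleftrightarrow> (\<forall>p. walk G v0 p v0 \<longrightarrow> walk_integral G (\<alpha> - \<beta>) p \<in> \<int>)"
    by (simp add: form_character_hclass character_of_eq_iff diff cong: imp_cong)
  also have "\<dots> \<longleftrightarrow> \<alpha> - \<beta> \<in> integral_forms G"
  proof
    assume i: "\<forall>p. walk G v0 p v0 \<longrightarrow> walk_integral G (\<alpha> - \<beta>) p \<in> \<int>"
    have "walk_integral G (\<alpha> - \<beta>) p \<in> \<int>" if p: "walk G v p v" for v p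
    proof -
      have "v \<in> verts G" using walk_verts[OF G p] by simp
      then obtain q where q: "walk G v0 q v" using G v0 unfolding quantum_graph_def by blast
      have "walk G v0 (q @ p @ rev_walk q) v0"
        by (rule walk_appendI[OF G q walk_appendI[OF G p walk_rev[OF G q]]])
      from i[rule_format, OF this] show ?thesis by simp
    qed
    then show "\<alpha> - \<beta> \<in> integral_forms G" using one_forms_diff[OF \<alpha> \<beta>] by (simp add: integral_forms_def)
  qed (simp add: integral_forms_def)
  finally show ?thesis .
qed

lemma form_character_unitary:
  assumes "\<gamma> \<in> carrier (pi1 G v0)"
  shows "cmod (form_character G v0 \<alpha> \<gamma>) = 1"
  using assms by (auto simp: form_character_hclass)

lemma form_character_in_characters:
  assumes G: "quantum_graph G" and v0: "v0 \<in> verts G"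
  shows "form_character G v0 \<alpha> \<in> characters G v0"
  unfolding characters_def
proof
  show "form_character G v0 \<alpha> \<in> hom (pi1 G v0) Cstar"
  proof (rule homI)
    fix \<gamma> assume "\<gamma> \<in> carrier (pi1 G v0)"
    from form_character_unitary[OF this, of \<alpha>] show "form_character G v0 \<alpha> \<gamma> \<in> carrier Cstar"
      by (auto simp: Cstar_def)
  next
    fix \<gamma> \<delta> assume "\<gamma> \<in> carrier (pi1 G v0)" "\<delta> \<in> carrier (pi1 G v0)"
    then obtain p q where pq: "\<gamma> = hclass G v0 p" "walk G v0 p v0" "\<delta> = hclass G v0 q" "walk G v0 q v0" by auto
    show "form_character G v0 \<alpha> (\<gamma> \<otimes>\<^bsub>pi1 G v0\<^esub> \<delta>) = form_character G v0 \<alpha> \<gamma> \<otimes>\<^bsub>Cstar\<^esub> form_character G v0 \<alpha> \<delta>"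
      using hconcat_hclass_hclass[OF G v0 pq(2,4)] walk_appendI[OF G pq(2,4)] pq
      by (simp add: form_character_hclass character_of_add Cstar_def)
  qed
  show "form_character G v0 \<alpha> \<in> extensional (carrier (pi1 G v0))" by (simp add: form_character_def)
qed

lemma character_of_surj:
  assumes "cmod c = 1"
  obtains t where "c = character_of t"
proof
  have "c = cis (Arg c)" using assms cis_Arg[of c] by (metis norm_zero sgn_eq zero_neq_one div_by_1 of_real_1)
  then show "c = character_of (- Arg c / (2 * pi))"
    by (simp add: character_of_def cis_conv_exp mult_ac)
qed

text \<open>
  A polynomial with integral \<open>1\<close> over \<open>[0, L]\<close> that vanishes at both ends.
\<close>

definition bump :: "real \<Rightarrow> real \<Rightarrow> real" where
  "bump L x = 6 / L ^ 3 * (x * (L - x))"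

lemma bump_ends [simp]: "bump L 0 = 0" "bump L L = 0"
  by (simp_all add: bump_def)

lemma bump_integral:
  assumes "0 < L"
  shows "integral {0..L} (\<lambda>x. t * bump L x) = t"
proof -
  have "((\<lambda>x. t * bump L x) has_integral (t / L ^ 3 * (3 * L * L\<^sup>2 - 2 * L ^ 3) - t / L ^ 3 * (3 * L * 0\<^sup>2 - 2 * 0 ^ 3))) {0..L}"
  proof (rule fundamental_theorem_of_calculus)
    fix x
    have "((\<lambda>x. t / L ^ 3 * (3 * L * x\<^sup>2 - 2 * x ^ 3)) has_real_derivative t * bump L x) (at x within {0..L})"
      using assms by (auto intro!: derivative_eq_intros simp: bump_def power2_eq_square field_simps power3_eq_cube)
    then show "((\<lambda>x. t / L ^ 3 * (3 * L * x\<^sup>2 - 2 * x ^ 3)) has_vector_derivative t * bump L x) (at x within {0..L})"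
      by (simp add: has_real_derivative_iff_has_vector_derivative)
  qed (use assms in auto)
  then have "((\<lambda>x. t * bump L x) has_integral t) {0..L}"
    using assms by (simp add: power2_eq_square power3_eq_cube field_simps)
  then show ?thesis by (rule integral_unique)
qed

lemma bump_smooth: "smooth_on_edge L (\<lambda>x. t * bump L x)"
proof -
  define c where "c = 6 * t / L ^ 3"
  define D :: "nat \<Rightarrow> real \<Rightarrow> real" where
    "D n x = c * (if n = 0 then x * (L - x) else if n = 1 then L - 2 * x else if n = 2 then - 2 else 0)" for n x
  have "(D n has_real_derivative D (Suc n) x) (at x within {0..L})" for n x
  proof -
    consider "n = 0" | "n = 1" | "n = 2" | "n > 2" by linarith
    then show ?thesis
      unfolding D_def[abs_def] by cases (auto intro!: derivative_eq_intros simp: field_simps)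
  qed
  then show ?thesis
    unfolding smooth_on_edge_def has_real_derivative_iff_has_vector_derivative
    by (intro exI[of _ D]) (auto simp: D_def c_def bump_def)
qed

text \<open>
  Choose a walk \<open>P v\<close> from \<open>v0\<close> to each vertex.  Then \<open>\<Psi> u p v\<close>, the value of \<open>\<psi>\<close> on \<open>p\<close> closed up by
  the chosen walks, is multiplicative in \<open>p\<close>, hence determined by its values on single edges.  These are
  of modulus \<open>1\<close> and prescribe the integrals of \<open>\<alpha>\<close> over the edges modulo \<open>\<int>\<close>.  The integral over an edge is
  spread out by \<open>bump\<close>, so that \<open>\<alpha>\<close> vanishes at all vertices and satisfies the vertex condition.
\<close>

theorem unitary_character_from_form:
  fixes G :: "('v, 'e) metric_graph"
  assumes G: "quantum_graph G" and v0: "v0 \<in> verts G" and \<psi>: "\<psi> \<in> characters G v0"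
    and unit: "\<And>\<gamma>. \<gamma> \<in> carrier (pi1 G v0) \<Longrightarrow> cmod (\<psi> \<gamma>) = 1"
  obtains \<alpha> where "\<alpha> \<in> one_forms G" "form_character G v0 \<alpha> = \<psi>"
proof -
  have mult: "\<psi> (hclass G v0 (p @ q)) = \<psi> (hclass G v0 p) * \<psi> (hclass G v0 q)"
    if "walk G v0 p v0" "walk G v0 q v0" for p q
  proof -
    have "\<psi> \<in> hom (pi1 G v0) Cstar" using \<psi> by (simp add: characters_def)
    then have "\<psi> (hclass G v0 p \<otimes>\<^bsub>pi1 G v0\<^esub> hclass G v0 q) = \<psi> (hclass G v0 p) \<otimes>\<^bsub>Cstar\<^esub> \<psi> (hclass G v0 q)"
      by (rule hom_mult) (use that in auto)
    then show ?thesis using hconcat_hclass_hclass[OF G v0 that] by (simp add: Cstar_def)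
  qed
  have nil: "walk G v0 [] v0" using v0 by simp
  have base: "hclass G v0 [] \<in> carrier (pi1 G v0)" unfolding pi1_simps using nil by blast
  have one: "\<psi> (hclass G v0 []) = 1"
  proof -
    have "\<psi> (hclass G v0 []) * \<psi> (hclass G v0 []) = \<psi> (hclass G v0 [])" using mult[OF nil nil] by simp
    moreover have "\<psi> (hclass G v0 []) \<noteq> 0" using unit[OF base] by auto
    ultimately show ?thesis by simp
  qed
  have "\<forall>v\<in>verts G. \<exists>p. walk G v0 p v" using G v0 by (auto simp: quantum_graph_def)
  from bchoice[OF this] obtain P' where P': "\<And>v. v \<in> verts G \<Longrightarrow> walk G v0 (P' v) v" by blast
  \<comment> \<open>the empty walk at \<open>v0\<close> makes \<open>\<Psi> v0 p v0\<close> the value of \<open>\<psi>\<close> on the class of \<open>p\<close> itself\<close>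
  define P where "P = P'(v0 := [])"
  have P: "walk G v0 (P v) v" if "v \<in> verts G" for v using P' that nil by (simp add: P_def)
  have P0: "P v0 = []" by (simp add: P_def)
  define \<Psi> where "\<Psi> u p v = \<psi> (hclass G v0 (P u @ p @ rev_walk (P v)))" for u p v
  have loop: "walk G v0 (P u @ p @ rev_walk (P v)) v0" if "walk G u p v" for u p v
    using walk_verts[OF G that] by (intro walk_appendI[OF G P walk_appendI[OF G that walk_rev[OF G P]]])
  have \<Psi>_append: "\<Psi> u (p @ q) w = \<Psi> u p v * \<Psi> v q w" if p: "walk G u p v" and q: "walk G v q w" for u p v q w
  proof -
    note vu = walk_verts[OF G p] walk_verts[OF G q]
    have up: "walk G v0 (P u @ p) v" by (rule walk_appendI[OF G P[OF vu(1)] p])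
    have qw: "walk G v (q @ rev_walk (P w)) v0" by (rule walk_appendI[OF G q walk_rev[OF G P[OF vu(4)]]])
    have "homotopic G v (rev_walk (P v) @ P v) []"
      using homotopic_rev_cancel[OF G walk_rev[OF G P[OF vu(2)]]] by simp
    from homotopic_append_right[OF G vu(2) this walk_appendI[OF G walk_rev[OF G P[OF vu(2)]] P[OF vu(2)]] qw]
    have "homotopic G v ((rev_walk (P v) @ P v) @ q @ rev_walk (P w)) ([] @ q @ rev_walk (P w))" .
    from homotopic_append_left[OF G this up]
    have "homotopic G v0 ((P u @ p @ rev_walk (P v)) @ (P v @ q @ rev_walk (P w))) (P u @ (p @ q) @ rev_walk (P w))"
      by simp
    then have "hclass G v0 ((P u @ p @ rev_walk (P v)) @ (P v @ q @ rev_walk (P w))) = hclass G v0 (P u @ (p @ q) @ rev_walk (P w))"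
      by (simp only: hclass_eq_iff[OF loop[OF walk_appendI[OF G p q]]])
    then show ?thesis unfolding \<Psi>_def using mult[OF loop[OF p] loop[OF q]] by simp
  qed
  have \<Psi>_nil: "\<Psi> u [] u = 1" if u: "u \<in> verts G" for u
  proof -
    have "hclass G v0 (P u @ rev_walk (P u)) = hclass G v0 []"
      using homotopic_rev_cancel[OF G P[OF u]] by (simp add: hclass_eq_iff[OF nil])
    then show ?thesis by (simp add: \<Psi>_def one)
  qed
  have \<Psi>_rev: "\<Psi> u [d] (dart_end G d) * \<Psi> (dart_end G d) [rev_dart d] u = 1" if d: "d \<in> darts_at G u" for u d
  proof -
    have u: "u \<in> verts G" using walk_verts(1)[OF G walk_single[OF G d]] .
    have d2: "walk G (dart_end G d) [rev_dart d] u"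
      using walk_single[OF G rev_dart_mem_darts_at[OF d]] d by (simp add: darts_at_def)
    have w: "walk G u [d, rev_dart d] u" using walk_appendI[OF G walk_single[OF G d] d2] by (simp del: walk.simps)
    have l: "walk G v0 (P u @ [d, rev_dart d] @ rev_walk (P u)) v0" by (rule loop[OF w])
    have "walk G v0 (P u @ rev_walk (P u)) v0" by (rule walk_appendI[OF G P[OF u] walk_rev[OF G P[OF u]]])
    then have "hclass G v0 (P u @ [d, rev_dart d] @ rev_walk (P u)) = hclass G v0 (P u @ rev_walk (P u))"
      by (subst hclass_eq_iff) (use homotopic.backtrack[OF l] in auto)
    then have "\<Psi> u [d, rev_dart d] u = \<Psi> u [] u" by (simp add: \<Psi>_def)
    then show ?thesis using \<Psi>_append[OF walk_single[OF G d] d2] \<Psi>_nil[OF u] by simp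
  qed
  have "\<exists>t. \<Psi> (tail G e) [(e, True)] (head G e) = character_of t" if e: "e \<in> edges G" for e
  proof -
    have "(e, True) \<in> darts_at G (tail G e)" using e by (simp add: darts_at_def)
    from walk_single[OF G this] have "walk G (tail G e) [(e, True)] (head G e)" by (simp add: dart_end_def)
    from loop[OF this] have "cmod (\<Psi> (tail G e) [(e, True)] (head G e)) = 1" unfolding \<Psi>_def by (intro unit) auto
    then show ?thesis using character_of_surj by metis
  qed
  then have "\<forall>e\<in>edges G. \<exists>t. \<Psi> (tail G e) [(e, True)] (head G e) = character_of t" by blast
  from bchoice[OF this] obtain t where t: "\<And>e. e \<in> edges G \<Longrightarrow> \<Psi> (tail G e) [(e, True)] (head G e) = character_of (t e)"
    by blast
  define \<alpha> where "\<alpha> e x = (if e \<in> edges G \<and> x \<in> {0..len G e} then t e * bump (len G e) x else 0)" for e x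
  have \<alpha>_form: "\<alpha> \<in> one_forms G"
    unfolding one_forms_def
  proof (intro CollectI conjI ballI)
    show "supported G \<alpha>" by (auto simp: supported_def \<alpha>_def)
    show "smooth_on_edge (len G e) (\<alpha> e)" if "e \<in> edges G" for e
      using bump_smooth[of "len G e" "t e"] that unfolding smooth_on_edge_def \<alpha>_def by simp
    show "(\<Sum>d\<in>darts_at G v. normal_sign d * \<alpha> (fst d) (end_point G d)) = 0" for v
      by (intro sum.neutral) (simp add: \<alpha>_def end_point_def)
  qed
  have \<alpha>_int: "integral {0..len G e} (\<alpha> e) = t e" if e: "e \<in> edges G" for e
  proof -
    have "integral {0..len G e} (\<alpha> e) = integral {0..len G e} (\<lambda>x. t e * bump (len G e) x)"
      by (rule Henstock_Kurzweil_Integration.integral_cong) (use e in \<open>simp add: \<alpha>_def\<close>)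
    then show ?thesis using bump_integral[OF quantum_graph_len_pos[OF G e]] by simp
  qed
  have dart: "\<Psi> u [d] (dart_end G d) = character_of (dart_integral G \<alpha> d)" if d: "d \<in> darts_at G u" for u d
  proof -
    obtain e b where eb: "d = (e, b)" "e \<in> edges G" using d by (cases d) (auto simp: darts_at_def)
    have tr: "\<Psi> (tail G e) [(e, True)] (head G e) = character_of (t e)" by (rule t[OF eb(2)])
    show ?thesis
    proof (cases b)
      case True
      then show ?thesis using d eb tr \<alpha>_int[OF eb(2)] by (auto simp: darts_at_def dart_end_def dart_integral_def)
    next
      case False
      then have "u = head G e" using d eb by (auto simp: darts_at_def)
      \<comment> \<open>a dart against its edge is the inverse of the edge\<close>
      then have "\<Psi> u [d] (dart_end G d) * character_of (t e) = 1"
        using \<Psi>_rev[OF d] tr False eb by (simp add: dart_end_def)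
      moreover have "character_of (t e) \<noteq> 0" by (metis norm_character_of norm_zero zero_neq_one)
      ultimately have "\<Psi> u [d] (dart_end G d) = character_of (- t e)"
        using character_of_uminus(1)[of "t e"] by (metis mult_right_cancel)
      then show ?thesis using False eb \<alpha>_int[OF eb(2)] by (simp add: dart_integral_def)
    qed
  qed
  have walk: "\<Psi> u p v = character_of (walk_integral G \<alpha> p)" if "walk G u p v" for u p v
    using that
  proof (induction p arbitrary: u)
    case Nil
    then show ?case using \<Psi>_nil by auto
  next
    case (Cons d p)
    then have d: "d \<in> darts_at G u" and p: "walk G (dart_end G d) p v" by auto
    show ?case using \<Psi>_append[OF walk_single[OF G d] p] dart[OF d] Cons.IH[OF p] by (simp add: character_of_add)
  qed
  have "form_character G v0 \<alpha> \<gamma> = \<psi> \<gamma>" if \<gamma>: "\<gamma> \<in> carrier (pi1 G v0)" for \<gamma>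
  proof -
    obtain p where p: "\<gamma> = hclass G v0 p" "walk G v0 p v0" using \<gamma> by auto
    show ?thesis using walk[OF p(2)] by (simp add: p(1) form_character_hclass[OF p(2)] \<Psi>_def P0)
  qed
  then have "form_character G v0 \<alpha> = \<psi>"
    using form_character_in_characters[OF G v0, of \<alpha>] \<psi> unfolding characters_def
    by (intro extensionalityI[of _ "carrier (pi1 G v0)"]) auto
  with \<alpha>_form show thesis by (rule that)
qed

section \<open>Equality of the spectra\<close>

theorem theorem4p2:
  fixes G :: "('v, 'e) metric_graph" and v0 :: 'v
  assumes "quantum_graph G" and "v0 \<in> verts G"
  shows "\<exists>\<Phi>.
    bij_betw \<Phi> (carrier (H1_torus G))
      {\<psi> \<in> characters G v0. \<forall>\<gamma>\<in>carrier (pi1 G v0). cmod (\<psi> \<gamma>) = 1} \<and>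
    (\<forall>\<alpha>\<in>one_forms G. \<Phi> (torus_class G \<alpha>) = form_character G v0 \<alpha> \<and>
       pi1_spectrum G v0 (form_character G v0 \<alpha>) = Spec_form G \<alpha>) \<and>
    (\<forall>c\<in>carrier (H1_torus G). bloch_spectrum G c = pi1_spectrum G v0 (\<Phi> c))"
proof -
  define rep where "rep c = (SOME \<alpha>. \<alpha> \<in> one_forms G \<and> torus_class G \<alpha> = c)" for c
  define \<Phi> where "\<Phi> c = form_character G v0 (rep c)" for c
  have rep: "rep (torus_class G \<alpha>) \<in> one_forms G" "torus_class G (rep (torus_class G \<alpha>)) = torus_class G \<alpha>"
    if "\<alpha> \<in> one_forms G" for \<alpha>
    using someI[of "\<lambda>\<beta>. \<beta> \<in> one_forms G \<and> torus_class G \<beta> = torus_class G \<alpha>" \<alpha>] that by (auto simp: rep_def)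
  have same: "torus_class G \<alpha> = torus_class G \<beta> \<longleftrightarrow> form_character G v0 \<alpha> = form_character G v0 \<beta>"
    if "\<alpha> \<in> one_forms G" "\<beta> \<in> one_forms G" for \<alpha> \<beta>
    using torus_class_eq_iff[OF assms(1) that] form_character_eq_iff[OF assms that] by simp
  have \<Phi>: "\<Phi> (torus_class G \<alpha>) = form_character G v0 \<alpha>" if "\<alpha> \<in> one_forms G" for \<alpha>
    using same[OF rep(1)[OF that] that] rep(2)[OF that] by (simp add: \<Phi>_def)
  note spec = pi1_spectrum_eq_Spec_form[OF assms]
  let ?U = "{\<psi> \<in> characters G v0. \<forall>\<gamma>\<in>carrier (pi1 G v0). cmod (\<psi> \<gamma>) = 1}"
  have "bij_betw \<Phi> (carrier (H1_torus G)) ?U"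
    unfolding bij_betw_def
  proof
    show "inj_on \<Phi> (carrier (H1_torus G))"
    proof (rule inj_onI)
      fix c d assume "c \<in> carrier (H1_torus G)" "d \<in> carrier (H1_torus G)" and eq: "\<Phi> c = \<Phi> d"
      then obtain \<alpha> \<beta> where "c = torus_class G \<alpha>" "\<alpha> \<in> one_forms G" "d = torus_class G \<beta>" "\<beta> \<in> one_forms G"
        unfolding carrier_H1_torus by blast
      then show "c = d" using same[of \<alpha> \<beta>] \<Phi> eq by simp
    qed
    show "\<Phi> ` carrier (H1_torus G) = ?U"
    proof (intro equalityI subsetI)
      fix \<psi> assume "\<psi> \<in> \<Phi> ` carrier (H1_torus G)"
      then obtain \<alpha> where "\<psi> = form_character G v0 \<alpha>" unfolding carrier_H1_torus using \<Phi> by auto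
      then show "\<psi> \<in> ?U" using form_character_in_characters[OF assms, of \<alpha>] form_character_unitary[of _ G v0 \<alpha>] by blast
    next
      fix \<psi> assume "\<psi> \<in> ?U"
      then obtain \<alpha> where "\<alpha> \<in> one_forms G" "form_character G v0 \<alpha> = \<psi>"
        using unitary_character_from_form[OF assms, of \<psi>] by blast
      then show "\<psi> \<in> \<Phi> ` carrier (H1_torus G)" unfolding carrier_H1_torus using \<Phi> by force
    qed
  qed
  moreover have "bloch_spectrum G c = pi1_spectrum G v0 (\<Phi> c)" if c: "c \<in> carrier (H1_torus G)" for c
  proof -
    obtain \<alpha> where \<alpha>: "\<alpha> \<in> one_forms G" "c = torus_class G \<alpha>" using c unfolding carrier_H1_torus by blast
    have "Spec_form G \<beta> = Spec_form G \<alpha>" if "\<beta> \<in> one_forms G" "torus_class G \<beta> = c" for \<beta>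
      using same[OF that(1) \<alpha>(1)] that(2) \<alpha>(2) spec[OF that(1)] spec[OF \<alpha>(1)] by simp
    then have "Spec_form G ` {\<beta> \<in> one_forms G. torus_class G \<beta> = c}
        = (\<lambda>_. Spec_form G \<alpha>) ` {\<beta> \<in> one_forms G. torus_class G \<beta> = c}"
      by (intro image_cong) simp_all
    also have "\<dots> = {Spec_form G \<alpha>}" by (rule image_constant[of \<alpha>]) (simp add: \<alpha>)
    finally have "Spec_form G ` {\<beta> \<in> one_forms G. torus_class G \<beta> = c} = {Spec_form G \<alpha>}" .
    then show ?thesis using spec[OF \<alpha>(1)] \<Phi>[OF \<alpha>(1)] \<alpha>(2) by (simp add: bloch_spectrum_def)
  qed
  ultimately show ?thesis using \<Phi> spec by (intro exI[of _ \<Phi>]) blast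
qed

end
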